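(* Let $\sigma>0$, $c\in\mathbb{R}$ and $\mu\in\mathcal{S}'(\mathbb{R})$, and let $\{B(t):t\ge0\}$ be a standard one-dimensional Brownian motion. Let $\{Z(t):t\ge0\}$ be a process with sample paths in $C([0,\infty),\mathcal{S}'(\mathbb{R}))$ which solves the stochastic equation $$\langle Z(t),f\rangle=\langle\mu,f\rangle+\sigma B(t)f(c)+\int_0^t\langle Z(s),Af\rangle\,ds,\qquad t\ge0,\ f\in\mathcal{S}(\mathbb{R}).$$ Then almost surely $$\langle Z(t),f\rangle=\langle\mu,P_tf\rangle+\sigma\int_0^tP_{t-s}f(c)\,dB(s),\qquad t\ge0,\ f\in\mathcal{S}(\mathbb{R}).$$
   Context: $\mathcal{S}(\mathbb{R})$ is the Schwartz space of rapidly decreasing functions, $\mathcal{S}'(\mathbb{R})$ its dual with the strong topology, $\langle\cdot,\cdot\rangle$ the duality pairing. $A=\frac12\frac{d^2}{dx^2}$, and $(P_t)_{t\ge0}$ is the transition semigroup of one-dimensional standard Brownian motion (generated by $A$). *)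

theory Defs
  imports "HOL-Probability.Probability"
begin

section \<open>The Schwartz space\<close>

definition schwartz :: "(real \<Rightarrow> real) set" where
  "schwartz = {f. (\<forall>n x. (deriv ^^ n) f field_differentiable at x) \<and>
                  (\<forall>k n. \<exists>C. \<forall>x. \<bar>x ^ k * (deriv ^^ n) f x\<bar> \<le> C)}"

definition schwartz_seminorm :: "nat \<Rightarrow> nat \<Rightarrow> (real \<Rightarrow> real) \<Rightarrow> real" where
  "schwartz_seminorm k n f = (SUP x. \<bar>x ^ k * (deriv ^^ n) f x\<bar>)"

definition schwartz_nbhd :: "(real \<Rightarrow> real) \<Rightarrow> nat \<Rightarrow> real \<Rightarrow> (real \<Rightarrow> real) set" where
  "schwartz_nbhd f N e =
     {g \<in> schwartz. \<forall>k\<le>N. \<forall>n\<le>N. schwartz_seminorm k n (\<lambda>x. g x - f x) < e}"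

definition schwartz_topology :: "(real \<Rightarrow> real) topology" where
  "schwartz_topology =
     topology (\<lambda>U. U \<subseteq> schwartz \<and> (\<forall>f\<in>U. \<exists>N. \<exists>e>0. schwartz_nbhd f N e \<subseteq> U))"

definition schwartz_bounded :: "(real \<Rightarrow> real) set \<Rightarrow> bool" where
  "schwartz_bounded K \<longleftrightarrow> K \<subseteq> schwartz \<and> (\<forall>k n. bdd_above (schwartz_seminorm k n ` K))"

lemma istopology_schwartz:
  "istopology (\<lambda>U. U \<subseteq> schwartz \<and> (\<forall>f\<in>U. \<exists>N. \<exists>e>0. schwartz_nbhd f N e \<subseteq> U))"
proof -
  have mono: "schwartz_nbhd f (max N N') (min e e') \<subseteq> schwartz_nbhd f N e \<inter> schwartz_nbhd f N' e'"
    for f N N' e e'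
    by (auto simp: schwartz_nbhd_def)
  show ?thesis
    unfolding istopology_def
  proof (intro conjI allI impI)
    fix S T
    assume S: "S \<subseteq> schwartz \<and> (\<forall>f\<in>S. \<exists>N. \<exists>e>0. schwartz_nbhd f N e \<subseteq> S)"
      and T: "T \<subseteq> schwartz \<and> (\<forall>f\<in>T. \<exists>N. \<exists>e>0. schwartz_nbhd f N e \<subseteq> T)"
    show "S \<inter> T \<subseteq> schwartz" using S by blast
    show "\<forall>f\<in>S \<inter> T. \<exists>N. \<exists>e>0. schwartz_nbhd f N e \<subseteq> S \<inter> T"
    proof
      fix f assume f: "f \<in> S \<inter> T"
      then obtain N e where 1: "e > 0" "schwartz_nbhd f N e \<subseteq> S" using S by blast
      obtain N' e' where 2: "e' > 0" "schwartz_nbhd f N' e' \<subseteq> T" using f T by blast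
      have "min e e' > 0" "schwartz_nbhd f (max N N') (min e e') \<subseteq> S \<inter> T"
        using 1 2 mono[of f N N' e e'] by auto
      then show "\<exists>N. \<exists>e>0. schwartz_nbhd f N e \<subseteq> S \<inter> T" by blast
    qed
  next
    fix \<K>
    assume \<K>: "\<forall>U\<in>\<K>. U \<subseteq> schwartz \<and> (\<forall>f\<in>U. \<exists>N. \<exists>e>0. schwartz_nbhd f N e \<subseteq> U)"
    show "\<Union>\<K> \<subseteq> schwartz" using \<K> by blast
    show "\<forall>f\<in>\<Union>\<K>. \<exists>N. \<exists>e>0. schwartz_nbhd f N e \<subseteq> \<Union>\<K>"
      using \<K> by (meson Union_iff Union_upper subset_trans)
  qed
qed

lemma openin_schwartz_topology:
  "openin schwartz_topology U \<longleftrightarrow>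
     U \<subseteq> schwartz \<and> (\<forall>f\<in>U. \<exists>N. \<exists>e>0. schwartz_nbhd f N e \<subseteq> U)"
  unfolding schwartz_topology_def by (subst topology_inverse'[OF istopology_schwartz]) (rule refl)

lemma topspace_schwartz_topology [simp]: "topspace schwartz_topology = schwartz"
proof
  show "topspace schwartz_topology \<subseteq> schwartz"
    using openin_schwartz_topology openin_topspace by blast
  have "openin schwartz_topology schwartz"
    unfolding openin_schwartz_topology by (auto simp: schwartz_nbhd_def intro: exI[of _ 1])
  then show "schwartz \<subseteq> topspace schwartz_topology" by (rule openin_subset)
qed


section \<open>Its strong dual\<close>

text \<open>Functionals are extensional, i.e. \<^const>\<open>undefined\<close> off \<^const>\<open>schwartz\<close>, so that
  equality in the dual is equality on \<^const>\<open>schwartz\<close>.\<close>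

definition tempered :: "((real \<Rightarrow> real) \<Rightarrow> real) set" where
  "tempered = {\<phi> \<in> extensional schwartz.
     (\<forall>f\<in>schwartz. \<forall>g\<in>schwartz. \<forall>a b. \<phi> (\<lambda>x. a * f x + b * g x) = a * \<phi> f + b * \<phi> g) \<and>
     continuous_map schwartz_topology euclideanreal \<phi>}"

definition tempered_nbhd ::
    "((real \<Rightarrow> real) \<Rightarrow> real) \<Rightarrow> (real \<Rightarrow> real) set \<Rightarrow> real \<Rightarrow> ((real \<Rightarrow> real) \<Rightarrow> real) set" where
  "tempered_nbhd \<phi> K e = {\<psi> \<in> tempered. \<forall>f\<in>K. \<bar>\<psi> f - \<phi> f\<bar> < e}"

text \<open>The topology of uniform convergence on bounded subsets of the Schwartz space.\<close>

definition strong_dual_topology :: "((real \<Rightarrow> real) \<Rightarrow> real) topology" where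
  "strong_dual_topology =
     topology (\<lambda>U. U \<subseteq> tempered \<and>
       (\<forall>\<phi>\<in>U. \<exists>K e. schwartz_bounded K \<and> e > 0 \<and> tempered_nbhd \<phi> K e \<subseteq> U))"

lemma schwartz_bounded_Un:
  assumes "schwartz_bounded K" "schwartz_bounded L"
  shows "schwartz_bounded (K \<union> L)"
  using assms by (auto simp: schwartz_bounded_def image_Un)

lemma istopology_strong_dual:
  "istopology (\<lambda>U. U \<subseteq> tempered \<and>
     (\<forall>\<phi>\<in>U. \<exists>K e. schwartz_bounded K \<and> e > 0 \<and> tempered_nbhd \<phi> K e \<subseteq> U))"
proof -
  have mono: "tempered_nbhd \<phi> (K \<union> K') (min e e') \<subseteq> tempered_nbhd \<phi> K e \<inter> tempered_nbhd \<phi> K' e'"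
    for \<phi> K K' e e'
    by (auto simp: tempered_nbhd_def)
  show ?thesis
    unfolding istopology_def
  proof (intro conjI allI impI)
    fix S T
    assume S: "S \<subseteq> tempered \<and>
        (\<forall>\<phi>\<in>S. \<exists>K e. schwartz_bounded K \<and> e > 0 \<and> tempered_nbhd \<phi> K e \<subseteq> S)"
      and T: "T \<subseteq> tempered \<and>
        (\<forall>\<phi>\<in>T. \<exists>K e. schwartz_bounded K \<and> e > 0 \<and> tempered_nbhd \<phi> K e \<subseteq> T)"
    show "S \<inter> T \<subseteq> tempered" using S by blast
    show "\<forall>\<phi>\<in>S \<inter> T. \<exists>K e. schwartz_bounded K \<and> e > 0 \<and> tempered_nbhd \<phi> K e \<subseteq> S \<inter> T"
    proof
      fix \<phi> assume \<phi>: "\<phi> \<in> S \<inter> T"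
      then obtain K e where 1: "schwartz_bounded K" "e > 0" "tempered_nbhd \<phi> K e \<subseteq> S"
        using S by blast
      obtain K' e' where 2: "schwartz_bounded K'" "e' > 0" "tempered_nbhd \<phi> K' e' \<subseteq> T"
        using \<phi> T by blast
      have "schwartz_bounded (K \<union> K')" "min e e' > 0"
           "tempered_nbhd \<phi> (K \<union> K') (min e e') \<subseteq> S \<inter> T"
        using 1 2 mono[of \<phi> K K' e e'] schwartz_bounded_Un by auto
      then show "\<exists>K e. schwartz_bounded K \<and> e > 0 \<and> tempered_nbhd \<phi> K e \<subseteq> S \<inter> T" by blast
    qed
  next
    fix \<K>
    assume \<K>: "\<forall>U\<in>\<K>. U \<subseteq> tempered \<and>
        (\<forall>\<phi>\<in>U. \<exists>K e. schwartz_bounded K \<and> e > 0 \<and> tempered_nbhd \<phi> K e \<subseteq> U)"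
    show "\<Union>\<K> \<subseteq> tempered" using \<K> by blast
    show "\<forall>\<phi>\<in>\<Union>\<K>. \<exists>K e. schwartz_bounded K \<and> e > 0 \<and> tempered_nbhd \<phi> K e \<subseteq> \<Union>\<K>"
      using \<K> by (meson Union_iff Union_upper subset_trans)
  qed
qed

lemma openin_strong_dual_topology:
  "openin strong_dual_topology U \<longleftrightarrow>
     U \<subseteq> tempered \<and> (\<forall>\<phi>\<in>U. \<exists>K e. schwartz_bounded K \<and> e > 0 \<and> tempered_nbhd \<phi> K e \<subseteq> U)"
  unfolding strong_dual_topology_def by (subst topology_inverse'[OF istopology_strong_dual]) (rule refl)

lemma topspace_strong_dual_topology [simp]: "topspace strong_dual_topology = tempered"
proof
  show "topspace strong_dual_topology \<subseteq> tempered"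
    using openin_strong_dual_topology openin_topspace by blast
  have "schwartz_bounded {}" by (simp add: schwartz_bounded_def)
  then have "openin strong_dual_topology tempered"
    unfolding openin_strong_dual_topology
    by (auto simp: tempered_nbhd_def intro!: exI[of _ "{}"] exI[of _ 1])
  then show "tempered \<subseteq> topspace strong_dual_topology" by (rule openin_subset)
qed


section \<open>The generator and the semigroup\<close>

definition half_laplacian :: "(real \<Rightarrow> real) \<Rightarrow> real \<Rightarrow> real" where
  "half_laplacian f x = (1 / 2) * deriv (deriv f) x"

definition brownian_semigroup :: "real \<Rightarrow> (real \<Rightarrow> real) \<Rightarrow> real \<Rightarrow> real" where
  "brownian_semigroup t f x =
     (if t = 0 then f x else (LINT y|lborel. normal_density x (sqrt t) y * f y))"


section \<open>Brownian motion and the Wiener integral\<close>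

definition standard_brownian_motion :: "'a measure \<Rightarrow> (real \<Rightarrow> 'a \<Rightarrow> real) \<Rightarrow> bool" where
  "standard_brownian_motion M B \<longleftrightarrow>
     (\<forall>t\<ge>0. B t \<in> borel_measurable M) \<and>
     (AE \<omega> in M. B 0 \<omega> = 0) \<and>
     (\<forall>n. \<forall>u :: nat \<Rightarrow> real. 0 \<le> u 0 \<and> (\<forall>i<n. u i \<le> u (Suc i)) \<longrightarrow>
        prob_space.indep_vars M (\<lambda>_. borel) (\<lambda>i \<omega>. B (u (Suc i)) \<omega> - B (u i) \<omega>) {..<n}) \<and>
     (\<forall>s t. 0 \<le> s \<and> s < t \<longrightarrow>
        distributed M lborel (\<lambda>\<omega>. B t \<omega> - B s \<omega>) (normal_density 0 (sqrt (t - s)))) \<and>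
     (AE \<omega> in M. continuous_on {0..} (\<lambda>t. B t \<omega>))"

definition is_partition :: "real \<Rightarrow> nat \<Rightarrow> (nat \<Rightarrow> real) \<Rightarrow> bool" where
  "is_partition t n u \<longleftrightarrow> u 0 = 0 \<and> u n = t \<and> (\<forall>i<n. u i \<le> u (Suc i))"

definition step_function :: "nat \<Rightarrow> (nat \<Rightarrow> real) \<Rightarrow> (nat \<Rightarrow> real) \<Rightarrow> real \<Rightarrow> real" where
  "step_function n u a s = (\<Sum>i<n. a i * indicator {u i<..u (Suc i)} s)"

definition step_integral ::
    "(real \<Rightarrow> 'a \<Rightarrow> real) \<Rightarrow> nat \<Rightarrow> (nat \<Rightarrow> real) \<Rightarrow> (nat \<Rightarrow> real) \<Rightarrow> 'a \<Rightarrow> real" where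
  "step_integral B n u a \<omega> = (\<Sum>i<n. a i * (B (u (Suc i)) \<omega> - B (u i) \<omega>))"

text \<open>The random variable \<open>X\<close> is a version of the stochastic integral of the deterministic
  function \<open>h\<close> over \<open>[0, t]\<close> with respect to \<open>B\<close>: it is the limit in mean square of the
  elementary integrals of step functions converging to \<open>h\<close> in \<open>L\<^sup>2([0, t])\<close>. By the Ito
  isometry it is determined up to almost sure equality. The nonnegative integrals
  avoid the convention that the Bochner integral of a non-integrable function is 0.\<close>

definition is_wiener_integral ::
    "'a measure \<Rightarrow> (real \<Rightarrow> 'a \<Rightarrow> real) \<Rightarrow> real \<Rightarrow> (real \<Rightarrow> real) \<Rightarrow> ('a \<Rightarrow> real) \<Rightarrow> bool" where
  "is_wiener_integral M B t h X \<longleftrightarrow>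
     set_borel_measurable lborel {0..t} h \<and> X \<in> borel_measurable M \<and>
     (\<exists>n u a. (\<forall>m. is_partition t (n m) (u m)) \<and>
        (\<lambda>m. \<integral>\<^sup>+ s\<in>{0..t}. ennreal ((h s - step_function (n m) (u m) (a m) s)\<^sup>2) \<partial>lborel)
          \<longlonglongrightarrow> 0 \<and>
        (\<lambda>m. \<integral>\<^sup>+ \<omega>. ennreal ((X \<omega> - step_integral B (n m) (u m) (a m) \<omega>)\<^sup>2) \<partial>M)
          \<longlonglongrightarrow> 0)"

text \<open>For each \<open>t\<close> and \<open>f\<close> the stochastic integral of \<open>s \<mapsto> P\<^bsub>t-s\<^esub>f(c)\<close> over \<open>[0, t]\<close> is
  determined only up to a null set depending on \<open>t\<close> and \<open>f\<close>. A statement holding almost surely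
  for all \<open>t\<close> and \<open>f\<close> at once refers to a version of the whole family whose paths lie in
  \<open>C([0,\<infinity>), S'(\<real>))\<close>; such a version is unique up to indistinguishability.\<close>

definition is_stochastic_convolution ::
    "'a measure \<Rightarrow> (real \<Rightarrow> 'a \<Rightarrow> real) \<Rightarrow> real \<Rightarrow> (real \<Rightarrow> 'a \<Rightarrow> (real \<Rightarrow> real) \<Rightarrow> real) \<Rightarrow> bool" where
  "is_stochastic_convolution M B c J \<longleftrightarrow>
     (\<forall>t\<ge>0. \<forall>f\<in>schwartz.
        is_wiener_integral M B t (\<lambda>s. brownian_semigroup (t - s) f c) (\<lambda>\<omega>. J t \<omega> f)) \<and>
     (\<forall>\<omega>\<in>space M. continuous_map (top_of_set {0..}) strong_dual_topology (\<lambda>t. J t \<omega>))"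

end

theory Submission
  imports Defs
begin

text \<open>For a tempered distribution \<open>\<phi>\<close> the function \<open>r \<mapsto> \<langle>\<phi>, P\<^sub>r f\<rangle>\<close> has derivative \<open>\<langle>\<phi>, P\<^sub>r A f\<rangle>\<close>. Testing the
  equation at the points \<open>s\<close> of a uniform grid of \<open>[0, t]\<close> against \<open>P\<^bsub>t-s\<^esub> f\<close> and telescoping,
  the drift terms cancel in the limit, so almost surely the step integrals of \<open>s \<mapsto> P\<^bsub>t-s\<^esub> f(c)\<close> converge to
  \<open>(\<langle>Z(t), f\<rangle> - \<langle>\<mu>, P\<^sub>t f\<rangle>) / \<sigma>\<close>, which is therefore a version of the Wiener integral. Its paths are strongly
  continuous in \<open>t\<close>, so it is a stochastic convolution. Any other one agrees with it almost surely for
  each \<open>t\<close> and \<open>f\<close>, hence simultaneously for all rational \<open>t\<close> and all \<open>f\<close> in a countable dense set,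
  hence for all \<open>t\<close> and \<open>f\<close> by continuity.\<close>

subsection \<open>Schwartz functions\<close>

text \<open>Two obstacles shape the proof. The equation holds outside a null set that depends on
  \<open>t\<close> and \<open>f\<close>, so along one path it can be used only for countably many
  pairs fixed beforehand. Grid points \<open>u i\<close> with test functions
  \<open>P (t - u j) f\<close> are such pairs; this is why Riemann sums stand in for an integral
  over time-dependent test functions. Next, facts about \<open>P_t\<close> must pass through
  arbitrary tempered functionals, so they are proved as estimates in Schwartz norms, which a
  functional inherits through one bound \<open>C * schwartz_norm N\<close>. These estimates come
  from writing \<open>P_t f(x)\<close> as the mean of \<open>f (x + sqrt t * Z)\<close> with
  \<open>Z\<close> standard normal: \<open>t\<close> enters only through the argument of
  \<open>f\<close>, time 0 fits the same formula, and Gaussian integration by parts yields the heat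
  equation. Finally, a claim about every \<open>J\<close> says something only if some
  \<open>J\<close> exists, so a version with continuous paths is extracted from the solution
  itself.\<close>

lemma schwartz_has_derivative:
  assumes "f \<in> schwartz"
  shows "((deriv ^^ n) f has_field_derivative (deriv ^^ Suc n) f x) (at x)"
  using assms by (simp add: schwartz_def DERIV_deriv_iff_field_differentiable)

text \<open>Membership in \<open>schwartz\<close> and formulas for \<open>deriv ^^ n\<close> are
  both reduced to guessing the whole tower of derivatives and checking a single differentiation
  step.\<close>

lemma iterated_derivs_eq:
  assumes "\<And>n x. (F n has_field_derivative F (Suc n) x) (at x)"
  shows "(deriv ^^ n) (F 0) = F n"
proof (induction n)
  case (Suc n)
  have "deriv (F n) = F (Suc n)"
    using assms by (intro ext DERIV_imp_deriv)
  then show ?case using Suc by simp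
qed simp

lemma schwartz_by_derivs:
  assumes "\<And>n x. (F n has_field_derivative F (Suc n) x) (at x)"
    and "\<And>k n. \<exists>C. \<forall>x. \<bar>x ^ k * F n x\<bar> \<le> C"
  shows "F 0 \<in> schwartz"
  unfolding schwartz_def using assms
  by (auto simp: iterated_derivs_eq[of F] field_differentiable_def)

text \<open>A real supremum dominates its members only over a range bounded above, and this is where
  membership in \<open>schwartz\<close> enters every estimate.\<close>

lemma schwartz_seminorm_upper:
  assumes "f \<in> schwartz"
  shows "\<bar>x ^ k * (deriv ^^ n) f x\<bar> \<le> schwartz_seminorm k n f"
proof -
  obtain C where "\<forall>x. \<bar>x ^ k * (deriv ^^ n) f x\<bar> \<le> C"
    using assms unfolding schwartz_def by blast
  then have "bdd_above (range (\<lambda>x. \<bar>x ^ k * (deriv ^^ n) f x\<bar>))" by (auto intro: bdd_aboveI)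
  then show ?thesis unfolding schwartz_seminorm_def by (rule cSUP_upper[rotated]) simp
qed

lemma schwartz_deriv_bounded:
  assumes "f \<in> schwartz"
  shows "\<bar>(deriv ^^ n) f x\<bar> \<le> schwartz_seminorm 0 n f"
  using schwartz_seminorm_upper[OF assms, of x 0 n] by simp

lemma schwartz_seminorm_least:
  assumes "\<And>x. \<bar>x ^ k * (deriv ^^ n) f x\<bar> \<le> C"
  shows "schwartz_seminorm k n f \<le> C"
  unfolding schwartz_seminorm_def by (rule cSUP_least) (use assms in auto)

lemma schwartz_seminorm_nonneg:
  assumes "f \<in> schwartz"
  shows "0 \<le> schwartz_seminorm k n f"
  using schwartz_seminorm_upper[OF assms, of 0 k n] by linarith

lemma
  assumes "f \<in> schwartz" "g \<in> schwartz"
  shows schwartz_lincomb: "(\<lambda>x. a * f x + b * g x) \<in> schwartz"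
    and derivs_lincomb:
      "(deriv ^^ n) (\<lambda>x. a * f x + b * g x) = (\<lambda>x. a * (deriv ^^ n) f x + b * (deriv ^^ n) g x)"
proof -
  let ?F = "\<lambda>n x. a * (deriv ^^ n) f x + b * (deriv ^^ n) g x"
  have d: "(?F n has_field_derivative ?F (Suc n) x) (at x)" for n x
    by (intro DERIV_add DERIV_cmult schwartz_has_derivative assms)
  have "\<bar>x ^ k * ?F n x\<bar> \<le> \<bar>a\<bar> * schwartz_seminorm k n f + \<bar>b\<bar> * schwartz_seminorm k n g" for x k n
  proof -
    have "\<bar>x ^ k * ?F n x\<bar> = \<bar>a * (x ^ k * (deriv ^^ n) f x) + b * (x ^ k * (deriv ^^ n) g x)\<bar>"
      by (simp add: algebra_simps)
    also have "\<dots> \<le> \<bar>a\<bar> * \<bar>x ^ k * (deriv ^^ n) f x\<bar> + \<bar>b\<bar> * \<bar>x ^ k * (deriv ^^ n) g x\<bar>"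
      by (rule order_trans[OF abs_triangle_ineq]) (simp add: abs_mult)
    also have "\<dots> \<le> \<bar>a\<bar> * schwartz_seminorm k n f + \<bar>b\<bar> * schwartz_seminorm k n g"
      by (intro add_mono mult_left_mono schwartz_seminorm_upper assms) auto
    finally show ?thesis .
  qed
  then show "(\<lambda>x. a * f x + b * g x) \<in> schwartz"
    using schwartz_by_derivs[of ?F, OF d] by auto
  show "(deriv ^^ n) (\<lambda>x. a * f x + b * g x) = ?F n"
    using iterated_derivs_eq[of ?F n, OF d] by simp
qed

lemma schwartz_diff:
  assumes "f \<in> schwartz" "g \<in> schwartz"
  shows "(\<lambda>x. f x - g x) \<in> schwartz"
  using schwartz_lincomb[OF assms, of 1 "-1"] by simp

lemma derivs_diff:
  assumes "f \<in> schwartz" "g \<in> schwartz"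
  shows "(deriv ^^ n) (\<lambda>x. f x - g x) = (\<lambda>x. (deriv ^^ n) f x - (deriv ^^ n) g x)"
  using derivs_lincomb[OF assms, of n 1 "-1"] by simp

lemma schwartz_seminorm_lincomb:
  assumes "f \<in> schwartz" "g \<in> schwartz"
  shows "schwartz_seminorm k n (\<lambda>x. a * f x + b * g x)
    \<le> \<bar>a\<bar> * schwartz_seminorm k n f + \<bar>b\<bar> * schwartz_seminorm k n g"
proof (rule schwartz_seminorm_least)
  fix x
  have "\<bar>x ^ k * (deriv ^^ n) (\<lambda>x. a * f x + b * g x) x\<bar>
      = \<bar>a * (x ^ k * (deriv ^^ n) f x) + b * (x ^ k * (deriv ^^ n) g x)\<bar>"
    by (simp add: derivs_lincomb[OF assms] algebra_simps)
  also have "\<dots> \<le> \<bar>a\<bar> * \<bar>x ^ k * (deriv ^^ n) f x\<bar> + \<bar>b\<bar> * \<bar>x ^ k * (deriv ^^ n) g x\<bar>"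
    by (rule order_trans[OF abs_triangle_ineq]) (simp add: abs_mult)
  also have "\<dots> \<le> \<bar>a\<bar> * schwartz_seminorm k n f + \<bar>b\<bar> * schwartz_seminorm k n g"
    by (intro add_mono mult_left_mono schwartz_seminorm_upper assms) auto
  finally show "\<bar>x ^ k * (deriv ^^ n) (\<lambda>x. a * f x + b * g x) x\<bar>
      \<le> \<bar>a\<bar> * schwartz_seminorm k n f + \<bar>b\<bar> * schwartz_seminorm k n g" .
qed

lemma schwartz_zero: "(\<lambda>x. 0) \<in> schwartz"
  using schwartz_by_derivs[of "\<lambda>_ _. 0"] by auto

lemma half_laplacian_eq: "half_laplacian f = (\<lambda>x. (1 / 2) * (deriv ^^ 2) f x)"
  by (auto simp: half_laplacian_def numeral_2_eq_2)

lemma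
  assumes "f \<in> schwartz"
  shows schwartz_half_laplacian: "half_laplacian f \<in> schwartz"
    and derivs_half_laplacian: "(deriv ^^ n) (half_laplacian f) = (\<lambda>x. (1 / 2) * (deriv ^^ (n + 2)) f x)"
proof -
  let ?F = "\<lambda>n x. (1 / 2) * (deriv ^^ (n + 2)) f x"
  have d: "(?F n has_field_derivative ?F (Suc n) x) (at x)" for n x
    using schwartz_has_derivative[OF assms, of "n + 2" x] by (auto intro!: derivative_eq_intros)
  have "\<bar>x ^ k * ?F n x\<bar> \<le> schwartz_seminorm k (n + 2) f" for x k n
    using schwartz_seminorm_upper[OF assms, of x k "n + 2"] schwartz_seminorm_nonneg[OF assms, of k "n + 2"]
    by (simp add: abs_mult)
  then show "half_laplacian f \<in> schwartz"
    using schwartz_by_derivs[of ?F, OF d] by (auto simp: half_laplacian_eq numeral_2_eq_2)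
  show "(deriv ^^ n) (half_laplacian f) = ?F n"
    using iterated_derivs_eq[of ?F n, OF d] by (simp add: half_laplacian_eq numeral_2_eq_2)
qed

lemma schwartz_seminorm_half_laplacian:
  assumes "f \<in> schwartz"
  shows "schwartz_seminorm k n (half_laplacian f) \<le> schwartz_seminorm k (n + 2) f"
  by (rule schwartz_seminorm_least)
    (use schwartz_seminorm_upper[OF assms, of _ k "n + 2"] schwartz_seminorm_nonneg[OF assms, of k "n + 2"]
     in \<open>auto simp: derivs_half_laplacian[OF assms] abs_mult intro: order_trans[where y = "schwartz_seminorm k (Suc (Suc n)) f"]\<close>)

text \<open>A sum instead of a maximum, so that bounds add up termwise. These norms increase with
  \<open>N\<close>, and a linear functional is continuous on \<open>schwartz\<close> exactly when a
  multiple of one of them bounds it. The factor \<open>(real N + 1)\<^sup>2\<close> below counts the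
  pairs \<open>(k, n)\<close>.\<close>

definition schwartz_norm :: "nat \<Rightarrow> (real \<Rightarrow> real) \<Rightarrow> real" where
  "schwartz_norm N f = (\<Sum>k\<le>N. \<Sum>n\<le>N. schwartz_seminorm k n f)"

lemma schwartz_norm_nonneg: "f \<in> schwartz \<Longrightarrow> 0 \<le> schwartz_norm N f"
  unfolding schwartz_norm_def by (intro sum_nonneg schwartz_seminorm_nonneg)

lemma schwartz_seminorm_le_norm:
  assumes "f \<in> schwartz" "k \<le> N" "n \<le> N"
  shows "schwartz_seminorm k n f \<le> schwartz_norm N f"
proof -
  have "schwartz_seminorm k n f \<le> (\<Sum>n\<le>N. schwartz_seminorm k n f)"
    by (rule member_le_sum) (use assms schwartz_seminorm_nonneg in auto)
  also have "\<dots> \<le> schwartz_norm N f"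
    unfolding schwartz_norm_def
    by (rule member_le_sum[where f = "\<lambda>k. \<Sum>n\<le>N. schwartz_seminorm k n f"])
      (use assms schwartz_seminorm_nonneg in \<open>auto intro: sum_nonneg\<close>)
  finally show ?thesis .
qed

lemma schwartz_norm_mono:
  assumes "f \<in> schwartz" "n \<le> m"
  shows "schwartz_norm n f \<le> schwartz_norm m f"
proof -
  have "schwartz_norm n f \<le> (\<Sum>k\<le>n. \<Sum>j\<le>m. schwartz_seminorm k j f)"
    unfolding schwartz_norm_def
    by (intro sum_mono sum_mono2) (use assms schwartz_seminorm_nonneg in auto)
  also have "\<dots> \<le> schwartz_norm m f"
    unfolding schwartz_norm_def
    by (intro sum_mono2) (use assms schwartz_seminorm_nonneg in \<open>auto intro: sum_nonneg\<close>)
  finally show ?thesis .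
qed

lemma schwartz_norm_le:
  assumes "\<And>k n. k \<le> N \<Longrightarrow> n \<le> N \<Longrightarrow> schwartz_seminorm k n f \<le> C"
  shows "schwartz_norm N f \<le> (real N + 1)\<^sup>2 * C"
proof -
  have "schwartz_norm N f \<le> (\<Sum>k\<le>N. \<Sum>n\<le>N. C)"
    unfolding schwartz_norm_def by (intro sum_mono assms) auto
  then show ?thesis by (simp add: power2_eq_square algebra_simps)
qed

lemma schwartz_norm_half_laplacian:
  assumes "f \<in> schwartz"
  shows "schwartz_norm N (half_laplacian f) \<le> (real N + 1)\<^sup>2 * schwartz_norm (N + 2) f"
proof (rule schwartz_norm_le)
  fix k n assume "k \<le> N" "n \<le> N"
  then show "schwartz_seminorm k n (half_laplacian f) \<le> schwartz_norm (N + 2) f"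
    using schwartz_seminorm_half_laplacian[OF assms, of k n]
      schwartz_seminorm_le_norm[OF assms, of k "N + 2" "n + 2"] by simp
qed

lemma schwartz_bounded_norm:
  assumes "schwartz_bounded K"
  obtains M where "M > 0" "\<And>f. f \<in> K \<Longrightarrow> schwartz_norm N f \<le> M"
proof -
  have "\<exists>C. \<forall>f\<in>K. schwartz_seminorm k n f \<le> C" for k n
    using assms unfolding schwartz_bounded_def bdd_above_def by auto
  then obtain C where C: "\<And>k n f. f \<in> K \<Longrightarrow> schwartz_seminorm k n f \<le> C k n" by metis
  have "schwartz_norm N f \<le> \<bar>\<Sum>k\<le>N. \<Sum>n\<le>N. C k n\<bar> + 1" if "f \<in> K" for f
  proof -
    have "schwartz_norm N f \<le> (\<Sum>k\<le>N. \<Sum>n\<le>N. C k n)"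
      unfolding schwartz_norm_def by (intro sum_mono C that)
    then show ?thesis by linarith
  qed
  then show ?thesis by (intro that[of "\<bar>\<Sum>k\<le>N. \<Sum>n\<le>N. C k n\<bar> + 1"]) auto
qed

subsection \<open>Gaussian averages and the heat semigroup\<close>

text \<open>The heat semigroup at time \<open>s\<^sup>2\<close>, with the density kept fixed and the
  parameter moved into the argument of \<open>f\<close>. For Schwartz \<open>f\<close> it is
  differentiable in \<open>s\<close> also at 0, where the heat kernel degenerates.\<close>

definition gauss_avg :: "real \<Rightarrow> (real \<Rightarrow> real) \<Rightarrow> real \<Rightarrow> real" where
  "gauss_avg s f x = (LINT z|lborel. std_normal_density z * f (x + s * z))"

lemma brownian_semigroup_eq_gauss_avg:
  assumes "t \<ge> 0"
  shows "brownian_semigroup t f x = gauss_avg (sqrt t) f x"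
proof (cases "t = 0")
  case True
  then show ?thesis by (simp add: brownian_semigroup_def gauss_avg_def)
next
  case False
  then have t: "sqrt t > 0" using assms by simp
  have "normal_density x (sqrt t) (x + sqrt t * z) * sqrt t = std_normal_density z" for z
    using assms False
    by (simp add: normal_density_def power_mult_distrib real_sqrt_mult)
  then have eq: "sqrt t * (normal_density x (sqrt t) (x + sqrt t * z) * f (x + sqrt t * z))
      = std_normal_density z * f (x + sqrt t * z)" for z
    by (metis mult.assoc mult.commute)
  then show ?thesis
    using lborel_integral_real_affine[of "sqrt t" "\<lambda>y. normal_density x (sqrt t) y * f y" x] t False
    unfolding brownian_semigroup_def gauss_avg_def
    by (simp add: eq flip: integral_mult_right_zero)
qed

section \<open>Differentiation and integration by parts under Gaussian integrals\<close>

lemma integrable_gauss_mult: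
  fixes g :: "real \<Rightarrow> real"
  assumes [measurable]: "g \<in> borel_measurable borel"
    and bound: "\<And>z. \<bar>g z\<bar> \<le> U + V * \<bar>z\<bar> ^ k"
  shows "integrable lborel (\<lambda>z. std_normal_density z * g z)"
proof (rule Bochner_Integration.integrable_bound)
  show "integrable lborel (\<lambda>z. U * std_normal_density z + V * (std_normal_density z * \<bar>z\<bar> ^ k))"
    by (intro Bochner_Integration.integrable_add integrable_mult_right integrable_std_normal_moment_abs) auto
  show "AE z in lborel. norm (std_normal_density z * g z)
      \<le> norm (U * std_normal_density z + V * (std_normal_density z * \<bar>z\<bar> ^ k))"
  proof (intro AE_I2)
    fix z :: real
    have "norm (std_normal_density z * g z) = std_normal_density z * \<bar>g z\<bar>"
      by (simp add: abs_mult)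
    also have "\<dots> \<le> std_normal_density z * (U + V * \<bar>z\<bar> ^ k)"
      by (intro mult_left_mono bound) auto
    also have "\<dots> = U * std_normal_density z + V * (std_normal_density z * \<bar>z\<bar> ^ k)"
      by (simp add: algebra_simps)
    finally show "norm (std_normal_density z * g z)
      \<le> norm (U * std_normal_density z + V * (std_normal_density z * \<bar>z\<bar> ^ k))"
      by simp
  qed
qed measurable

text \<open>An explicit quadratic remainder survives both integration and the application of a
  bounded functional, so this criterion serves for Gaussian integrals as well as for
  \<open>\<phi> (P_r f)\<close>, without interchanging limits.\<close>

lemma has_real_derivative_by_quadratic_bound:
  fixes F :: "real \<Rightarrow> real"
  assumes "\<delta> > 0" and bound: "\<And>h. \<bar>h\<bar> < \<delta> \<Longrightarrow> \<bar>F (x + h) - F x - h * D\<bar> \<le> K * h\<^sup>2"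
  shows "(F has_real_derivative D) (at x)"
  unfolding DERIV_def
proof (rule LIM_I)
  fix r :: real assume r: "r > 0"
  \<comment> \<open>\<open>\<bar>K\<bar> + 1\<close> is positive whatever the sign of
    \<open>K\<close>.\<close>
  define d where "d = min \<delta> (r / (\<bar>K\<bar> + 1))"
  have "d > 0" using r \<open>\<delta> > 0\<close> by (simp add: d_def)
  moreover have "norm ((F (x + h) - F x) / h - D) < r" if h: "h \<noteq> 0 \<and> norm (h - 0) < d" for h
  proof -
    have "norm ((F (x + h) - F x) / h - D) = \<bar>F (x + h) - F x - h * D\<bar> / \<bar>h\<bar>"
      using h by (simp add: field_simps flip: abs_divide)
    also have "\<dots> \<le> K * h\<^sup>2 / \<bar>h\<bar>" by (intro divide_right_mono bound) (use h in \<open>auto simp: d_def\<close>)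
    also have "\<dots> = K * \<bar>h\<bar>" using h by (simp add: power2_eq_square divide_simps)
    also have "\<dots> \<le> (\<bar>K\<bar> + 1) * \<bar>h\<bar>" by (intro mult_right_mono) auto
    also have "\<dots> < (\<bar>K\<bar> + 1) * d" using h by (intro mult_strict_left_mono) auto
    also have "\<dots> \<le> (\<bar>K\<bar> + 1) * (r / (\<bar>K\<bar> + 1))" by (intro mult_left_mono) (auto simp: d_def)
    also have "\<dots> = r" by simp
    finally show ?thesis .
  qed
  ultimately show "\<exists>s>0. \<forall>h. h \<noteq> 0 \<and> norm (h - 0) < s \<longrightarrow> norm ((F (x + h) - F x) / h - D) < r"
    by blast
qed

lemma taylor_quadratic_bound:
  fixes g :: "real \<Rightarrow> real"
  assumes "\<And>x. (g has_field_derivative g' x) (at x)"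
    and "\<And>x. (g' has_field_derivative g'' x) (at x)"
    and "\<And>x. \<bar>g'' x\<bar> \<le> C"
  shows "\<bar>g (y + v) - g y - v * g' y\<bar> \<le> C * v\<^sup>2"
proof -
  let ?f = "\<lambda>i::nat. if i = 0 then g else if i = 1 then g' else g''"
  have "norm (?f 0 (y + v) - (\<Sum>i\<le>1. ?f i y * (y + v - y) ^ i / fact i))
      \<le> C * norm (y + v - y) ^ Suc 1 / fact 1"
    by (rule field_Taylor[where S = UNIV]) (use assms in \<open>auto split: if_splits\<close>)
  then show ?thesis by (simp add: power2_eq_square algebra_simps)
qed

text \<open>The affine family in \<open>\<theta>\<close> covers both derivatives of
  \<open>gauss_avg s f x\<close>: \<open>\<theta>\<close> is the space variable in one use and the
  scale in the other. Taylor's remainder is at most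
  \<open>C2 * h\<^sup>2 * (b0 + b1 * z)\<^sup>2\<close>, integrable because the Gaussian has a
  second moment.\<close>

lemma gauss_integral_has_derivative:
  fixes g :: "real \<Rightarrow> real"
  assumes g: "\<And>x. (g has_field_derivative g' x) (at x)"
    and g': "\<And>x. (g' has_field_derivative g'' x) (at x)"
    and bounds: "\<And>x. \<bar>g x\<bar> \<le> C0" "\<And>x. \<bar>g' x\<bar> \<le> C1" "\<And>x. \<bar>g'' x\<bar> \<le> C2"
  shows "((\<lambda>\<theta>. LINT z|lborel. std_normal_density z * g (a0 + a1 * z + \<theta> * (b0 + b1 * z)))
    has_field_derivative
     (LINT z|lborel. std_normal_density z * ((b0 + b1 * z) * g' (a0 + a1 * z + \<theta> * (b0 + b1 * z))))) (at \<theta>)"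
proof (rule has_real_derivative_by_quadratic_bound[OF zero_less_one])
  fix h :: real
  define Y where "Y \<theta> z = a0 + a1 * z + \<theta> * (b0 + b1 * z)" for \<theta> z
  have [measurable]: "g \<in> borel_measurable borel" "g' \<in> borel_measurable borel"
    using g g' by (auto intro!: borel_measurable_continuous_onI continuous_at_imp_continuous_on
        intro: DERIV_isCont)
  have [measurable]: "Y \<theta> \<in> borel_measurable borel" for \<theta>
    unfolding Y_def by measurable
  have C1: "C1 \<ge> 0" using bounds(2)[of 0] by linarith
  have C2: "C2 \<ge> 0" using bounds(3)[of 0] by linarith
  have i1: "integrable lborel (\<lambda>z. std_normal_density z * g (Y \<theta> z))" for \<theta>
    by (rule integrable_gauss_mult[where U = C0 and V = 0 and k = 0]) (use bounds in auto)
  have i2: "integrable lborel (\<lambda>z. std_normal_density z * ((b0 + b1 * z) * g' (Y \<theta> z)))" for \<theta>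
  proof (rule integrable_gauss_mult[where U = "\<bar>b0\<bar> * C1" and V = "\<bar>b1\<bar> * C1" and k = 1])
    fix z
    have "\<bar>b0 + b1 * z\<bar> * \<bar>g' (Y \<theta> z)\<bar> \<le> (\<bar>b0\<bar> + \<bar>b1\<bar> * \<bar>z\<bar>) * C1"
      by (intro mult_mono bounds order_trans[OF abs_triangle_ineq]) (auto simp: abs_mult)
    then show "\<bar>(b0 + b1 * z) * g' (Y \<theta> z)\<bar> \<le> \<bar>b0\<bar> * C1 + \<bar>b1\<bar> * C1 * \<bar>z\<bar> ^ 1"
      unfolding abs_mult by (simp add: ring_distribs mult_ac)
  qed measurable
  have i3: "integrable lborel (\<lambda>z. std_normal_density z * (b0 + b1 * z)\<^sup>2)"
  proof (rule integrable_gauss_mult[where U = "2 * b0\<^sup>2" and V = "2 * b1\<^sup>2" and k = 2])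
    fix z
    have "(b0 + b1 * z)\<^sup>2 \<le> 2 * b0\<^sup>2 + 2 * (b1 * z)\<^sup>2"
      using zero_le_power2[of "b0 - b1 * z"] by (simp add: power2_eq_square algebra_simps)
    then show "\<bar>(b0 + b1 * z)\<^sup>2\<bar> \<le> 2 * b0\<^sup>2 + 2 * b1\<^sup>2 * \<bar>z\<bar>\<^sup>2"
      by (simp add: power_mult_distrib)
  qed measurable
  let ?R = "\<lambda>z. std_normal_density z * g (Y (\<theta> + h) z) - std_normal_density z * g (Y \<theta> z)
      - h * (std_normal_density z * ((b0 + b1 * z) * g' (Y \<theta> z)))"
  have eq: "(LINT z|lborel. std_normal_density z * g (Y (\<theta> + h) z))
      - (LINT z|lborel. std_normal_density z * g (Y \<theta> z))
      - h * (LINT z|lborel. std_normal_density z * ((b0 + b1 * z) * g' (Y \<theta> z)))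
    = (LINT z|lborel. ?R z)"
    using i1 i2 by simp
  have "\<bar>LINT z|lborel. ?R z\<bar> \<le> (LINT z|lborel. C2 * h\<^sup>2 * (std_normal_density z * (b0 + b1 * z)\<^sup>2))"
  proof (rule order_trans[OF integral_abs_bound integral_mono])
    show "integrable lborel (\<lambda>z. \<bar>?R z\<bar>)"
      using i1 i2 by (intro integrable_abs Bochner_Integration.integrable_diff integrable_mult_right)
    show "integrable lborel (\<lambda>z. C2 * h\<^sup>2 * (std_normal_density z * (b0 + b1 * z)\<^sup>2))"
      using i3 by (intro integrable_mult_right)
    fix z
    have "?R z = std_normal_density z * (g (Y \<theta> z + h * (b0 + b1 * z)) - g (Y \<theta> z)
        - h * (b0 + b1 * z) * g' (Y \<theta> z))"
      by (simp add: Y_def algebra_simps)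
    also have "\<bar>\<dots>\<bar> \<le> std_normal_density z * (C2 * (h * (b0 + b1 * z))\<^sup>2)"
      unfolding abs_mult using taylor_quadratic_bound[OF g g' bounds(3)]
      by (intro mult_mono) auto
    finally show "\<bar>?R z\<bar> \<le> C2 * h\<^sup>2 * (std_normal_density z * (b0 + b1 * z)\<^sup>2)"
      by (simp add: power_mult_distrib mult_ac)
  qed
  also have "\<dots> = (C2 * (LINT z|lborel. std_normal_density z * (b0 + b1 * z)\<^sup>2)) * h\<^sup>2"
    by simp
  finally show "\<bar>(LINT z|lborel. std_normal_density z * g (a0 + a1 * z + (\<theta> + h) * (b0 + b1 * z)))
      - (LINT z|lborel. std_normal_density z * g (a0 + a1 * z + \<theta> * (b0 + b1 * z)))
      - h * (LINT z|lborel. std_normal_density z * ((b0 + b1 * z) * g' (a0 + a1 * z + \<theta> * (b0 + b1 * z))))\<bar>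
    \<le> (C2 * (LINT z|lborel. std_normal_density z * (b0 + b1 * z)\<^sup>2)) * h\<^sup>2"
    unfolding eq[unfolded Y_def] by (simp add: Y_def)
qed

lemma std_normal_density_has_derivative:
  "(std_normal_density has_field_derivative - (z * std_normal_density z)) (at z)"
  unfolding std_normal_density_def[abs_def]
  by (auto intro!: derivative_eq_intros simp: field_simps)

lemma std_normal_density_tendsto_zero:
  "(std_normal_density \<longlongrightarrow> 0) at_top" "(std_normal_density \<longlongrightarrow> 0) at_bot"
  unfolding std_normal_density_def[abs_def] by real_asymp+

text \<open>Stein's identity. The density has derivative \<open>- z\<close> times itself, so
  \<open>- (std_normal_density z * G z)\<close> is a primitive of the difference of the two
  integrands; it vanishes at both ends because \<open>G\<close> is bounded.\<close>

lemma gauss_integration_by_parts: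
  fixes G :: "real \<Rightarrow> real"
  assumes G: "\<And>x. (G has_field_derivative G' x) (at x)"
    and cont: "continuous_on UNIV G'"
    and bounds: "\<And>x. \<bar>G x\<bar> \<le> C0" "\<And>x. \<bar>G' x\<bar> \<le> C1"
  shows "(LINT z|lborel. std_normal_density z * (z * G z)) = (LINT z|lborel. std_normal_density z * G' z)"
proof -
  let ?f = "\<lambda>z. std_normal_density z * (z * G z) - std_normal_density z * G' z"
  let ?F = "\<lambda>z. - (std_normal_density z * G z)"
  have cG: "continuous_on UNIV G"
    using G by (auto intro!: continuous_at_imp_continuous_on intro: DERIV_isCont)
  have cd: "continuous_on UNIV std_normal_density"
    using std_normal_density_has_derivative
    by (auto intro!: continuous_at_imp_continuous_on intro: DERIV_isCont)
  have [measurable]: "G \<in> borel_measurable borel" "G' \<in> borel_measurable borel"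
    using cG cont by (auto intro!: borel_measurable_continuous_onI)
  have C0: "C0 \<ge> 0" using bounds(1)[of 0] by linarith
  have i1: "integrable lborel (\<lambda>z. std_normal_density z * (z * G z))"
  proof (rule integrable_gauss_mult[where U = 0 and V = C0 and k = 1])
    show "\<bar>z * G z\<bar> \<le> 0 + C0 * \<bar>z\<bar> ^ 1" for z
      using mult_left_mono[OF bounds(1)[of z], of "\<bar>z\<bar>"] by (simp add: abs_mult mult_ac)
  qed measurable
  have i2: "integrable lborel (\<lambda>z. std_normal_density z * G' z)"
    by (rule integrable_gauss_mult[where U = C1 and V = 0 and k = 0]) (use bounds in auto)
  have lim: "(?F \<longlongrightarrow> 0) F" if "(std_normal_density \<longlongrightarrow> 0) F" for F
  proof -
    have "((\<lambda>z. std_normal_density z * G z) \<longlongrightarrow> 0) F"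
      by (rule Lim_null_comparison[where g = "\<lambda>z. C0 * std_normal_density z"])
        (use bounds(1) tendsto_mult_right_zero[OF that, of C0] in
          \<open>auto simp: abs_mult mult.commute[of C0] intro!: always_eventually mult_left_mono\<close>)
    then show ?thesis using tendsto_minus by fastforce
  qed
  have "(LBINT z=-\<infinity>..\<infinity>. ?f z) = 0 - 0"
  proof (rule interval_integral_FTC_integrable)
    show "(?F has_vector_derivative ?f x) (at x)" for x
      unfolding has_real_derivative_iff_has_vector_derivative[symmetric]
      by (rule derivative_eq_intros G std_normal_density_has_derivative refl)+ (simp add: algebra_simps)
    show "isCont ?f x" for x
      using cG cont cd
      by (intro continuous_intros) (auto simp: continuous_on_eq_continuous_at)
    show "set_integrable lborel (einterval (- \<infinity>) \<infinity>) ?f"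
      using i1 i2 by (simp add: set_integrable_def)
    show "((?F \<circ> real_of_ereal) \<longlongrightarrow> 0) (at_right (- \<infinity>))"
      using lim[OF std_normal_density_tendsto_zero(2)]
      by (simp add: ereal_tendsto_simps)
    show "((?F \<circ> real_of_ereal) \<longlongrightarrow> 0) (at_left \<infinity>)"
      using lim[OF std_normal_density_tendsto_zero(1)]
      by (simp add: ereal_tendsto_simps)
  qed simp
  then have "(LINT z|lborel. ?f z) = 0"
    by (simp add: interval_lebesgue_integral_def set_lebesgue_integral_def)
  then show ?thesis using i1 i2 by simp
qed


section \<open>Decay of Gaussian averages and invariance of the Schwartz space\<close>

lemma abs_power_add_le:
  fixes y v :: real
  shows "\<bar>y + v\<bar> ^ k \<le> 2 ^ k * (\<bar>y\<bar> ^ k + \<bar>v\<bar> ^ k)"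
proof -
  have "\<bar>y + v\<bar> ^ k \<le> (2 * max \<bar>y\<bar> \<bar>v\<bar>) ^ k"
    by (intro power_mono) auto
  also have "\<dots> = 2 ^ k * max (\<bar>y\<bar> ^ k) (\<bar>v\<bar> ^ k)"
    by (auto simp: power_mult_distrib max_def intro!: antisym power_mono)
  also have "\<dots> \<le> 2 ^ k * (\<bar>y\<bar> ^ k + \<bar>v\<bar> ^ k)"
    by (intro mult_left_mono) auto
  finally show ?thesis .
qed

definition gauss_abs_moment :: "nat \<Rightarrow> real" where
  "gauss_abs_moment k = (LINT z|lborel. std_normal_density z * \<bar>z\<bar> ^ k)"

lemma gauss_abs_moment_nonneg: "0 \<le> gauss_abs_moment k"
  unfolding gauss_abs_moment_def by (intro integral_nonneg_AE) auto

text \<open>The weight \<open>x ^ k\<close> is carried to the point \<open>y = x + s * z\<close>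
  where \<open>g\<close> is evaluated: as \<open>x = y - s * z\<close>, it splits into
  \<open>\<bar>y\<bar> ^ k\<close>, absorbed by \<open>Q\<close>, and
  \<open>\<bar>s * z\<bar> ^ k\<close>, absorbed by a Gaussian moment. The upper bound
  \<open>S\<close> makes the constant uniform over a time interval.\<close>

lemma gauss_avg_weighted_bound:
  assumes [measurable]: "g \<in> borel_measurable borel"
    and bounds: "\<And>x. \<bar>g x\<bar> \<le> P" "\<And>x. \<bar>x ^ k * g x\<bar> \<le> Q"
    and s: "0 \<le> s" "s \<le> S"
  shows "\<bar>x ^ k * gauss_avg s g x\<bar> \<le> 2 ^ k * (Q + S ^ k * gauss_abs_moment k * P)"
proof -
  have P: "P \<ge> 0" using bounds(1)[of 0] by linarith
  have "\<bar>x ^ k * gauss_avg s g x\<bar> = \<bar>LINT z|lborel. x ^ k * (std_normal_density z * g (x + s * z))\<bar>"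
    by (simp add: gauss_avg_def)
  also have "\<dots> \<le> (LINT z|lborel. 2 ^ k * Q * std_normal_density z
      + 2 ^ k * s ^ k * P * (std_normal_density z * \<bar>z\<bar> ^ k))"
  proof (rule order_trans[OF integral_abs_bound integral_mono])
    show "integrable lborel (\<lambda>z. \<bar>x ^ k * (std_normal_density z * g (x + s * z))\<bar>)"
      by (intro integrable_abs integrable_mult_right
          integrable_gauss_mult[where U = P and V = 0 and k = 0]) (use bounds in auto)
    show "integrable lborel (\<lambda>z. 2 ^ k * Q * std_normal_density z
        + 2 ^ k * s ^ k * P * (std_normal_density z * \<bar>z\<bar> ^ k))"
      by (intro Bochner_Integration.integrable_add integrable_mult_right integrable_std_normal_moment_abs) auto
    fix z
    let ?y = "x + s * z"
    have "\<bar>x\<bar> ^ k * \<bar>g ?y\<bar> \<le> 2 ^ k * (\<bar>?y\<bar> ^ k + \<bar>s * z\<bar> ^ k) * \<bar>g ?y\<bar>"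
      using abs_power_add_le[of ?y "- (s * z)" k] by (intro mult_right_mono) auto
    also have "\<dots> = 2 ^ k * \<bar>?y ^ k * g ?y\<bar> + 2 ^ k * s ^ k * \<bar>z\<bar> ^ k * \<bar>g ?y\<bar>"
      using s by (simp add: abs_mult power_abs power_mult_distrib algebra_simps)
    also have "\<dots> \<le> 2 ^ k * Q + 2 ^ k * s ^ k * \<bar>z\<bar> ^ k * P"
      using s by (intro add_mono mult_left_mono bounds) auto
    finally have "std_normal_density z * (\<bar>x\<bar> ^ k * \<bar>g ?y\<bar>)
        \<le> std_normal_density z * (2 ^ k * Q + 2 ^ k * s ^ k * \<bar>z\<bar> ^ k * P)"
      by (intro mult_left_mono) auto
    then show "\<bar>x ^ k * (std_normal_density z * g (x + s * z))\<bar> \<le> 2 ^ k * Q * std_normal_density z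
        + 2 ^ k * s ^ k * P * (std_normal_density z * \<bar>z\<bar> ^ k)"
      by (simp add: abs_mult power_abs algebra_simps)
  qed
  also have "\<dots> = 2 ^ k * (Q + s ^ k * gauss_abs_moment k * P)"
    using integrable_std_normal_moment_abs[of k]
    by (simp add: gauss_abs_moment_def distrib_left)
  also have "\<dots> \<le> 2 ^ k * (Q + S ^ k * gauss_abs_moment k * P)"
    using s P gauss_abs_moment_nonneg
    by (intro mult_left_mono add_left_mono mult_right_mono power_mono) auto
  finally show ?thesis .
qed

lemma schwartz_derivs_measurable:
  assumes "f \<in> schwartz"
  shows "(deriv ^^ n) f \<in> borel_measurable borel"
  by (intro borel_measurable_continuous_onI continuous_at_imp_continuous_on ballI
      DERIV_isCont[OF schwartz_has_derivative[OF assms]])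

lemma gauss_avg_weighted_seminorm_bound:
  assumes "f \<in> schwartz" "0 \<le> s" "s \<le> S"
  shows "\<bar>x ^ k * gauss_avg s ((deriv ^^ n) f) x\<bar>
    \<le> 2 ^ k * (schwartz_seminorm k n f + S ^ k * gauss_abs_moment k * schwartz_seminorm 0 n f)"
  by (rule gauss_avg_weighted_bound)
    (use assms schwartz_derivs_measurable schwartz_deriv_bounded schwartz_seminorm_upper in auto)

text \<open>Averaging commutes with differentiation, so the averages of the derivatives of
  \<open>f\<close> form the tower that \<open>schwartz_by_derivs\<close> asks for.\<close>

lemma
  assumes f: "f \<in> schwartz" and s: "0 \<le> s"
  shows schwartz_gauss_avg: "gauss_avg s f \<in> schwartz"
    and derivs_gauss_avg: "(deriv ^^ n) (gauss_avg s f) = gauss_avg s ((deriv ^^ n) f)"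
proof -
  let ?F = "\<lambda>n. gauss_avg s ((deriv ^^ n) f)"
  have d: "(?F n has_field_derivative ?F (Suc n) x) (at x)" for n x
    using gauss_integral_has_derivative[where ?a0.0 = 0 and ?a1.0 = s and ?b0.0 = 1 and ?b1.0 = 0 and \<theta> = x,
        OF schwartz_has_derivative[OF f] schwartz_has_derivative[OF f]
          schwartz_deriv_bounded[OF f] schwartz_deriv_bounded[OF f] schwartz_deriv_bounded[OF f]]
    unfolding gauss_avg_def[abs_def] by (simp add: add.commute)
  show "gauss_avg s f \<in> schwartz"
    using schwartz_by_derivs[of ?F, OF d] gauss_avg_weighted_seminorm_bound[OF f s order_refl]
    by auto
  show "(deriv ^^ n) (gauss_avg s f) = ?F n"
    using iterated_derivs_eq[of ?F n, OF d] by simp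
qed

lemma brownian_semigroup_fun_eq: "t \<ge> 0 \<Longrightarrow> brownian_semigroup t f = gauss_avg (sqrt t) f"
  by (rule ext) (rule brownian_semigroup_eq_gauss_avg)

lemma schwartz_brownian_semigroup:
  assumes "f \<in> schwartz" "t \<ge> 0"
  shows "brownian_semigroup t f \<in> schwartz"
  using schwartz_gauss_avg[OF assms(1), of "sqrt t"] assms(2) by (simp add: brownian_semigroup_fun_eq)

lemma derivs_brownian_semigroup:
  assumes "f \<in> schwartz" "t \<ge> 0"
  shows "(deriv ^^ n) (brownian_semigroup t f) = brownian_semigroup t ((deriv ^^ n) f)"
  using derivs_gauss_avg[OF assms(1), of "sqrt t" n] assms(2) by (simp add: brownian_semigroup_fun_eq)

lemma brownian_semigroup_lincomb:
  assumes "f \<in> schwartz" "g \<in> schwartz" "t \<ge> 0"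
  shows "brownian_semigroup t (\<lambda>x. a * f x + b * g x)
    = (\<lambda>x. a * brownian_semigroup t f x + b * brownian_semigroup t g x)"
proof
  fix x
  have i: "integrable lborel (\<lambda>z. std_normal_density z * h (x + sqrt t * z))" if h: "h \<in> schwartz" for h
  proof -
    have [measurable]: "h \<in> borel_measurable borel"
      using schwartz_derivs_measurable[OF h, of 0] by simp
    show ?thesis
      by (rule integrable_gauss_mult[where U = "schwartz_seminorm 0 0 h" and V = 0 and k = 0])
        (use schwartz_deriv_bounded[OF h, of 0] in auto)
  qed
  have "std_normal_density z * (a * f (x + sqrt t * z) + b * g (x + sqrt t * z))
    = a * (std_normal_density z * f (x + sqrt t * z)) + b * (std_normal_density z * g (x + sqrt t * z))" for z
    by (simp add: algebra_simps)
  then show "brownian_semigroup t (\<lambda>x. a * f x + b * g x) x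
    = a * brownian_semigroup t f x + b * brownian_semigroup t g x"
    using i[OF assms(1)] i[OF assms(2)]
    by (simp add: brownian_semigroup_eq_gauss_avg assms gauss_avg_def)
qed

lemma brownian_semigroup_cmult:
  assumes "t \<ge> 0"
  shows "brownian_semigroup t (\<lambda>x. a * f x) = (\<lambda>x. a * brownian_semigroup t f x)"
  by (rule ext) (simp add: brownian_semigroup_eq_gauss_avg[OF assms] gauss_avg_def mult.left_commute)

lemma half_laplacian_brownian_semigroup:
  assumes "f \<in> schwartz" "t \<ge> 0"
  shows "half_laplacian (brownian_semigroup t f) = brownian_semigroup t (half_laplacian f)"
  by (simp add: half_laplacian_eq derivs_brownian_semigroup[OF assms] brownian_semigroup_cmult[OF assms(2)]
      del: times_divide_eq_left)

text \<open>No order is lost: averaging preserves the number of derivatives, and moving the weight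
  costs only Gaussian moments times powers of \<open>sqrt T\<close>.\<close>

lemma schwartz_norm_brownian_semigroup:
  obtains C where "C \<ge> 0"
    "\<And>f t. f \<in> schwartz \<Longrightarrow> 0 \<le> t \<Longrightarrow> t \<le> T \<Longrightarrow> schwartz_norm N (brownian_semigroup t f) \<le> C * schwartz_norm N f"
proof (cases "T \<ge> 0")
  case True
  define D where "D = (\<Sum>k\<le>N. 2 ^ k * (1 + sqrt T ^ k * gauss_abs_moment k))"
  have pos: "0 \<le> 2 ^ k * (1 + sqrt T ^ k * gauss_abs_moment k)" for k
    using True gauss_abs_moment_nonneg[of k] by simp
  have D: "2 ^ k * (1 + sqrt T ^ k * gauss_abs_moment k) \<le> D" if "k \<le> N" for k
    unfolding D_def by (rule member_le_sum[where f = "\<lambda>k. 2 ^ k * (1 + sqrt T ^ k * gauss_abs_moment k)"])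
      (use that pos in auto)
  show ?thesis
  proof (rule that[of "(real N + 1)\<^sup>2 * D"])
    show "0 \<le> (real N + 1)\<^sup>2 * D" using pos[of 0] D[of 0] by simp
    fix f t assume f: "f \<in> schwartz" and t: "0 \<le> t" "t \<le> T"
    have "schwartz_norm N (brownian_semigroup t f) \<le> (real N + 1)\<^sup>2 * (D * schwartz_norm N f)"
    proof (intro schwartz_norm_le schwartz_seminorm_least)
      fix k n x assume kn: "k \<le> N" "n \<le> N"
      have "\<bar>x ^ k * (deriv ^^ n) (brownian_semigroup t f) x\<bar>
          \<le> 2 ^ k * (schwartz_seminorm k n f + sqrt T ^ k * gauss_abs_moment k * schwartz_seminorm 0 n f)"
        using gauss_avg_weighted_seminorm_bound[OF f, of "sqrt t" "sqrt T" x k n] t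
        by (simp add: derivs_gauss_avg[OF f] brownian_semigroup_fun_eq)
      also have "\<dots> \<le> 2 ^ k * (schwartz_norm N f + sqrt T ^ k * gauss_abs_moment k * schwartz_norm N f)"
        using kn True gauss_abs_moment_nonneg[of k]
        by (intro mult_left_mono add_mono schwartz_seminorm_le_norm f) auto
      also have "\<dots> = (2 ^ k * (1 + sqrt T ^ k * gauss_abs_moment k)) * schwartz_norm N f"
        by (simp add: algebra_simps)
      also have "\<dots> \<le> D * schwartz_norm N f"
        by (intro mult_right_mono D kn schwartz_norm_nonneg f)
      finally show "\<bar>x ^ k * (deriv ^^ n) (brownian_semigroup t f) x\<bar> \<le> D * schwartz_norm N f" .
    qed
    then show "schwartz_norm N (brownian_semigroup t f) \<le> (real N + 1)\<^sup>2 * D * schwartz_norm N f"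
      by (simp add: mult.assoc)
  qed
\<comment> \<open>For negative \<open>T\<close> no time is admissible.\<close>
qed (use that[of 0] in auto)

section \<open>The heat equation and regularity in time\<close>

text \<open>Differentiating in the scale brings down a factor \<open>z\<close>, which integration by
  parts trades for \<open>s\<close> and a second derivative. With \<open>s = sqrt t\<close> this
  factor later cancels the singular derivative \<open>1 / (2 * sqrt t)\<close> of the square root
  and leaves half the second derivative.\<close>

lemma gauss_avg_has_derivative_scale:
  assumes f: "f \<in> schwartz"
  shows "((\<lambda>s. gauss_avg s f x) has_field_derivative s * gauss_avg s ((deriv ^^ 2) f) x) (at s)"
proof -
  have "(LINT z|lborel. std_normal_density z * (z * deriv f (x + s * z)))
      = (LINT z|lborel. std_normal_density z * (s * (deriv ^^ 2) f (x + s * z)))"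
  proof (rule gauss_integration_by_parts)
    have d1: "(deriv f has_field_derivative (deriv ^^ 2) f y) (at y)" for y
      using schwartz_has_derivative[OF f, of 1 y] by (simp add: numeral_2_eq_2)
    show "((\<lambda>z. deriv f (x + s * z)) has_field_derivative s * (deriv ^^ 2) f (x + s * z)) (at z)" for z
    proof -
      have "((\<lambda>z. x + s * z) has_field_derivative s) (at z)"
        by (auto intro!: derivative_eq_intros)
      from DERIV_chain2[OF d1 this] show ?thesis by (simp add: mult.commute)
    qed
    show "continuous_on UNIV (\<lambda>z. s * (deriv ^^ 2) f (x + s * z))"
      by (intro continuous_intros continuous_on_compose2[where s = UNIV and g = "(deriv ^^ 2) f"]
          continuous_at_imp_continuous_on ballI DERIV_isCont[OF schwartz_has_derivative[OF f]]) auto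
    show "\<bar>deriv f (x + s * z)\<bar> \<le> schwartz_seminorm 0 1 f" for z
      using schwartz_deriv_bounded[OF f, of 1] by simp
    show "\<bar>s * (deriv ^^ 2) f (x + s * z)\<bar> \<le> \<bar>s\<bar> * schwartz_seminorm 0 2 f" for z
      unfolding abs_mult using schwartz_deriv_bounded[OF f, of 2] by (intro mult_left_mono) auto
  qed
  also have "\<dots> = s * gauss_avg s ((deriv ^^ 2) f) x"
    by (simp add: gauss_avg_def mult.left_commute)
  finally show ?thesis
    using gauss_integral_has_derivative[where ?a0.0 = x and ?a1.0 = 0 and ?b0.0 = 0 and ?b1.0 = 1 and \<theta> = s,
        OF schwartz_has_derivative[OF f, of 0] schwartz_has_derivative[OF f]
          schwartz_deriv_bounded[OF f] schwartz_deriv_bounded[OF f] schwartz_deriv_bounded[OF f]]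
    by (simp add: gauss_avg_def[abs_def])
qed

text \<open>The square root is differentiable only at positive times, but the mean value theorem
  asks for mere continuity at the left end, so \<open>a = 0\<close> is included.\<close>

lemma brownian_semigroup_mvt_less:
  assumes f: "f \<in> schwartz" and ab: "0 \<le> a" "a < b"
  obtains \<xi> where "a < \<xi>" "\<xi> < b"
    "brownian_semigroup b f x - brownian_semigroup a f x = (b - a) * brownian_semigroup \<xi> (half_laplacian f) x"
proof -
  have c: "continuous_on {a..b} (\<lambda>t. gauss_avg (sqrt t) f x)"
    by (rule continuous_on_compose2[of UNIV "\<lambda>s. gauss_avg s f x"])
      (auto intro!: continuous_intros continuous_at_imp_continuous_on
        DERIV_isCont[OF gauss_avg_has_derivative_scale[OF f]])
  have d: "((\<lambda>t. gauss_avg (sqrt t) f x) has_field_derivative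
      brownian_semigroup t (half_laplacian f) x) (at t)" if "a < t" "t < b" for t
  proof -
    have t: "t > 0" using that ab by simp
    have "((\<lambda>t. gauss_avg (sqrt t) f x) has_field_derivative
      sqrt t * gauss_avg (sqrt t) ((deriv ^^ 2) f) x * (inverse (sqrt t) / 2)) (at t)"
      by (rule DERIV_chain2[OF gauss_avg_has_derivative_scale[OF f] DERIV_real_sqrt[OF t]])
    also have "sqrt t * gauss_avg (sqrt t) ((deriv ^^ 2) f) x * (inverse (sqrt t) / 2)
        = brownian_semigroup t (half_laplacian f) x"
      using t by (simp add: half_laplacian_eq brownian_semigroup_cmult brownian_semigroup_eq_gauss_avg
          field_simps del: times_divide_eq_left)
    finally show ?thesis .
  qed
  obtain l z where z: "a < z" "z < b" "((\<lambda>t. gauss_avg (sqrt t) f x) has_field_derivative l) (at z)"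
    "gauss_avg (sqrt b) f x - gauss_avg (sqrt a) f x = (b - a) * l"
    using MVT[OF ab(2) c] d by (meson real_differentiable_def)
  then have "l = brownian_semigroup z (half_laplacian f) x"
    using d DERIV_unique by blast
  with z that[of z] ab show ?thesis by (simp add: brownian_semigroup_eq_gauss_avg)
qed

lemma brownian_semigroup_mvt:
  assumes f: "f \<in> schwartz" and ab: "0 \<le> a" "0 \<le> b"
  obtains \<xi> where "min a b \<le> \<xi>" "\<xi> \<le> max a b"
    "brownian_semigroup b f x - brownian_semigroup a f x = (b - a) * brownian_semigroup \<xi> (half_laplacian f) x"
proof (cases a b rule: linorder_cases)
  case less
  then show ?thesis
    using brownian_semigroup_mvt_less[OF f ab(1) less, of x] that by (metis less_imp_le max.absorb2 min.absorb1)
next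
  case equal
  then show ?thesis using that[of a] by simp
next
  case greater
  then obtain \<xi> where "b < \<xi>" "\<xi> < a"
    "brownian_semigroup a f x - brownian_semigroup b f x = (a - b) * brownian_semigroup \<xi> (half_laplacian f) x"
    using brownian_semigroup_mvt_less[OF f ab(2) greater, of x] by blast
  then show ?thesis using that[of \<xi>] by (simp add: algebra_simps)
qed

lemma schwartz_derivs:
  assumes "f \<in> schwartz"
  shows "(deriv ^^ n) f \<in> schwartz"
proof -
  let ?F = "\<lambda>m. (deriv ^^ (m + n)) f"
  have "?F 0 \<in> schwartz"
  proof (rule schwartz_by_derivs)
    show "(?F m has_field_derivative ?F (Suc m) x) (at x)" for m x
      using schwartz_has_derivative[OF assms, of "m + n" x] by simp
    show "\<exists>C. \<forall>x. \<bar>x ^ k * ?F m x\<bar> \<le> C" for k m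
      using schwartz_seminorm_upper[OF assms] by blast
  qed
  then show ?thesis by simp
qed

text \<open>Differentiation commutes with \<open>P_t\<close> and with the generator. The point
  \<open>\<xi>\<close> depends on \<open>x\<close> and \<open>n\<close>, so the bounds below are
  taken pointwise and uniformly in \<open>\<xi>\<close> before passing to the supremum.\<close>

lemma derivs_brownian_semigroup_mvt:
  assumes f: "f \<in> schwartz" and ab: "0 \<le> a" "0 \<le> b"
  obtains \<xi> where "min a b \<le> \<xi>" "\<xi> \<le> max a b"
    "(deriv ^^ n) (brownian_semigroup b f) x - (deriv ^^ n) (brownian_semigroup a f) x
      = (b - a) * (deriv ^^ n) (brownian_semigroup \<xi> (half_laplacian f)) x"
proof -
  have "half_laplacian ((deriv ^^ n) f) = (deriv ^^ n) (half_laplacian f)"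
    by (simp add: half_laplacian_eq[of "(deriv ^^ n) f"] derivs_half_laplacian[OF f] numeral_2_eq_2)
  moreover obtain \<xi> where \<xi>: "min a b \<le> \<xi>" "\<xi> \<le> max a b"
    "brownian_semigroup b ((deriv ^^ n) f) x - brownian_semigroup a ((deriv ^^ n) f) x
      = (b - a) * brownian_semigroup \<xi> (half_laplacian ((deriv ^^ n) f)) x"
    using brownian_semigroup_mvt[OF schwartz_derivs[OF f] ab] by blast
  moreover have "\<xi> \<ge> 0" using ab \<xi> by linarith
  ultimately show ?thesis using that[of \<xi>]
    by (simp add: derivs_brownian_semigroup f ab schwartz_half_laplacian)
qed

text \<open>Two orders of the norm are lost because the increment is governed by the second
  derivative of \<open>f\<close>.\<close>

lemma brownian_semigroup_lipschitz:
  obtains C where "C \<ge> 0"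
    "\<And>f a b. f \<in> schwartz \<Longrightarrow> a \<in> {0..T} \<Longrightarrow> b \<in> {0..T} \<Longrightarrow>
      schwartz_norm N (\<lambda>x. brownian_semigroup b f x - brownian_semigroup a f x)
        \<le> C * \<bar>b - a\<bar> * schwartz_norm (N + 2) f"
proof -
  obtain C where C: "C \<ge> 0" "\<And>f t. f \<in> schwartz \<Longrightarrow> 0 \<le> t \<Longrightarrow> t \<le> T \<Longrightarrow>
      schwartz_norm N (brownian_semigroup t f) \<le> C * schwartz_norm N f"
    using schwartz_norm_brownian_semigroup[of T N] by blast
  show ?thesis
  proof (rule that[of "(real N + 1)\<^sup>2 * (C * (real N + 1)\<^sup>2)"])
    show "0 \<le> (real N + 1)\<^sup>2 * (C * (real N + 1)\<^sup>2)" using C by simp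
    fix f a b assume f: "f \<in> schwartz" and a: "a \<in> {0..T}" and b: "b \<in> {0..T}"
    have ab: "0 \<le> a" "0 \<le> b" using a b by auto
    have "schwartz_norm N (\<lambda>x. brownian_semigroup b f x - brownian_semigroup a f x)
      \<le> (real N + 1)\<^sup>2 * (\<bar>b - a\<bar> * (C * ((real N + 1)\<^sup>2 * schwartz_norm (N + 2) f)))"
    proof (intro schwartz_norm_le schwartz_seminorm_least)
      fix k n x assume kn: "k \<le> N" "n \<le> N"
      obtain \<xi> where \<xi>: "min a b \<le> \<xi>" "\<xi> \<le> max a b"
        "(deriv ^^ n) (brownian_semigroup b f) x - (deriv ^^ n) (brownian_semigroup a f) x
          = (b - a) * (deriv ^^ n) (brownian_semigroup \<xi> (half_laplacian f)) x"
        using derivs_brownian_semigroup_mvt[OF f ab] by blast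
      have \<xi>': "0 \<le> \<xi>" "\<xi> \<le> T" using \<xi> a b by auto
      have "\<bar>x ^ k * (deriv ^^ n) (\<lambda>x. brownian_semigroup b f x - brownian_semigroup a f x) x\<bar>
        = \<bar>b - a\<bar> * \<bar>x ^ k * (deriv ^^ n) (brownian_semigroup \<xi> (half_laplacian f)) x\<bar>"
        using \<xi> by (simp add: derivs_diff schwartz_brownian_semigroup f ab abs_mult)
      also have "\<dots> \<le> \<bar>b - a\<bar> * schwartz_seminorm k n (brownian_semigroup \<xi> (half_laplacian f))"
        by (intro mult_left_mono schwartz_seminorm_upper schwartz_brownian_semigroup
            schwartz_half_laplacian f \<xi>') auto
      also have "\<dots> \<le> \<bar>b - a\<bar> * schwartz_norm N (brownian_semigroup \<xi> (half_laplacian f))"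
        by (intro mult_left_mono schwartz_seminorm_le_norm schwartz_brownian_semigroup
            schwartz_half_laplacian f \<xi>' kn) auto
      also have "\<dots> \<le> \<bar>b - a\<bar> * (C * schwartz_norm N (half_laplacian f))"
        by (intro mult_left_mono C schwartz_half_laplacian f \<xi>') auto
      also have "\<dots> \<le> \<bar>b - a\<bar> * (C * ((real N + 1)\<^sup>2 * schwartz_norm (N + 2) f))"
        by (intro mult_left_mono schwartz_norm_half_laplacian f C) auto
      finally show "\<bar>x ^ k * (deriv ^^ n) (\<lambda>x. brownian_semigroup b f x - brownian_semigroup a f x) x\<bar>
        \<le> \<bar>b - a\<bar> * (C * ((real N + 1)\<^sup>2 * schwartz_norm (N + 2) f))" .
    qed
    then show "schwartz_norm N (\<lambda>x. brownian_semigroup b f x - brownian_semigroup a f x)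
      \<le> (real N + 1)\<^sup>2 * (C * (real N + 1)\<^sup>2) * \<bar>b - a\<bar> * schwartz_norm (N + 2) f"
      by (simp add: mult_ac)
  qed
qed

text \<open>The mean value theorem leaves \<open>(b - a) * (P_\<xi> g - P_a g)\<close> with
  \<open>g = A f\<close>, and the Lipschitz estimate for \<open>g\<close> supplies the second factor
  \<open>\<bar>b - a\<bar>\<close>. This is the remainder that lets \<open>\<phi> (P_r f)\<close> be
  differentiated in \<open>r\<close>.\<close>

lemma brownian_semigroup_second_order:
  obtains C where "C \<ge> 0"
    "\<And>f a b. f \<in> schwartz \<Longrightarrow> a \<in> {0..T} \<Longrightarrow> b \<in> {0..T} \<Longrightarrow>
      schwartz_norm N (\<lambda>x. (brownian_semigroup b f x - brownian_semigroup a f x)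
          - (b - a) * brownian_semigroup a (half_laplacian f) x)
        \<le> C * (b - a)\<^sup>2 * schwartz_norm (N + 2) (half_laplacian f)"
proof -
  obtain C where C: "C \<ge> 0" "\<And>f a b. f \<in> schwartz \<Longrightarrow> a \<in> {0..T} \<Longrightarrow> b \<in> {0..T} \<Longrightarrow>
      schwartz_norm N (\<lambda>x. brownian_semigroup b f x - brownian_semigroup a f x)
        \<le> C * \<bar>b - a\<bar> * schwartz_norm (N + 2) f"
    using brownian_semigroup_lipschitz[of T N] by blast
  show ?thesis
  proof (rule that[of "(real N + 1)\<^sup>2 * C"])
    show "0 \<le> (real N + 1)\<^sup>2 * C" using C by simp
    fix f a b assume f: "f \<in> schwartz" and a: "a \<in> {0..T}" and b: "b \<in> {0..T}"
    let ?g = "half_laplacian f"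
    have g: "?g \<in> schwartz" using schwartz_half_laplacian[OF f] .
    have ab: "0 \<le> a" "0 \<le> b" using a b by auto
    note P = schwartz_brownian_semigroup[OF f] schwartz_brownian_semigroup[OF g]
    \<comment> \<open>The coefficients \<open>1\<close> and \<open>- (b - a)\<close> are spelled out
      to match \<open>derivs_lincomb\<close>.\<close>
    have "schwartz_norm N (\<lambda>x. 1 * (brownian_semigroup b f x - brownian_semigroup a f x)
          + (- (b - a)) * brownian_semigroup a ?g x)
      \<le> (real N + 1)\<^sup>2 * (\<bar>b - a\<bar> * (C * \<bar>b - a\<bar> * schwartz_norm (N + 2) ?g))"
    proof (intro schwartz_norm_le schwartz_seminorm_least)
      fix k n x assume kn: "k \<le> N" "n \<le> N"
      obtain \<xi> where \<xi>: "min a b \<le> \<xi>" "\<xi> \<le> max a b"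
        "(deriv ^^ n) (brownian_semigroup b f) x - (deriv ^^ n) (brownian_semigroup a f) x
          = (b - a) * (deriv ^^ n) (brownian_semigroup \<xi> ?g) x"
        using derivs_brownian_semigroup_mvt[OF f ab] by blast
      have \<xi>': "0 \<le> \<xi>" "\<xi> \<le> T" using \<xi> a b by auto
      let ?d = "\<lambda>x. brownian_semigroup \<xi> ?g x - brownian_semigroup a ?g x"
      have d: "?d \<in> schwartz" by (intro schwartz_diff P \<xi>' ab)
      have "(deriv ^^ n) (\<lambda>x. 1 * (brownian_semigroup b f x - brownian_semigroup a f x)
          + (- (b - a)) * brownian_semigroup a ?g x) x = (b - a) * (deriv ^^ n) ?d x"
        using \<xi>(3) by (subst derivs_lincomb) 
          (auto simp: derivs_diff P schwartz_diff ab \<xi>' algebra_simps)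
      then have "\<bar>x ^ k * (deriv ^^ n) (\<lambda>x. 1 * (brownian_semigroup b f x - brownian_semigroup a f x)
          + (- (b - a)) * brownian_semigroup a ?g x) x\<bar>
        = \<bar>b - a\<bar> * \<bar>x ^ k * (deriv ^^ n) ?d x\<bar>"
        by (simp only: abs_mult) (simp add: mult_ac)
      also have "\<dots> \<le> \<bar>b - a\<bar> * schwartz_seminorm k n ?d"
        by (intro mult_left_mono schwartz_seminorm_upper d) auto
      also have "\<dots> \<le> \<bar>b - a\<bar> * schwartz_norm N ?d"
        by (intro mult_left_mono schwartz_seminorm_le_norm d kn) auto
      also have "\<dots> \<le> \<bar>b - a\<bar> * (C * \<bar>\<xi> - a\<bar> * schwartz_norm (N + 2) ?g)"
        using \<xi>' a by (intro mult_left_mono C g) auto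
      also have "\<dots> \<le> \<bar>b - a\<bar> * (C * \<bar>b - a\<bar> * schwartz_norm (N + 2) ?g)"
        using \<xi> by (intro mult_left_mono mult_right_mono schwartz_norm_nonneg g C) auto
      finally show "\<bar>x ^ k * (deriv ^^ n) (\<lambda>x. 1 * (brownian_semigroup b f x - brownian_semigroup a f x)
          + (- (b - a)) * brownian_semigroup a ?g x) x\<bar>
        \<le> \<bar>b - a\<bar> * (C * \<bar>b - a\<bar> * schwartz_norm (N + 2) ?g)" .
    qed
    moreover have "\<bar>b - a\<bar> * \<bar>b - a\<bar> = (b - a)\<^sup>2" by (simp add: power2_eq_square)
    moreover have "(\<lambda>x. 1 * (brownian_semigroup b f x - brownian_semigroup a f x)
          + (- (b - a)) * brownian_semigroup a ?g x) = (\<lambda>x. (brownian_semigroup b f x - brownian_semigroup a f x)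
          - (b - a) * brownian_semigroup a ?g x)"
      by (simp add: algebra_simps)
    ultimately show "schwartz_norm N (\<lambda>x. (brownian_semigroup b f x - brownian_semigroup a f x)
          - (b - a) * brownian_semigroup a ?g x)
      \<le> (real N + 1)\<^sup>2 * C * (b - a)\<^sup>2 * schwartz_norm (N + 2) ?g"
      by (metis (no_types, lifting) mult.assoc mult.commute)
  qed
qed

subsection \<open>Tempered distributions\<close>

lemma tempered_linear:
  assumes "\<phi> \<in> tempered" "f \<in> schwartz" "g \<in> schwartz"
  shows "\<phi> (\<lambda>x. a * f x + b * g x) = a * \<phi> f + b * \<phi> g"
  using assms unfolding tempered_def by blast

lemma tempered_diff:
  assumes "\<phi> \<in> tempered" "f \<in> schwartz" "g \<in> schwartz"
  shows "\<phi> (\<lambda>x. f x - g x) = \<phi> f - \<phi> g"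
  using tempered_linear[OF assms, of 1 "-1"] by simp

text \<open>The preimage of \<open>(-1, 1)\<close> is open and contains a basic neighbourhood of 0;
  rescaling functions into that neighbourhood gives the bound.\<close>

lemma tempered_norm_bound:
  assumes \<phi>: "\<phi> \<in> tempered"
  obtains C N where "C \<ge> 0" "\<And>f. f \<in> schwartz \<Longrightarrow> \<bar>\<phi> f\<bar> \<le> C * schwartz_norm N f"
proof -
  let ?z = "\<lambda>x::real. 0::real"
  let ?U = "{f \<in> schwartz. \<phi> f \<in> {-1<..<1}}"
  have "\<phi> ?z = 0"
    using tempered_linear[OF \<phi> schwartz_zero schwartz_zero, of 0 0] by simp
  then have z: "?z \<in> ?U" by (simp add: schwartz_zero)
  have "continuous_map schwartz_topology euclideanreal \<phi>"
    using \<phi> by (simp add: tempered_def)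
  then have "openin schwartz_topology ?U"
    unfolding continuous_map_def topspace_schwartz_topology
    using open_real_greaterThanLessThan open_openin by blast
  then obtain N e where e: "e > 0" and sub: "schwartz_nbhd ?z N e \<subseteq> ?U"
    using z unfolding openin_schwartz_topology by blast
  show ?thesis
  proof (rule that[of "1 / e" N])
    show "1 / e \<ge> 0" using e by simp
    fix f assume f: "f \<in> schwartz"
    let ?p = "schwartz_norm N f"
    have p: "?p \<ge> 0" by (rule schwartz_norm_nonneg[OF f])
    have "\<bar>\<phi> f\<bar> * e \<le> ?p + \<eta>" if \<eta>: "\<eta> > 0" for \<eta>
    proof -
      \<comment> \<open>This scaling brings all seminorms up to order \<open>N\<close> below
        \<open>e\<close>; \<open>\<eta>\<close> keeps the denominator positive when
        \<open>?p = 0\<close>.\<close>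
      define c where "c = e / (?p + \<eta>)"
      have c: "c > 0" using e p \<eta> by (simp add: c_def)
      let ?g = "\<lambda>x. c * f x + 0 * f x"
      have "schwartz_seminorm k n ?g < e" if "k \<le> N" "n \<le> N" for k n
      proof -
        have "schwartz_seminorm k n ?g \<le> c * schwartz_seminorm k n f"
          using schwartz_seminorm_lincomb[OF f f, of k n c 0] c by simp
        also have "\<dots> \<le> c * ?p"
          using c that by (intro mult_left_mono schwartz_seminorm_le_norm f) auto
        also have "\<dots> < c * (?p + \<eta>)" using c \<eta> by simp
        also have "\<dots> = e" using p \<eta> by (simp add: c_def)
        finally show ?thesis .
      qed
      then have "?g \<in> schwartz_nbhd ?z N e"
        using schwartz_lincomb[OF f f, of c 0] by (simp add: schwartz_nbhd_def)
      then have "\<bar>\<phi> ?g\<bar> < 1" using sub by auto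
      then have "c * \<bar>\<phi> f\<bar> < 1"
        using tempered_linear[OF \<phi> f f, of c 0] c by (simp add: abs_mult)
      then show ?thesis using p \<eta> by (simp add: c_def field_simps)
    qed
    then have "\<bar>\<phi> f\<bar> * e \<le> ?p" by (rule field_le_epsilon)
    then show "\<bar>\<phi> f\<bar> \<le> 1 / e * ?p" using e by (simp add: field_simps)
  qed
qed

lemma temperedI:
  assumes ext: "\<phi> \<in> extensional schwartz"
    and lin: "\<And>f g a b. f \<in> schwartz \<Longrightarrow> g \<in> schwartz \<Longrightarrow> \<phi> (\<lambda>x. a * f x + b * g x) = a * \<phi> f + b * \<phi> g"
    and bound: "\<And>f. f \<in> schwartz \<Longrightarrow> \<bar>\<phi> f\<bar> \<le> C * schwartz_norm N f"
  shows "\<phi> \<in> tempered"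
proof -
  have diff: "\<phi> (\<lambda>x. f x - g x) = \<phi> f - \<phi> g" if "f \<in> schwartz" "g \<in> schwartz" for f g
    using lin[OF that, of 1 "-1"] by simp
  have "\<exists>N. \<exists>e>0. schwartz_nbhd f N e \<subseteq> {h \<in> schwartz. \<phi> h \<in> U}"
    if U: "open U" and f: "f \<in> schwartz" "\<phi> f \<in> U" for U f
  proof -
    obtain d where d: "d > 0" "ball (\<phi> f) d \<subseteq> U" using U f open_contains_ball by blast
    \<comment> \<open>\<open>(real N + 1)\<^sup>2\<close> pays for passing from single seminorms to
      the norm, and \<open>\<bar>C\<bar> + 1\<close> is positive for every \<open>C\<close>.\<close>
    define e where "e = d / ((real N + 1)\<^sup>2 * (\<bar>C\<bar> + 1))"
    have pos: "(real N + 1)\<^sup>2 * (\<bar>C\<bar> + 1) > 0" by (intro mult_pos_pos) auto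
    then have e: "e > 0" using d by (simp add: e_def)
    have "\<phi> g \<in> U" if g: "g \<in> schwartz_nbhd f N e" for g
    proof -
      have gs: "g \<in> schwartz" using g by (simp add: schwartz_nbhd_def)
      have "schwartz_norm N (\<lambda>x. g x - f x) \<le> (real N + 1)\<^sup>2 * e"
        using g by (intro schwartz_norm_le) (auto simp: schwartz_nbhd_def less_imp_le)
      note n = this
      have "\<bar>\<phi> g - \<phi> f\<bar> \<le> C * schwartz_norm N (\<lambda>x. g x - f x)"
        using bound[OF schwartz_diff[OF gs f(1)]] diff[OF gs f(1)] by simp
      also have "\<dots> \<le> \<bar>C\<bar> * ((real N + 1)\<^sup>2 * e)"
        by (intro mult_mono n schwartz_norm_nonneg schwartz_diff gs f) auto
      also have "\<dots> < (\<bar>C\<bar> + 1) * ((real N + 1)\<^sup>2 * e)"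
        using e by (intro mult_strict_right_mono mult_pos_pos) auto
      also have "\<dots> = e * ((real N + 1)\<^sup>2 * (\<bar>C\<bar> + 1))" by (simp add: mult_ac)
      also have "\<dots> = d" using pos by (simp add: e_def del: mult_eq_0_iff)
      finally show ?thesis using d by (auto simp: dist_real_def)
    qed
    then show ?thesis using e by (intro exI[of _ N] exI[of _ e]) (auto simp: schwartz_nbhd_def)
  qed
  then have "continuous_map schwartz_topology euclideanreal \<phi>"
    unfolding continuous_map_def openin_schwartz_topology by auto
  then show ?thesis using ext lin by (simp add: tempered_def)
qed

text \<open>The restriction keeps the functional extensional, as \<open>tempered\<close> requires;
  \<open>N + N'\<close> is a common order for the two bounds.\<close>

lemma tempered_lincomb:
  assumes \<phi>: "\<phi> \<in> tempered" and \<psi>: "\<psi> \<in> tempered"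
  shows "(\<lambda>f\<in>schwartz. a * \<phi> f + b * \<psi> f) \<in> tempered"
proof -
  obtain C N where C: "C \<ge> 0" "\<And>f. f \<in> schwartz \<Longrightarrow> \<bar>\<phi> f\<bar> \<le> C * schwartz_norm N f"
    by (rule tempered_norm_bound[OF \<phi>]) (rule that)
  obtain C' N' where C': "C' \<ge> 0" "\<And>f. f \<in> schwartz \<Longrightarrow> \<bar>\<psi> f\<bar> \<le> C' * schwartz_norm N' f"
    by (rule tempered_norm_bound[OF \<psi>]) (rule that)
  have mono: "schwartz_norm n f \<le> schwartz_norm (N + N') f"
    if "f \<in> schwartz" "n \<le> N + N'" for n f
    using that by (rule schwartz_norm_mono)
  show ?thesis
  proof (rule temperedI[where C = "\<bar>a\<bar> * C + \<bar>b\<bar> * C'" and N = "N + N'"])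
    show "(\<lambda>f\<in>schwartz. a * \<phi> f + b * \<psi> f) \<in> extensional schwartz" by simp
    fix f g c d assume f: "f \<in> schwartz" and g: "g \<in> schwartz"
    then show "(\<lambda>f\<in>schwartz. a * \<phi> f + b * \<psi> f) (\<lambda>x. c * f x + d * g x)
      = c * (\<lambda>f\<in>schwartz. a * \<phi> f + b * \<psi> f) f + d * (\<lambda>f\<in>schwartz. a * \<phi> f + b * \<psi> f) g"
      by (simp add: schwartz_lincomb tempered_linear[OF \<phi>] tempered_linear[OF \<psi>] algebra_simps)
  next
    fix f assume f: "f \<in> schwartz"
    have "\<bar>a * \<phi> f + b * \<psi> f\<bar> \<le> \<bar>a\<bar> * \<bar>\<phi> f\<bar> + \<bar>b\<bar> * \<bar>\<psi> f\<bar>"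
      by (rule order_trans[OF abs_triangle_ineq]) (simp add: abs_mult)
    also have "\<dots> \<le> \<bar>a\<bar> * (C * schwartz_norm (N + N') f) + \<bar>b\<bar> * (C' * schwartz_norm (N + N') f)"
      using C C' f
      by (intro add_mono mult_left_mono order_trans[OF C(2)] order_trans[OF C'(2)] mono) auto
    finally show "\<bar>(\<lambda>f\<in>schwartz. a * \<phi> f + b * \<psi> f) f\<bar>
        \<le> (\<bar>a\<bar> * C + \<bar>b\<bar> * C') * schwartz_norm (N + N') f"
      using f by (simp add: algebra_simps)
  qed
qed

section \<open>Strong continuity of paths in the dual\<close>

text \<open>The strong topology is given only through its open sets; all later arguments about paths
  use this epsilon-delta form.\<close>

lemma strongly_continuous_iff:
  fixes F :: "real \<Rightarrow> (real \<Rightarrow> real) \<Rightarrow> real"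
  shows "continuous_map (top_of_set {0..}) strong_dual_topology F \<longleftrightarrow>
    (\<forall>t\<ge>0. F t \<in> tempered) \<and>
    (\<forall>t\<ge>0. \<forall>K. schwartz_bounded K \<longrightarrow>
      (\<forall>e>0. \<exists>d>0. \<forall>s\<ge>0. \<bar>s - t\<bar> < d \<longrightarrow> (\<forall>f\<in>K. \<bar>F s f - F t f\<bar> < e)))"
    (is "?L \<longleftrightarrow> ?R1 \<and> ?R2")
proof (intro iffI conjI)
  assume L: ?L
  then show R1: ?R1
    by (auto simp: continuous_map_def Pi_iff)
  show ?R2
  proof (intro allI impI)
    fix t e :: real and K assume t: "t \<ge> 0" and K: "schwartz_bounded K" and e: "e > 0"
    \<comment> \<open>The set where \<open>\<bar>\<psi> f - F t f\<bar> < e\<close> for all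
      \<open>f \<in> K\<close> need not be open, since the gaps may shrink to 0 along
      \<open>K\<close>. A uniform margin \<open>e' < e\<close> repairs this: the neighbourhood of
      radius \<open>(e - e') / 2\<close> over \<open>K\<close> then fits inside.\<close>
    define U where "U = {\<psi> \<in> tempered. \<exists>e'<e. \<forall>f\<in>K. \<bar>\<psi> f - F t f\<bar> \<le> e'}"
    have "openin strong_dual_topology U"
      unfolding openin_strong_dual_topology
    proof (intro conjI ballI)
      fix \<psi> assume "\<psi> \<in> U"
      then obtain e' where e': "e' < e" "\<And>f. f \<in> K \<Longrightarrow> \<bar>\<psi> f - F t f\<bar> \<le> e'" unfolding U_def by blast
      have "tempered_nbhd \<psi> K ((e - e') / 2) \<subseteq> U"
      proof
        fix \<theta> assume \<theta>: "\<theta> \<in> tempered_nbhd \<psi> K ((e - e') / 2)"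
        have "\<bar>\<theta> f - F t f\<bar> \<le> (e + e') / 2" if "f \<in> K" for f
        proof -
          have "\<bar>\<theta> f - \<psi> f\<bar> < (e - e') / 2" using \<theta> that by (simp add: tempered_nbhd_def)
          then show ?thesis using e'(2)[OF that] by argo
        qed
        moreover have "(e + e') / 2 < e" using e' by simp
        ultimately show "\<theta> \<in> U" using \<theta> unfolding tempered_nbhd_def U_def by blast
      qed
      then show "\<exists>K e. schwartz_bounded K \<and> 0 < e \<and> tempered_nbhd \<psi> K e \<subseteq> U"
        using K e' by (intro exI[of _ K] exI[of _ "(e - e') / 2"]) simp
    qed (auto simp: U_def)
    from openin_continuous_map_preimage[OF L this]
    have "openin (top_of_set {0..}) {s \<in> {0..}. F s \<in> U}"
      unfolding topspace_euclidean_subtopology .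
    moreover have "t \<in> {s \<in> {0..}. F s \<in> U}" using t R1 e by (auto simp: U_def)
    ultimately have "\<exists>d>0. \<forall>s\<in>{0..}. dist s t < d \<longrightarrow> s \<in> {s \<in> {0..}. F s \<in> U}"
      unfolding openin_euclidean_subtopology_iff by (elim conjE) (erule bspec)
    then obtain d where d: "d > 0" "\<And>s. s \<in> {0..} \<Longrightarrow> dist s t < d \<Longrightarrow> s \<in> {s \<in> {0..}. F s \<in> U}"
      by blast
    have "\<bar>F s f - F t f\<bar> < e" if "s \<ge> 0" "\<bar>s - t\<bar> < d" "f \<in> K" for s f
      using d(2)[of s] that by (fastforce simp: dist_real_def U_def)
    then show "\<exists>d>0. \<forall>s\<ge>0. \<bar>s - t\<bar> < d \<longrightarrow> (\<forall>f\<in>K. \<bar>F s f - F t f\<bar> < e)"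
      using d(1) by blast
  qed
next
  assume R: "?R1 \<and> ?R2"
  have "openin (top_of_set {0..}) {s \<in> {0..}. F s \<in> U}" if U: "openin strong_dual_topology U" for U
    unfolding openin_euclidean_subtopology_iff
  proof (intro conjI ballI)
    fix t assume t: "t \<in> {s \<in> {0..}. F s \<in> U}"
    then obtain K e where K: "schwartz_bounded K" "e > 0" "tempered_nbhd (F t) K e \<subseteq> U"
      using U unfolding openin_strong_dual_topology by blast
    have "t \<ge> 0" using t by simp
    with R K(1,2) have "\<exists>d>0. \<forall>s\<ge>0. \<bar>s - t\<bar> < d \<longrightarrow> (\<forall>f\<in>K. \<bar>F s f - F t f\<bar> < e)" by simp
    then obtain d where d: "d > 0" "\<And>s f. s \<ge> 0 \<Longrightarrow> \<bar>s - t\<bar> < d \<Longrightarrow> f \<in> K \<Longrightarrow> \<bar>F s f - F t f\<bar> < e"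
      by blast
    have "F s \<in> U" if "s \<ge> 0" "\<bar>s - t\<bar> < d" for s
    proof -
      have "F s \<in> tempered_nbhd (F t) K e"
        using d(2)[OF that] R that by (auto simp: tempered_nbhd_def)
      then show ?thesis using K by blast
    qed
    then show "\<exists>e>0. \<forall>x'\<in>{0..}. dist x' t < e \<longrightarrow> x' \<in> {s \<in> {0..}. F s \<in> U}"
      using d(1) by (auto simp: dist_real_def)
  qed auto
  then show ?L using R by (simp add: continuous_map_def Pi_iff)
qed

lemma strongly_continuous_imp_tempered:
  fixes t :: real
  shows "continuous_map (top_of_set {0..}) strong_dual_topology F \<Longrightarrow> t \<ge> 0 \<Longrightarrow> F t \<in> tempered"
  by (simp add: strongly_continuous_iff)

lemma strongly_continuousD:
  fixes F :: "real \<Rightarrow> (real \<Rightarrow> real) \<Rightarrow> real"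
  assumes "continuous_map (top_of_set {0..}) strong_dual_topology F"
    and "t \<ge> 0" "schwartz_bounded K" "e > 0"
  obtains d where "d > 0" "\<And>s f. s \<ge> 0 \<Longrightarrow> \<bar>s - t\<bar> < d \<Longrightarrow> f \<in> K \<Longrightarrow> \<bar>F s f - F t f\<bar> < e"
  using assms unfolding strongly_continuous_iff by meson

lemma schwartz_bounded_singleton: "f \<in> schwartz \<Longrightarrow> schwartz_bounded {f}"
  by (simp add: schwartz_bounded_def)

lemma strongly_continuous_imp_continuous_on:
  fixes F :: "real \<Rightarrow> (real \<Rightarrow> real) \<Rightarrow> real"
  assumes "continuous_map (top_of_set {0..}) strong_dual_topology F" "f \<in> schwartz"
  shows "continuous_on {0..} (\<lambda>t. F t f)"
  unfolding continuous_on_iff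
proof (intro ballI allI impI)
  fix t e :: real assume "t \<in> {0..}" "e > 0"
  then have t: "t \<ge> 0" and e: "e > 0" by auto
  obtain d where "d > 0" "\<And>s g. s \<ge> 0 \<Longrightarrow> \<bar>s - t\<bar> < d \<Longrightarrow> g \<in> {f} \<Longrightarrow> \<bar>F s g - F t g\<bar> < e"
    by (rule strongly_continuousD[OF assms(1) t schwartz_bounded_singleton[OF assms(2)] e]) (rule that)
  then show "\<exists>d>0. \<forall>x'\<in>{0..}. dist x' t < d \<longrightarrow> dist (F x' f) (F t f) < e"
    by (auto simp: dist_real_def)
qed

lemma strongly_continuous_lincomb:
  fixes F G :: "real \<Rightarrow> (real \<Rightarrow> real) \<Rightarrow> real"
  assumes F: "continuous_map (top_of_set {0..}) strong_dual_topology F"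
    and G: "continuous_map (top_of_set {0..}) strong_dual_topology G"
  shows "continuous_map (top_of_set {0..}) strong_dual_topology (\<lambda>t. \<lambda>f\<in>schwartz. a * F t f + b * G t f)"
  unfolding strongly_continuous_iff
proof (intro conjI allI impI)
  show "(\<lambda>f\<in>schwartz. a * F t f + b * G t f) \<in> tempered" if "t \<ge> 0" for t
    using that F G by (intro tempered_lincomb strongly_continuous_imp_tempered)
  fix t e :: real and K assume t: "t \<ge> 0" and K: "schwartz_bounded K" and e: "e > 0"
  define h where "h = e / (\<bar>a\<bar> + \<bar>b\<bar> + 1)"
  have h: "h > 0" using e by (simp add: h_def add_nonneg_pos)
  obtain d where d: "d > 0" "\<And>s f. s \<ge> 0 \<Longrightarrow> \<bar>s - t\<bar> < d \<Longrightarrow> f \<in> K \<Longrightarrow> \<bar>F s f - F t f\<bar> < h"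
    by (rule strongly_continuousD[OF F t K h]) (rule that)
  obtain d' where d': "d' > 0" "\<And>s f. s \<ge> 0 \<Longrightarrow> \<bar>s - t\<bar> < d' \<Longrightarrow> f \<in> K \<Longrightarrow> \<bar>G s f - G t f\<bar> < h"
    by (rule strongly_continuousD[OF G t K h]) (rule that)
  have "\<bar>(a * F s f + b * G s f) - (a * F t f + b * G t f)\<bar> < e"
    if s: "s \<ge> 0" "\<bar>s - t\<bar> < min d d'" "f \<in> K" for s f
  proof -
    have "\<bar>(a * F s f + b * G s f) - (a * F t f + b * G t f)\<bar>
        = \<bar>a * (F s f - F t f) + b * (G s f - G t f)\<bar>" by (simp add: algebra_simps)
    also have "\<dots> \<le> \<bar>a\<bar> * \<bar>F s f - F t f\<bar> + \<bar>b\<bar> * \<bar>G s f - G t f\<bar>"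
      by (rule order_trans[OF abs_triangle_ineq]) (simp add: abs_mult)
    also have "\<dots> \<le> \<bar>a\<bar> * h + \<bar>b\<bar> * h"
      using d(2)[of s f] d'(2)[of s f] s by (intro add_mono mult_left_mono) auto
    also have "\<dots> < (\<bar>a\<bar> + \<bar>b\<bar> + 1) * h" using h by (simp add: algebra_simps)
    also have "\<dots> = e" by (simp add: h_def)
    finally show ?thesis .
  qed
  moreover have "f \<in> schwartz" if "f \<in> K" for f using K that by (auto simp: schwartz_bounded_def)
  ultimately show "\<exists>d>0. \<forall>s\<ge>0. \<bar>s - t\<bar> < d \<longrightarrow> (\<forall>f\<in>K. \<bar>(\<lambda>f\<in>schwartz. a * F s f + b * G s f) f
      - (\<lambda>f\<in>schwartz. a * F t f + b * G t f) f\<bar> < e)"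
    using d(1) d'(1) by (intro exI[of _ "min d d'"]) auto
qed

section \<open>The adjoint semigroup on tempered distributions\<close>

text \<open>The bound sees \<open>f\<close> only through one norm, hence is uniform over bounded
  sets; this makes \<open>t \<mapsto> \<phi> \<circ> P_t\<close> strongly and not just weakly
  continuous.\<close>

lemma tempered_semigroup_lipschitz:
  assumes \<phi>: "\<phi> \<in> tempered"
  obtains C N where "C \<ge> 0"
    "\<And>f a b. f \<in> schwartz \<Longrightarrow> a \<in> {0..T} \<Longrightarrow> b \<in> {0..T} \<Longrightarrow>
      \<bar>\<phi> (brownian_semigroup b f) - \<phi> (brownian_semigroup a f)\<bar> \<le> C * \<bar>b - a\<bar> * schwartz_norm N f"
proof -
  obtain C N where C: "C \<ge> 0" "\<And>f. f \<in> schwartz \<Longrightarrow> \<bar>\<phi> f\<bar> \<le> C * schwartz_norm N f"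
    by (rule tempered_norm_bound[OF \<phi>]) (rule that)
  obtain D where D: "D \<ge> 0" "\<And>f a b. f \<in> schwartz \<Longrightarrow> a \<in> {0..T} \<Longrightarrow> b \<in> {0..T} \<Longrightarrow>
      schwartz_norm N (\<lambda>x. brownian_semigroup b f x - brownian_semigroup a f x)
        \<le> D * \<bar>b - a\<bar> * schwartz_norm (N + 2) f"
    by (rule brownian_semigroup_lipschitz[of T N]) (rule that)
  show ?thesis
  proof (rule that[of "C * D" "N + 2"])
    show "0 \<le> C * D" using C D by simp
    fix f a b assume f: "f \<in> schwartz" and a: "a \<in> {0..T}" and b: "b \<in> {0..T}"
    have P: "brownian_semigroup a f \<in> schwartz" "brownian_semigroup b f \<in> schwartz"
      using a b f by (auto intro: schwartz_brownian_semigroup)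
    have "\<bar>\<phi> (brownian_semigroup b f) - \<phi> (brownian_semigroup a f)\<bar>
      \<le> C * schwartz_norm N (\<lambda>x. brownian_semigroup b f x - brownian_semigroup a f x)"
      using C(2)[OF schwartz_diff[OF P(2,1)]] tempered_diff[OF \<phi> P(2,1)] by simp
    also have "\<dots> \<le> C * (D * \<bar>b - a\<bar> * schwartz_norm (N + 2) f)"
      by (intro mult_left_mono D f a b C)
    finally show "\<bar>\<phi> (brownian_semigroup b f) - \<phi> (brownian_semigroup a f)\<bar>
        \<le> C * D * \<bar>b - a\<bar> * schwartz_norm (N + 2) f" by (simp add: mult_ac)
  qed
qed

lemma tempered_semigroup:
  assumes \<phi>: "\<phi> \<in> tempered" and t: "t \<ge> 0"
  shows "(\<lambda>f\<in>schwartz. \<phi> (brownian_semigroup t f)) \<in> tempered"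
proof -
  obtain C N where C: "C \<ge> 0" "\<And>f. f \<in> schwartz \<Longrightarrow> \<bar>\<phi> f\<bar> \<le> C * schwartz_norm N f"
    by (rule tempered_norm_bound[OF \<phi>]) (rule that)
  obtain D where D: "D \<ge> 0" "\<And>f s. f \<in> schwartz \<Longrightarrow> 0 \<le> s \<Longrightarrow> s \<le> t \<Longrightarrow>
      schwartz_norm N (brownian_semigroup s f) \<le> D * schwartz_norm N f"
    by (rule schwartz_norm_brownian_semigroup[of t N]) (rule that)
  show ?thesis
  proof (rule temperedI[where C = "C * D" and N = N])
    show "(\<lambda>f\<in>schwartz. \<phi> (brownian_semigroup t f)) \<in> extensional schwartz" by simp
    fix f g a b assume "f \<in> schwartz" "g \<in> schwartz"
    then show "(\<lambda>f\<in>schwartz. \<phi> (brownian_semigroup t f)) (\<lambda>x. a * f x + b * g x)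
      = a * (\<lambda>f\<in>schwartz. \<phi> (brownian_semigroup t f)) f + b * (\<lambda>f\<in>schwartz. \<phi> (brownian_semigroup t f)) g"
      by (simp add: schwartz_lincomb brownian_semigroup_lincomb t tempered_linear[OF \<phi>] schwartz_brownian_semigroup)
  next
    fix f assume f: "f \<in> schwartz"
    have "\<bar>\<phi> (brownian_semigroup t f)\<bar> \<le> C * (D * schwartz_norm N f)"
      by (rule order_trans[OF C(2) mult_left_mono[OF D(2)]])
        (use f t C in \<open>auto intro: schwartz_brownian_semigroup\<close>)
    then show "\<bar>(\<lambda>f\<in>schwartz. \<phi> (brownian_semigroup t f)) f\<bar> \<le> C * D * schwartz_norm N f"
      using f by (simp add: mult.assoc)
  qed
qed

lemma strongly_continuous_semigroup:
  assumes \<phi>: "\<phi> \<in> tempered"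
  shows "continuous_map (top_of_set {0..}) strong_dual_topology (\<lambda>t. \<lambda>f\<in>schwartz. \<phi> (brownian_semigroup t f))"
  unfolding strongly_continuous_iff
proof (intro conjI allI impI)
  fix t e :: real and K assume t: "t \<ge> 0" and K: "schwartz_bounded K" and e: "e > 0"
  obtain C N where C: "C \<ge> 0"
    "\<And>f a b. f \<in> schwartz \<Longrightarrow> a \<in> {0..t + 1} \<Longrightarrow> b \<in> {0..t + 1} \<Longrightarrow>
      \<bar>\<phi> (brownian_semigroup b f) - \<phi> (brownian_semigroup a f)\<bar> \<le> C * \<bar>b - a\<bar> * schwartz_norm N f"
    by (rule tempered_semigroup_lipschitz[OF \<phi>, of "t + 1"]) (rule that)
  obtain M where M: "M > 0" "\<And>f. f \<in> K \<Longrightarrow> schwartz_norm N f \<le> M"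
    by (rule schwartz_bounded_norm[OF K]) (rule that)
  \<comment> \<open>The first \<open>1\<close> keeps \<open>s\<close> inside
    \<open>{0..t + 1}\<close>, where \<open>C\<close> is valid; the one in the denominator covers
    \<open>C * M = 0\<close>.\<close>
  define d where "d = min 1 (e / (C * M + 1))"
  have CM: "C * M + 1 > 0" using C M by (simp add: add_nonneg_pos)
  have d: "d > 0" using e CM by (simp add: d_def)
  have *: "\<bar>(\<lambda>f\<in>schwartz. \<phi> (brownian_semigroup s f)) f - (\<lambda>f\<in>schwartz. \<phi> (brownian_semigroup t f)) f\<bar> < e"
    if s: "s \<ge> 0" "\<bar>s - t\<bar> < d" "f \<in> K" for s f
  proof -
    have f: "f \<in> schwartz" using K s by (auto simp: schwartz_bounded_def)
    have "\<bar>\<phi> (brownian_semigroup s f) - \<phi> (brownian_semigroup t f)\<bar> \<le> C * \<bar>s - t\<bar> * schwartz_norm N f"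
      using s t by (intro C f) (auto simp: d_def)
    also have "\<dots> \<le> C * \<bar>s - t\<bar> * M" using s M C by (intro mult_left_mono) auto
    also have "\<dots> = (C * M) * \<bar>s - t\<bar>" by simp
    also have "\<dots> \<le> (C * M) * d" using s C M by (intro mult_left_mono) auto
    also have "\<dots> < (C * M + 1) * d" using d by (simp add: algebra_simps)
    also have "\<dots> \<le> (C * M + 1) * (e / (C * M + 1))" using CM by (intro mult_left_mono) (auto simp: d_def)
    also have "\<dots> = e" using CM by simp
    finally show ?thesis using f by simp
  qed
  then show "\<exists>d>0. \<forall>s\<ge>0. \<bar>s - t\<bar> < d \<longrightarrow> (\<forall>f\<in>K.
      \<bar>(\<lambda>f\<in>schwartz. \<phi> (brownian_semigroup s f)) f - (\<lambda>f\<in>schwartz. \<phi> (brownian_semigroup t f)) f\<bar> < e)"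
    using d by blast
qed (rule tempered_semigroup[OF \<phi>])

lemma tempered_semigroup_continuous_on:
  assumes "\<phi> \<in> tempered" "f \<in> schwartz"
  shows "continuous_on {0..} (\<lambda>t. \<phi> (brownian_semigroup t f))"
  using strongly_continuous_imp_continuous_on[OF strongly_continuous_semigroup[OF assms(1)] assms(2)] assms(2)
  by simp

text \<open>The second-order estimate passes through the norm bound of \<open>\<phi>\<close>.
  Increments smaller than \<open>r\<close> keep both times in \<open>{0..2 * r}\<close>, hence the
  derivative at positive times.\<close>

lemma tempered_semigroup_has_derivative:
  assumes \<phi>: "\<phi> \<in> tempered" and f: "f \<in> schwartz" and r: "r > 0"
  shows "((\<lambda>r. \<phi> (brownian_semigroup r f)) has_real_derivative \<phi> (brownian_semigroup r (half_laplacian f))) (at r)"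
proof -
  obtain C N where C: "C \<ge> 0" "\<And>f. f \<in> schwartz \<Longrightarrow> \<bar>\<phi> f\<bar> \<le> C * schwartz_norm N f"
    by (rule tempered_norm_bound[OF \<phi>]) (rule that)
  let ?g = "half_laplacian f"
  have g: "?g \<in> schwartz" by (rule schwartz_half_laplacian[OF f])
  obtain D where D: "D \<ge> 0" "\<And>f a b. f \<in> schwartz \<Longrightarrow> a \<in> {0..2 * r} \<Longrightarrow> b \<in> {0..2 * r} \<Longrightarrow>
      schwartz_norm N (\<lambda>x. (brownian_semigroup b f x - brownian_semigroup a f x)
          - (b - a) * brownian_semigroup a (half_laplacian f) x)
        \<le> D * (b - a)\<^sup>2 * schwartz_norm (N + 2) (half_laplacian f)"
    by (rule brownian_semigroup_second_order[of "2 * r" N]) (rule that)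
  show ?thesis
  proof (rule has_real_derivative_by_quadratic_bound[OF r])
    fix h :: real assume h: "\<bar>h\<bar> < r"
    have P: "brownian_semigroup (r + h) f \<in> schwartz" "brownian_semigroup r f \<in> schwartz"
      "brownian_semigroup r ?g \<in> schwartz"
      using r h by (auto intro!: schwartz_brownian_semigroup f g)
    note d = schwartz_diff[OF P(1,2)]
    let ?u = "\<lambda>x. 1 * (brownian_semigroup (r + h) f x - brownian_semigroup r f x) + (- h) * brownian_semigroup r ?g x"
    have "\<phi> ?u = \<phi> (brownian_semigroup (r + h) f) - \<phi> (brownian_semigroup r f) - h * \<phi> (brownian_semigroup r ?g)"
      by (subst tempered_linear[OF \<phi> d P(3)]) (simp add: tempered_diff[OF \<phi> P(1,2)])
    moreover have "\<bar>\<phi> ?u\<bar> \<le> C * schwartz_norm N ?u"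
      by (rule C(2)[OF schwartz_lincomb[OF d P(3)]])
    moreover have "C * schwartz_norm N ?u \<le> C * (D * h\<^sup>2 * schwartz_norm (N + 2) ?g)"
    proof (intro mult_left_mono C)
      have "r \<in> {0..2 * r}" "r + h \<in> {0..2 * r}" using r h by (auto simp: abs_less_iff)
      from D(2)[OF f this] show "schwartz_norm N ?u \<le> D * h\<^sup>2 * schwartz_norm (N + 2) ?g" by simp
    qed
    ultimately show "\<bar>\<phi> (brownian_semigroup (r + h) f) - \<phi> (brownian_semigroup r f)
        - h * \<phi> (brownian_semigroup r ?g)\<bar> \<le> (C * D * schwartz_norm (N + 2) ?g) * h\<^sup>2"
      by (simp add: mult_ac)
  qed
qed

text \<open>In contrast to the pointwise version for \<open>P_t f x\<close>, this yields one
  \<open>\<xi>\<close> for the functional as a whole.\<close>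

lemma tempered_semigroup_mvt:
  assumes \<phi>: "\<phi> \<in> tempered" and f: "f \<in> schwartz" and ab: "0 \<le> a" "a \<le> b"
  obtains \<xi> where "a \<le> \<xi>" "\<xi> \<le> b"
    "\<phi> (brownian_semigroup b f) - \<phi> (brownian_semigroup a f) = (b - a) * \<phi> (brownian_semigroup \<xi> (half_laplacian f))"
proof (cases "a = b")
  case True
  then show ?thesis using that[of a] by simp
next
  case False
  then have less: "a < b" using ab by simp
  have "continuous_on {a..b} (\<lambda>r. \<phi> (brownian_semigroup r f))"
    using tempered_semigroup_continuous_on[OF \<phi> f] by (rule continuous_on_subset) (use ab in auto)
  moreover have "(\<lambda>r. \<phi> (brownian_semigroup r f)) differentiable (at r)" if "a < r" "r < b" for r
    using tempered_semigroup_has_derivative[OF \<phi> f, of r] that ab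
    by (auto simp: real_differentiable_def)
  ultimately obtain l z where z: "a < z" "z < b" "((\<lambda>r. \<phi> (brownian_semigroup r f)) has_real_derivative l) (at z)"
    "\<phi> (brownian_semigroup b f) - \<phi> (brownian_semigroup a f) = (b - a) * l"
    by (rule MVT[OF less, elim_format]) blast+
  moreover have "l = \<phi> (brownian_semigroup z (half_laplacian f))"
    using tempered_semigroup_has_derivative[OF \<phi> f, of z] z ab by (intro DERIV_unique[OF z(3)]) auto
  ultimately show ?thesis using that[of z] by simp
qed

text \<open>Continuity in \<open>s\<close> uniformly over the bounded set \<open>{P\<^sub>r f | 0 \<le> r \<le> T}\<close> is where the strong
  topology on the dual enters.\<close>

lemma strongly_continuous_semigroup_jointly:
  fixes F :: "real \<Rightarrow> (real \<Rightarrow> real) \<Rightarrow> real"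
  assumes F: "continuous_map (top_of_set {0..}) strong_dual_topology F" and f: "f \<in> schwartz"
  shows "continuous_on ({0..T} \<times> {0..T}) (\<lambda>(s, r). F s (brownian_semigroup r f))"
proof -
  let ?K = "(\<lambda>r. brownian_semigroup r f) ` {0..T}"
  have K: "schwartz_bounded ?K"
  proof -
    have "bdd_above (schwartz_seminorm k n ` ?K)" for k n
    proof -
      \<comment> \<open>Order \<open>k + n\<close> dominates the seminorm with indices
        \<open>k\<close> and \<open>n\<close>, and the norm of that order stays bounded along the
        orbit.\<close>
      obtain D where D: "\<And>t. 0 \<le> t \<Longrightarrow> t \<le> T \<Longrightarrow>
          schwartz_norm (k + n) (brownian_semigroup t f) \<le> D * schwartz_norm (k + n) f"
        using schwartz_norm_brownian_semigroup[of T "k + n"] f by metis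
      show ?thesis
        using D by (auto intro!: bdd_aboveI2[where M = "D * schwartz_norm (k + n) f"]
            order_trans[OF schwartz_seminorm_le_norm[where N = "k + n"]] schwartz_brownian_semigroup f)
    qed
    then show ?thesis using f by (auto simp: schwartz_bounded_def schwartz_brownian_semigroup)
  qed
  show ?thesis
    unfolding continuous_on_iff
  proof (intro ballI allI impI)
    fix p :: "real \<times> real" and e :: real assume p: "p \<in> {0..T} \<times> {0..T}" and e: "e > 0"
    obtain s r where sr: "p = (s, r)" "s \<in> {0..T}" "r \<in> {0..T}" using p by auto
    \<comment> \<open>This \<open>d\<close> serves all members of the orbit at once, so
      \<open>s\<close> can be moved with \<open>r'\<close> fixed, and then \<open>r'\<close> with
      \<open>s\<close> fixed.\<close>
    obtain d where d: "d > 0" "\<And>s' g. s' \<ge> 0 \<Longrightarrow> \<bar>s' - s\<bar> < d \<Longrightarrow> g \<in> ?K \<Longrightarrow> \<bar>F s' g - F s g\<bar> < e / 2"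
    proof (rule strongly_continuousD[OF F _ K, of s "e / 2"])
      show "s \<ge> 0" "e / 2 > 0" using sr e by auto
    qed (rule that)
    have "continuous_on {0..} (\<lambda>r. F s (brownian_semigroup r f))"
      using sr by (intro tempered_semigroup_continuous_on strongly_continuous_imp_tempered[OF F] f) auto
    moreover have "r \<in> {0..}" using sr by simp
    ultimately have "\<exists>d>0. \<forall>r'\<in>{0..}. dist r' r < d \<longrightarrow>
        dist (F s (brownian_semigroup r' f)) (F s (brownian_semigroup r f)) < e / 2"
      unfolding continuous_on_iff using half_gt_zero[OF e] by blast
    then obtain d' where d': "d' > 0" "\<And>r'. r' \<ge> 0 \<Longrightarrow> \<bar>r' - r\<bar> < d' \<Longrightarrow>
        \<bar>F s (brownian_semigroup r' f) - F s (brownian_semigroup r f)\<bar> < e / 2"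
      by (auto simp: dist_real_def)
    have "dist (F s' (brownian_semigroup r' f)) (F s (brownian_semigroup r f)) < e"
      if *: "s' \<in> {0..T}" "r' \<in> {0..T}" "dist (s', r') p < min d d'" for s' r'
    proof -
      have "\<bar>s' - s\<bar> < d" "\<bar>r' - r\<bar> < d'"
        using * dist_fst_le[of "(s', r')" p] dist_snd_le[of "(s', r')" p] sr
        by (auto simp: dist_real_def)
      moreover have "s' \<ge> 0" "r' \<ge> 0" "brownian_semigroup r' f \<in> ?K" using * by auto
      ultimately have "\<bar>F s' (brownian_semigroup r' f) - F s (brownian_semigroup r' f)\<bar> < e / 2"
        "\<bar>F s (brownian_semigroup r' f) - F s (brownian_semigroup r f)\<bar> < e / 2"
        using d(2) d'(2) by blast+
      then show ?thesis unfolding dist_real_def by argo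
    qed
    then show "\<exists>d>0. \<forall>x'\<in>{0..T} \<times> {0..T}. dist x' p < d \<longrightarrow>
      dist (case x' of (s, r) \<Rightarrow> F s (brownian_semigroup r f)) (case p of (s, r) \<Rightarrow> F s (brownian_semigroup r f)) < e"
      using d(1) d'(1) sr(1) by (intro exI[of _ "min d d'"]) auto
  qed
qed

subsection \<open>Separability of the Schwartz space\<close>

lemma floor_eq_imp_close:
  fixes a b c :: real
  assumes "\<lfloor>a * c\<rfloor> = \<lfloor>b * c\<rfloor>" "c > 0"
  shows "\<bar>a - b\<bar> \<le> 1 / c"
proof -
  have "\<bar>a * c - b * c\<bar> \<le> 1" using assms(1) by linarith
  then have "\<bar>a - b\<bar> * c \<le> 1" using assms(2) by (simp add: abs_mult flip: left_diff_distrib)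
  then show ?thesis using assms(2) by (simp add: field_simps)
qed

lemma schwartz_derivs_lipschitz:
  assumes f: "f \<in> schwartz" and n: "n \<le> N"
  shows "\<bar>(deriv ^^ n) f x - (deriv ^^ n) f y\<bar> \<le> schwartz_norm (N + 1) f * \<bar>x - y\<bar>"
proof -
  have "norm ((deriv ^^ n) f x - (deriv ^^ n) f y) \<le> schwartz_norm (N + 1) f * norm (x - y)"
  proof (rule field_differentiable_bound[where S = UNIV])
    show "((deriv ^^ n) f has_field_derivative (deriv ^^ Suc n) f z) (at z within UNIV)" for z
      using schwartz_has_derivative[OF f] by simp
    show "norm ((deriv ^^ Suc n) f z) \<le> schwartz_norm (N + 1) f" for z
      using schwartz_deriv_bounded[OF f, of "Suc n" z] schwartz_seminorm_le_norm[OF f, of 0 "N + 1" "Suc n"] n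
      by simp
  qed auto
  then show ?thesis by simp
qed

text \<open>One more factor \<open>x\<close> in the weight is still controlled by the norm of order
  \<open>N + 1\<close>; dividing by \<open>\<bar>x\<bar> \<ge> R\<close> gives smallness.\<close>

lemma schwartz_tail:
  assumes f: "f \<in> schwartz" and kn: "k \<le> N" "n \<le> N" and x: "\<bar>x\<bar> \<ge> R" "R > 0"
    and R: "schwartz_norm (N + 1) f \<le> R * \<epsilon>"
  shows "\<bar>x ^ k * (deriv ^^ n) f x\<bar> \<le> \<epsilon>"
proof -
  have "\<bar>x\<bar> * \<bar>x ^ k * (deriv ^^ n) f x\<bar> = \<bar>x ^ Suc k * (deriv ^^ n) f x\<bar>"
    by (simp add: abs_mult)
  also have "\<dots> \<le> schwartz_norm (N + 1) f"
    by (rule order_trans[OF schwartz_seminorm_upper[OF f] schwartz_seminorm_le_norm[OF f]]) (use kn in auto)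
  finally have "R * \<bar>x ^ k * (deriv ^^ n) f x\<bar> \<le> R * \<epsilon>"
    using R mult_right_mono[OF x(1), of "\<bar>x ^ k * (deriv ^^ n) f x\<bar>"] by linarith
  then show ?thesis using x(2) by simp
qed

text \<open>A Schwartz function is coded by a radius \<open>R\<close> beyond which it is negligible, a mesh \<open>1/q\<close> below
  which its derivatives hardly vary, and the rounded values of its derivatives on the grid.\<close>

definition schwartz_grid :: "nat \<Rightarrow> real \<Rightarrow> nat \<Rightarrow> nat \<Rightarrow> (real \<Rightarrow> real) \<Rightarrow> int list list" where
  "schwartz_grid N \<epsilon> R q f = map (\<lambda>n. map (\<lambda>j. \<lfloor>(deriv ^^ n) f (of_int j / real q) * (real R ^ N / \<epsilon>)\<rfloor>)
      [- int (R * q)..int (R * q)]) [0..<Suc N]"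

text \<open>Outside \<open>[-R, R]\<close> each function contributes at most
  \<open>\<epsilon>\<close>. Inside there are three errors of \<open>\<epsilon> / R ^ N\<close>, two
  from moving to the grid point and one from rounding, and the weight is at most
  \<open>R ^ N\<close>. Order \<open>N + 1\<close> supplies the extra weight for the tail and the
  extra derivative for the Lipschitz bound.\<close>

lemma schwartz_grid_close:
  assumes f: "f \<in> schwartz" and g: "g \<in> schwartz" and \<epsilon>: "\<epsilon> > 0" and R: "R \<ge> 1" and q: "q \<ge> 1"
    and Rf: "schwartz_norm (N + 1) f \<le> real R * \<epsilon>" and Rg: "schwartz_norm (N + 1) g \<le> real R * \<epsilon>"
    and qf: "schwartz_norm (N + 1) f * real R ^ N \<le> real q * \<epsilon>"
    and qg: "schwartz_norm (N + 1) g * real R ^ N \<le> real q * \<epsilon>"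
    and eq: "schwartz_grid N \<epsilon> R q f = schwartz_grid N \<epsilon> R q g"
  shows "schwartz_norm N (\<lambda>x. f x - g x) \<le> (real N + 1)\<^sup>2 * (3 * \<epsilon>)"
proof (intro schwartz_norm_le schwartz_seminorm_least)
  fix k n x assume kn: "k \<le> N" "n \<le> N"
  let ?f = "(deriv ^^ n) f" and ?g = "(deriv ^^ n) g"
  have eq_abs: "\<bar>x ^ k * (deriv ^^ n) (\<lambda>x. f x - g x) x\<bar> = \<bar>x ^ k * ?f x - x ^ k * ?g x\<bar>"
    by (simp add: derivs_diff[OF f g] algebra_simps)
  show "\<bar>x ^ k * (deriv ^^ n) (\<lambda>x. f x - g x) x\<bar> \<le> 3 * \<epsilon>"
  proof (cases "\<bar>x\<bar> \<le> real R")
    case False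
    then have "\<bar>x ^ k * ?f x\<bar> \<le> \<epsilon>" "\<bar>x ^ k * ?g x\<bar> \<le> \<epsilon>"
      using schwartz_tail[OF f kn _ _ Rf] schwartz_tail[OF g kn _ _ Rg] R by auto
    then show ?thesis unfolding eq_abs using \<epsilon> by linarith
  next
    case True
    \<comment> \<open>Rounding down cannot leave the grid, because its left end
      \<open>- R * q\<close> is an integer.\<close>
    define j where "j = \<lfloor>x * real q\<rfloor>"
    define y where "y = of_int j / real q"
    have xy: "\<bar>x - y\<bar> \<le> 1 / real q"
    proof -
      have "\<bar>x * real q - of_int j\<bar> \<le> 1" unfolding j_def by linarith
      moreover have "(x - y) * real q = x * real q - of_int j" using q by (simp add: y_def left_diff_distrib)
      ultimately have "\<bar>(x - y) * real q\<bar> \<le> 1" by simp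
      then have "\<bar>x - y\<bar> * real q \<le> 1" by (simp add: abs_mult)
      then show ?thesis using q by (simp add: field_simps)
    qed
    have lip: "\<bar>(deriv ^^ n) h x - (deriv ^^ n) h y\<bar> \<le> \<epsilon> / real R ^ N"
      if h: "h \<in> schwartz" and qh: "schwartz_norm (N + 1) h * real R ^ N \<le> real q * \<epsilon>" for h
    proof -
      have "\<bar>(deriv ^^ n) h x - (deriv ^^ n) h y\<bar> \<le> schwartz_norm (N + 1) h * \<bar>x - y\<bar>"
        by (rule schwartz_derivs_lipschitz[OF h kn(2)])
      also have "\<dots> \<le> schwartz_norm (N + 1) h * (1 / real q)"
        by (intro mult_left_mono xy schwartz_norm_nonneg h)
      also have "\<dots> \<le> \<epsilon> / real R ^ N" using qh q R by (simp add: field_simps)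
      finally show ?thesis .
    qed
    have "x * real q \<le> real R * real q" "- (real R * real q) \<le> x * real q"
      using True q mult_right_mono[of x "real R" "real q"] mult_right_mono[of "- real R" x "real q"] by auto
    then have "j \<in> set [- int (R * q)..int (R * q)]"
      unfolding j_def by (auto simp: le_floor_iff floor_le_iff)
    moreover have "map (\<lambda>j. \<lfloor>?f (of_int j / real q) * (real R ^ N / \<epsilon>)\<rfloor>) [- int (R * q)..int (R * q)]
        = map (\<lambda>j. \<lfloor>?g (of_int j / real q) * (real R ^ N / \<epsilon>)\<rfloor>) [- int (R * q)..int (R * q)]"
    proof -
      have "n \<in> set [0..<Suc N]" using kn(2) by (simp only: set_upt) auto
      then show ?thesis using bspec[OF eq[unfolded schwartz_grid_def map_eq_conv[of _ "[0..<Suc N]"]]] by blast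
    qed
    ultimately have "\<lfloor>?f y * (real R ^ N / \<epsilon>)\<rfloor> = \<lfloor>?g y * (real R ^ N / \<epsilon>)\<rfloor>"
      unfolding map_eq_conv y_def by blast
    then have "\<bar>?f y - ?g y\<bar> \<le> \<epsilon> / real R ^ N"
      using floor_eq_imp_close[of "?f y" "real R ^ N / \<epsilon>" "?g y"] R \<epsilon> by simp
    then have "\<bar>?f x - ?g x\<bar> \<le> 3 * (\<epsilon> / real R ^ N)"
      using lip[OF f qf] lip[OF g qg] by linarith
    moreover have "\<bar>x ^ k\<bar> \<le> real R ^ N"
    proof -
      have "\<bar>x ^ k\<bar> \<le> real R ^ k" using True by (simp add: power_abs power_mono)
      also have "\<dots> \<le> real R ^ N" using kn R by (intro power_increasing) auto
      finally show ?thesis .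
    qed
    ultimately have "\<bar>x ^ k\<bar> * \<bar>?f x - ?g x\<bar> \<le> real R ^ N * (3 * (\<epsilon> / real R ^ N))"
      by (intro mult_mono) auto
    also have "\<dots> = 3 * \<epsilon>" using R by simp
    finally show ?thesis unfolding eq_abs by (simp add: abs_mult flip: right_diff_distrib)
  qed
qed

text \<open>Codes range over a countable type, so choosing one preimage per attained code gives a
  countable net inside \<open>schwartz\<close> without constructing any function. Equal codes
  include equal \<open>R\<close> and \<open>q\<close>, so the size conditions hold for both
  functions.\<close>

lemma schwartz_countable_net:
  assumes e: "e > 0"
  obtains D where "countable D" "D \<subseteq> schwartz"
    "\<And>f. f \<in> schwartz \<Longrightarrow> \<exists>g\<in>D. schwartz_norm N (\<lambda>x. f x - g x) < e"
proof -
  \<comment> \<open>The \<open>4\<close> exceeds the \<open>3\<close> of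
    \<open>schwartz_grid_close\<close>, which makes the final inequality strict.\<close>
  define \<epsilon> where "\<epsilon> = e / ((real N + 1)\<^sup>2 * 4)"
  have \<epsilon>: "\<epsilon> > 0" using e by (simp add: \<epsilon>_def)
  define R where "R f = nat \<lceil>schwartz_norm (N + 1) f / \<epsilon>\<rceil> + 1" for f
  define q where "q f = nat \<lceil>schwartz_norm (N + 1) f * real (R f) ^ N / \<epsilon>\<rceil> + 1" for f
  have R: "schwartz_norm (N + 1) f \<le> real (R f) * \<epsilon>" for f
  proof -
    have "schwartz_norm (N + 1) f / \<epsilon> \<le> real (R f)"
      unfolding R_def using real_nat_ceiling_ge[of "schwartz_norm (N + 1) f / \<epsilon>"] by simp
    then show ?thesis using \<epsilon> by (simp add: field_simps)
  qed
  have q: "schwartz_norm (N + 1) f * real (R f) ^ N \<le> real (q f) * \<epsilon>" for f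
  proof -
    have "schwartz_norm (N + 1) f * real (R f) ^ N / \<epsilon> \<le> real (q f)"
      unfolding q_def using real_nat_ceiling_ge[of "schwartz_norm (N + 1) f * real (R f) ^ N / \<epsilon>"] by simp
    then show ?thesis using \<epsilon> by (simp add: field_simps)
  qed
  define \<Phi> where "\<Phi> f = (R f, q f, schwartz_grid N \<epsilon> (R f) (q f) f)" for f
  show ?thesis
  proof (rule that[of "inv_into schwartz \<Phi> ` \<Phi> ` schwartz"])
    show "countable (inv_into schwartz \<Phi> ` \<Phi> ` schwartz)"
      by (rule countable_image[OF countableI_type])
    show "inv_into schwartz \<Phi> ` \<Phi> ` schwartz \<subseteq> schwartz" by (auto intro: inv_into_into)
    fix f assume f: "f \<in> schwartz"
    define g where "g = inv_into schwartz \<Phi> (\<Phi> f)"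
    have g: "g \<in> schwartz" "\<Phi> g = \<Phi> f"
      unfolding g_def by (rule inv_into_into[OF imageI[OF f]], rule f_inv_into_f[OF imageI[OF f]])
    have "schwartz_norm N (\<lambda>x. f x - g x) \<le> (real N + 1)\<^sup>2 * (3 * \<epsilon>)"
    proof (rule schwartz_grid_close[OF f g(1) \<epsilon> _ _ R _ q])
      have "R g = R f \<and> q g = q f \<and> schwartz_grid N \<epsilon> (R g) (q g) g = schwartz_grid N \<epsilon> (R f) (q f) f"
        using g(2) unfolding \<Phi>_def prod.inject .
      then have eq: "R g = R f" "q g = q f" "schwartz_grid N \<epsilon> (R g) (q g) g = schwartz_grid N \<epsilon> (R f) (q f) f"
        by blast+
      show "R f \<ge> 1" "q f \<ge> 1" by (simp_all add: R_def q_def)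
      show "schwartz_norm (N + 1) g \<le> real (R f) * \<epsilon>"
        "schwartz_norm (N + 1) g * real (R f) ^ N \<le> real (q f) * \<epsilon>"
        using R[of g] q[of g] unfolding eq by blast+
      show "schwartz_grid N \<epsilon> (R f) (q f) f = schwartz_grid N \<epsilon> (R f) (q f) g"
        using eq(3) unfolding eq(1,2) by simp
    qed
    also have "\<dots> < (real N + 1)\<^sup>2 * (4 * \<epsilon>)" using \<epsilon> by (intro mult_strict_left_mono) auto
    also have "\<dots> = e" by (simp add: \<epsilon>_def)
    finally show "\<exists>g\<in>inv_into schwartz \<Phi> ` \<Phi> ` schwartz. schwartz_norm N (\<lambda>x. f x - g x) < e"
      using f unfolding g_def by blast
  qed
qed

text \<open>One countable set has to serve all orders \<open>N\<close>, because the order at which a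
  functional is bounded varies with the functional.\<close>

lemma schwartz_separable:
  obtains D where "countable D" "D \<subseteq> schwartz"
    "\<And>f N e. f \<in> schwartz \<Longrightarrow> e > 0 \<Longrightarrow> \<exists>g\<in>D. schwartz_norm N (\<lambda>x. f x - g x) < e"
proof -
  define net where "net N m D \<longleftrightarrow> countable D \<and> D \<subseteq> schwartz \<and>
      (\<forall>f\<in>schwartz. \<exists>g\<in>D. schwartz_norm N (\<lambda>x. f x - g x) < inverse (real (Suc m)))" for N m D
  have "\<exists>D. net N m D" for N m
    unfolding net_def
    by (rule schwartz_countable_net[of "inverse (real (Suc m))" N]) (simp, blast)
  then obtain D where "\<And>N m. net N m (D N m)" by metis
  then have D: "\<And>N m. countable (D N m)" "\<And>N m. D N m \<subseteq> schwartz"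
    "\<And>N m f. f \<in> schwartz \<Longrightarrow> \<exists>g\<in>D N m. schwartz_norm N (\<lambda>x. f x - g x) < inverse (real (Suc m))"
    unfolding net_def by auto
  show ?thesis
  proof (rule that[of "\<Union>N. \<Union>m. D N m"])
    fix f N and e :: real assume f: "f \<in> schwartz" and e: "e > 0"
    obtain m where m: "inverse (real (Suc m)) < e" using reals_Archimedean[OF e] by blast
    obtain g where "g \<in> D N m" "schwartz_norm N (\<lambda>x. f x - g x) < inverse (real (Suc m))"
      using D(3)[OF f, of N m] by blast
    with m show "\<exists>g\<in>\<Union>N. \<Union>m. D N m. schwartz_norm N (\<lambda>x. f x - g x) < e"
      by (intro bexI[of _ g]) auto
  qed (use D(1,2) in blast)+
qed

text \<open>The difference of the functionals is bounded by a single norm, and \<open>f\<close> is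
  approximated from \<open>D\<close> in that norm.\<close>

lemma tempered_eq_on_dense:
  assumes \<phi>: "\<phi> \<in> tempered" and \<psi>: "\<psi> \<in> tempered" and D: "D \<subseteq> schwartz"
    and dense: "\<And>f N e. f \<in> schwartz \<Longrightarrow> e > 0 \<Longrightarrow> \<exists>g\<in>D. schwartz_norm N (\<lambda>x. f x - g x) < e"
    and eq: "\<And>g. g \<in> D \<Longrightarrow> \<phi> g = \<psi> g" and f: "f \<in> schwartz"
  shows "\<phi> f = \<psi> f"
proof -
  let ?\<theta> = "\<lambda>f\<in>schwartz. 1 * \<phi> f + (-1) * \<psi> f"
  have \<theta>: "?\<theta> \<in> tempered" by (rule tempered_lincomb[OF \<phi> \<psi>])
  obtain C N where C: "C \<ge> 0" "\<And>f. f \<in> schwartz \<Longrightarrow> \<bar>?\<theta> f\<bar> \<le> C * schwartz_norm N f"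
    by (rule tempered_norm_bound[OF \<theta>]) (rule that)
  have "\<bar>?\<theta> f\<bar> \<le> 0 + e" if e: "e > 0" for e
  proof -
    obtain g where g: "g \<in> D" "schwartz_norm N (\<lambda>x. f x - g x) < e / (C + 1)"
    proof -
      have "e / (C + 1) > 0" using e C(1) by simp
      from dense[OF f this, of N] show ?thesis using that by blast
    qed
    have gs: "g \<in> schwartz" using g D by auto
    have "\<bar>?\<theta> f\<bar> = \<bar>?\<theta> (\<lambda>x. f x - g x)\<bar>"
      using tempered_diff[OF \<theta> f gs] eq[OF g(1)] gs by simp
    also have "\<dots> \<le> C * schwartz_norm N (\<lambda>x. f x - g x)" by (rule C(2)[OF schwartz_diff[OF f gs]])
    also have "\<dots> \<le> (C + 1) * (e / (C + 1))"
      using g(2) C(1) by (intro mult_mono schwartz_norm_nonneg schwartz_diff f gs) auto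
    also have "\<dots> = e" using C(1) by simp
    finally show ?thesis by simp
  qed
  then have "\<bar>?\<theta> f\<bar> \<le> 0" by (rule field_le_epsilon)
  then show ?thesis using f by simp
qed

subsection \<open>The Wiener integral\<close>

lemma
  assumes M: "prob_space M" and B: "standard_brownian_motion M B" and st: "0 \<le> s" "s \<le> t"
  shows bm_increment_integrable: "integrable M (\<lambda>\<omega>. B t \<omega> - B s \<omega>)"
    and bm_increment_expectation: "(LINT \<omega>|M. B t \<omega> - B s \<omega>) = 0"
    and bm_increment_square_integrable: "integrable M (\<lambda>\<omega>. (B t \<omega> - B s \<omega>)\<^sup>2)"
    and bm_increment_variance: "(LINT \<omega>|M. (B t \<omega> - B s \<omega>)\<^sup>2) = t - s"
proof -
  interpret prob_space M by (rule M)
  have "integrable M (\<lambda>\<omega>. B t \<omega> - B s \<omega>) \<and> (LINT \<omega>|M. B t \<omega> - B s \<omega>) = 0 \<and>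
    integrable M (\<lambda>\<omega>. (B t \<omega> - B s \<omega>)\<^sup>2) \<and> (LINT \<omega>|M. (B t \<omega> - B s \<omega>)\<^sup>2) = t - s"
  \<comment> \<open>The law of an increment is given only for \<open>s < t\<close>; for
    \<open>s = t\<close> the increment is identically 0.\<close>
  proof (cases "s = t")
    case False
    then have pos: "sqrt (t - s) > 0" using st by simp
    have D: "distributed M lborel (\<lambda>\<omega>. B t \<omega> - B s \<omega>) (normal_density 0 (sqrt (t - s)))"
      using B st False by (simp add: standard_brownian_motion_def)
    have 1: "integrable M (\<lambda>\<omega>. B t \<omega> - B s \<omega>)"
      using distributed_integrable[OF D, of "\<lambda>x. x"] integrable_normal_moment[OF pos, of 0 1] by simp
    have 2: "integrable M (\<lambda>\<omega>. (B t \<omega> - B s \<omega>)\<^sup>2)"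
      using distributed_integrable[OF D, of "\<lambda>x. x\<^sup>2"] integrable_normal_moment[OF pos, of 0 2] by simp
    have 3: "(LINT \<omega>|M. B t \<omega> - B s \<omega>) = 0"
      by (rule normal_distributed_expectation[OF pos D])
    have "(LINT \<omega>|M. (B t \<omega> - B s \<omega>)\<^sup>2) = t - s"
      using normal_distributed_variance[OF pos D] st unfolding 3 by simp
    with 1 2 3 show ?thesis by blast
  qed simp
  then show "integrable M (\<lambda>\<omega>. B t \<omega> - B s \<omega>)" "(LINT \<omega>|M. B t \<omega> - B s \<omega>) = 0"
    "integrable M (\<lambda>\<omega>. (B t \<omega> - B s \<omega>)\<^sup>2)" "(LINT \<omega>|M. (B t \<omega> - B s \<omega>)\<^sup>2) = t - s"
    by blast+
qed

lemma
  assumes M: "prob_space M" and B: "standard_brownian_motion M B" and st: "0 \<le> s" "s \<le> t"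
  shows bm_increments_mult_integrable: "integrable M (\<lambda>\<omega>. (B s \<omega> - B 0 \<omega>) * (B t \<omega> - B s \<omega>))"
    and bm_increments_uncorrelated: "(LINT \<omega>|M. (B s \<omega> - B 0 \<omega>) * (B t \<omega> - B s \<omega>)) = 0"
proof -
  interpret prob_space M by (rule M)
  \<comment> \<open>The partition with the two cells \<open>[0, s]\<close> and \<open>[s, t]\<close>
    isolates the two independent increments.\<close>
  let ?u = "\<lambda>i::nat. if i = 0 then 0 else if i = 1 then s else t"
  let ?X = "\<lambda>i \<omega>. B (?u (Suc i)) \<omega> - B (?u i) \<omega>"
  have set2: "{..<2::nat} = {0, 1}" by auto
  have "\<forall>i<2. ?u i \<le> ?u (Suc i)" using st by (auto simp: less_2_cases_iff)
  then have "indep_vars (\<lambda>_. borel) ?X {..<2}"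
    using B[unfolded standard_brownian_motion_def, THEN conjunct2, THEN conjunct2, THEN conjunct1,
        rule_format, of ?u 2] by simp
  moreover have "integrable M (?X i)" if "i \<in> {..<2}" for i
    using that st bm_increment_integrable[OF M B, of 0 s] bm_increment_integrable[OF M B, of s t]
    by (auto simp: set2)
  ultimately have "integrable M (\<lambda>\<omega>. \<Prod>i\<in>{..<2}. ?X i \<omega>)"
    and "(LINT \<omega>|M. (\<Prod>i\<in>{..<2}. ?X i \<omega>)) = (\<Prod>i\<in>{..<2}. LINT \<omega>|M. ?X i \<omega>)"
    using indep_vars_integrable[of "{..<2}" ?X] indep_vars_lebesgue_integral[of "{..<2}" ?X] by auto
  then show "integrable M (\<lambda>\<omega>. (B s \<omega> - B 0 \<omega>) * (B t \<omega> - B s \<omega>))"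
    "(LINT \<omega>|M. (B s \<omega> - B 0 \<omega>) * (B t \<omega> - B s \<omega>)) = 0"
    using bm_increment_expectation[OF M B order_refl st(1)] by (simp_all add: set2)
qed

text \<open>\<open>B 0\<close> vanishes only almost surely, so covariances are taken of
  \<open>B t - B 0\<close>. Splitting this at \<open>s\<close> leaves a square of mean
  \<open>s\<close> and a product of mean 0.\<close>

lemma bm_covariance_le:
  assumes M: "prob_space M" and B: "standard_brownian_motion M B" and st: "0 \<le> s" "s \<le> t"
  shows "has_bochner_integral M (\<lambda>\<omega>. (B s \<omega> - B 0 \<omega>) * (B t \<omega> - B 0 \<omega>)) s"
proof -
  have "has_bochner_integral M (\<lambda>\<omega>. (B s \<omega> - B 0 \<omega>)\<^sup>2 + (B s \<omega> - B 0 \<omega>) * (B t \<omega> - B s \<omega>)) (s + 0)"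
    using bm_increment_square_integrable[OF M B order_refl st(1)] bm_increment_variance[OF M B order_refl st(1)]
      bm_increments_mult_integrable[OF M B st] bm_increments_uncorrelated[OF M B st]
    by (intro has_bochner_integral_add) (auto simp: has_bochner_integral_iff)
  then show ?thesis by (simp add: power2_eq_square algebra_simps)
qed

lemma bm_covariance:
  assumes M: "prob_space M" and B: "standard_brownian_motion M B" and st: "0 \<le> s" "0 \<le> t"
  shows "has_bochner_integral M (\<lambda>\<omega>. (B s \<omega> - B 0 \<omega>) * (B t \<omega> - B 0 \<omega>)) (min s t)"
  using bm_covariance_le[OF M B, of s t] bm_covariance_le[OF M B, of t s] st
  by (cases "s \<le> t") (auto simp: mult.commute)

lemma indicator_covariance:
  fixes s t :: real
  assumes "0 \<le> s" "0 \<le> t"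
  shows "has_bochner_integral lborel (\<lambda>x. indicator {0<..s} x * indicator {0<..t} x) (min s t)"
proof -
  have "{0<..s} \<inter> {0<..t} = {0<..min s t}" by auto
  moreover have "has_bochner_integral lborel (indicator {0<..min s t} :: real \<Rightarrow> real) (min s t)"
    using assms by (intro has_bochner_integral_real_indicator[THEN has_bochner_integral_cong[THEN iffD1, rotated -1]])
      (auto)
  ultimately show ?thesis by (simp flip: indicator_inter_arith)
qed

text \<open>Both \<open>B r - B l\<close> and the indicator of \<open>(l, r]\<close> are differences of processes with the same
  covariance \<open>min s t\<close>; hence the isometry, with no common refinement of partitions.\<close>

lemma interval_covariance:
  fixes W :: "real \<Rightarrow> 'b \<Rightarrow> real"
  assumes W: "\<And>s t. 0 \<le> s \<Longrightarrow> 0 \<le> t \<Longrightarrow> has_bochner_integral N (\<lambda>\<omega>. W s \<omega> * W t \<omega>) (min s t)"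
    and lr: "0 \<le> l" "l \<le> r" "0 \<le> l'" "l' \<le> r'"
  shows "has_bochner_integral N (\<lambda>\<omega>. (W r \<omega> - W l \<omega>) * (W r' \<omega> - W l' \<omega>))
    (min r r' - min r l' - min l r' + min l l')"
proof -
  have "has_bochner_integral N (\<lambda>\<omega>. W r \<omega> * W r' \<omega> - W r \<omega> * W l' \<omega> - W l \<omega> * W r' \<omega> + W l \<omega> * W l' \<omega>)
    (min r r' - min r l' - min l r' + min l l')"
    using lr by (intro has_bochner_integral_add has_bochner_integral_diff W) auto
  then show ?thesis by (simp add: algebra_simps)
qed

text \<open>The right-hand side mentions neither \<open>W\<close> nor its measure, so any two
  processes with covariance \<open>min s t\<close> give the same value. The intervals may overlap
  freely.\<close>

lemma quadratic_isometry:
  fixes W :: "real \<Rightarrow> 'b \<Rightarrow> real"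
  assumes W: "\<And>s t. 0 \<le> s \<Longrightarrow> 0 \<le> t \<Longrightarrow> has_bochner_integral N (\<lambda>\<omega>. W s \<omega> * W t \<omega>) (min s t)"
    and lr: "\<And>i. i \<in> I \<Longrightarrow> 0 \<le> l i" "\<And>i. i \<in> I \<Longrightarrow> l i \<le> r i"
  shows "(\<integral>\<^sup>+ \<omega>. ennreal ((\<Sum>i\<in>I. \<alpha> i * (W (r i) \<omega> - W (l i) \<omega>))\<^sup>2) \<partial>N)
    = ennreal (\<Sum>i\<in>I. \<Sum>j\<in>I. \<alpha> i * \<alpha> j *
        (min (r i) (r j) - min (r i) (l j) - min (l i) (r j) + min (l i) (l j)))"
proof -
  have "has_bochner_integral N (\<lambda>\<omega>. \<Sum>i\<in>I. \<Sum>j\<in>I. \<alpha> i * \<alpha> j * ((W (r i) \<omega> - W (l i) \<omega>) * (W (r j) \<omega> - W (l j) \<omega>)))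
    (\<Sum>i\<in>I. \<Sum>j\<in>I. \<alpha> i * \<alpha> j * (min (r i) (r j) - min (r i) (l j) - min (l i) (r j) + min (l i) (l j)))"
    by (intro has_bochner_integral_sum has_bochner_integral_mult_right interval_covariance W lr)
  moreover have "(\<Sum>i\<in>I. \<Sum>j\<in>I. \<alpha> i * \<alpha> j * ((W (r i) \<omega> - W (l i) \<omega>) * (W (r j) \<omega> - W (l j) \<omega>)))
    = (\<Sum>i\<in>I. \<alpha> i * (W (r i) \<omega> - W (l i) \<omega>))\<^sup>2" for \<omega>
    by (simp add: power2_eq_square sum_product mult_ac)
  ultimately show ?thesis
    by (simp add: has_bochner_integral_iff nn_integral_eq_integral)
qed

lemma increment_isometry:
  assumes M: "prob_space M" and B: "standard_brownian_motion M B"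
    and lr: "\<And>i. i \<in> I \<Longrightarrow> 0 \<le> l i" "\<And>i. i \<in> I \<Longrightarrow> l i \<le> r i"
  shows "(\<integral>\<^sup>+ \<omega>. ennreal ((\<Sum>i\<in>I. \<alpha> i * (B (r i) \<omega> - B (l i) \<omega>))\<^sup>2) \<partial>M)
    = (\<integral>\<^sup>+ s. ennreal ((\<Sum>i\<in>I. \<alpha> i * indicator {l i<..r i} s)\<^sup>2) \<partial>lborel)"
proof -
  have "indicator {l i<..r i} s = indicator {0<..r i} s - (indicator {0<..l i} s :: real)" if "i \<in> I" for i s
    using lr[OF that] by (auto simp: indicator_def)
  then have "(\<Sum>i\<in>I. \<alpha> i * indicator {l i<..r i} s) = (\<Sum>i\<in>I. \<alpha> i * (indicator {0<..r i} s - indicator {0<..l i} s))" for s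
    by (intro sum.cong) auto
  then show ?thesis
    using quadratic_isometry[where W = "\<lambda>t \<omega>. B t \<omega> - B 0 \<omega>", OF bm_covariance[OF M B] lr, where \<alpha> = \<alpha>]
      quadratic_isometry[where W = "\<lambda>t x. indicator {0<..t} x", OF indicator_covariance lr, where \<alpha> = \<alpha>]
    by simp
qed

section \<open>Step integrals and mean square distances\<close>

lemma is_partition_mono:
  assumes "is_partition t n u" "i \<le> j" "j \<le> n"
  shows "u i \<le> u j"
  using assms(2,3)
proof (induction j rule: dec_induct)
  case (step j)
  then have "u j \<le> u (Suc j)" using assms(1) by (simp add: is_partition_def)
  with step show ?case by simp
qed simp

lemma is_partition_bounds:
  assumes "is_partition t n u" "i \<le> n"
  shows "0 \<le> u i" "u i \<le> t"
  using is_partition_mono[OF assms(1), of 0 i] is_partition_mono[OF assms(1), of i n] assms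
  by (auto simp: is_partition_def)

text \<open>Indexing by the disjoint sum of the cells, with the second coefficients negated, turns a
  difference over two unrelated partitions into one sum over overlapping intervals.\<close>

lemma step_isometry:
  assumes M: "prob_space M" and B: "standard_brownian_motion M B"
    and u: "is_partition t n u" and u': "is_partition t n' u'"
  shows "(\<integral>\<^sup>+ \<omega>. ennreal ((step_integral B n u a \<omega> - step_integral B n' u' a' \<omega>)\<^sup>2) \<partial>M)
    = (\<integral>\<^sup>+ s. ennreal ((step_function n u a s - step_function n' u' a' s)\<^sup>2) \<partial>lborel)"
proof -
  define I where "I = {..<n} <+> {..<n'}"
  define \<alpha> where "\<alpha> = case_sum a (\<lambda>i. - a' i)"
  define l where "l = case_sum u u'"
  define r where "r = case_sum (\<lambda>i. u (Suc i)) (\<lambda>i. u' (Suc i))"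
  have "l i \<ge> 0" "l i \<le> r i" if "i \<in> I" for i
    using that is_partition_bounds[OF u] is_partition_bounds[OF u'] u u'
    by (auto simp: I_def l_def r_def is_partition_def)
  note iso = increment_isometry[OF M B, where I = I and l = l and r = r and \<alpha> = \<alpha>, OF this]
  have "(\<Sum>i\<in>I. \<alpha> i * (B (r i) \<omega> - B (l i) \<omega>)) = step_integral B n u a \<omega> - step_integral B n' u' a' \<omega>" for \<omega>
    by (simp add: I_def sum.Plus \<alpha>_def l_def r_def step_integral_def sum_negf)
  moreover have "(\<Sum>i\<in>I. \<alpha> i * indicator {l i<..r i} s) = step_function n u a s - step_function n' u' a' s" for s
    unfolding step_function_def I_def
    by (subst sum.Plus) (simp_all add: \<alpha>_def l_def r_def sum_negf del: sum_mult_indicator)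
  ultimately show ?thesis using iso by simp
qed

lemma step_function_measurable [measurable]: "step_function n u a \<in> borel_measurable borel"
  unfolding step_function_def[abs_def] by measurable

lemma step_function_outside:
  assumes "is_partition t n u" "s \<notin> {0..t}"
  shows "step_function n u a s = 0"
  unfolding step_function_def
proof (intro sum.neutral ballI)
  fix i assume "i \<in> {..<n}"
  then have "0 \<le> u i" "u (Suc i) \<le> t"
    using is_partition_bounds[OF assms(1)] by auto
  then show "a i * indicator {u i<..u (Suc i)} s = 0"
    using assms(2) by (auto simp: indicator_def)
qed

lemma step_integral_measurable:
  assumes B: "standard_brownian_motion M B" and u: "is_partition t n u"
  shows "step_integral B n u a \<in> borel_measurable M"
proof -
  have "B (u i) \<in> borel_measurable M" if "i \<le> n" for i
    using B is_partition_bounds[OF u that] by (simp add: standard_brownian_motion_def)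
  then show ?thesis
    unfolding step_integral_def[abs_def] by (intro borel_measurable_sum borel_measurable_times borel_measurable_diff) auto
qed

lemma step_distance_le:
  assumes M: "prob_space M" and B: "standard_brownian_motion M B"
    and h: "set_borel_measurable lborel {0..t} h"
    and u: "is_partition t n u" and u': "is_partition t n' u'"
  shows "(\<integral>\<^sup>+ \<omega>. ennreal ((step_integral B n u a \<omega> - step_integral B n' u' a' \<omega>)\<^sup>2) \<partial>M)
    \<le> 2 * (\<integral>\<^sup>+ s\<in>{0..t}. ennreal ((h s - step_function n u a s)\<^sup>2) \<partial>lborel)
      + 2 * (\<integral>\<^sup>+ s\<in>{0..t}. ennreal ((h s - step_function n' u' a' s)\<^sup>2) \<partial>lborel)"
proof -
  \<comment> \<open>\<open>h\<close> is constrained only on \<open>{0..t}\<close>; extending it by 0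
    matches the step functions, which vanish outside.\<close>
  define k where "k s = indicator {0..t} s * h s" for s
  have k[measurable]: "k \<in> borel_measurable borel"
    using h unfolding set_borel_measurable_def k_def by simp
  have eq: "(\<integral>\<^sup>+ s\<in>{0..t}. ennreal ((h s - step_function n u a s)\<^sup>2) \<partial>lborel)
      = (\<integral>\<^sup>+ s. ennreal ((k s - step_function n u a s)\<^sup>2) \<partial>lborel)"
    if "is_partition t n u" for n u a
    by (intro nn_integral_cong) (auto simp: k_def step_function_outside[OF that] split: split_indicator)
  have "(\<integral>\<^sup>+ s. ennreal ((step_function n u a s - step_function n' u' a' s)\<^sup>2) \<partial>lborel)
    \<le> (\<integral>\<^sup>+ s. 2 * ennreal ((k s - step_function n u a s)\<^sup>2)
        + 2 * ennreal ((k s - step_function n' u' a' s)\<^sup>2) \<partial>lborel)"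
  proof (intro nn_integral_mono)
    fix s
    have "(x - y)\<^sup>2 \<le> 2 * (z - x)\<^sup>2 + 2 * (z - y)\<^sup>2" for x y z :: real
      using zero_le_power2[of "2 * z - x - y"] by (simp add: power2_eq_square algebra_simps)
    then show "ennreal ((step_function n u a s - step_function n' u' a' s)\<^sup>2)
      \<le> 2 * ennreal ((k s - step_function n u a s)\<^sup>2) + 2 * ennreal ((k s - step_function n' u' a' s)\<^sup>2)"
      by (simp add: ennreal_leI flip: ennreal_plus ennreal_numeral ennreal_mult)
  qed
  also have "\<dots> = 2 * (\<integral>\<^sup>+ s. ennreal ((k s - step_function n u a s)\<^sup>2) \<partial>lborel)
      + 2 * (\<integral>\<^sup>+ s. ennreal ((k s - step_function n' u' a' s)\<^sup>2) \<partial>lborel)"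
    by (subst nn_integral_add) (auto simp: nn_integral_cmult)
  finally show ?thesis unfolding step_isometry[OF M B u u'] eq[OF u] eq[OF u'] .
qed

text \<open>The integrands of both approximating sequences are close to \<open>h\<close>, so by the
  isometry their step integrals are close to each other, and with them \<open>X\<close> and
  \<open>Y\<close>.\<close>

lemma wiener_integral_unique:
  assumes M: "prob_space M" and B: "standard_brownian_motion M B"
    and X: "is_wiener_integral M B t h X" and Y: "is_wiener_integral M B t h Y"
  shows "AE \<omega> in M. X \<omega> = Y \<omega>"
proof -
  have h: "set_borel_measurable lborel {0..t} h" and [measurable]: "X \<in> borel_measurable M" "Y \<in> borel_measurable M"
    using X Y by (auto simp: is_wiener_integral_def)
  obtain n u a where p: "\<And>m. is_partition t (n m) (u m)"
    and d: "(\<lambda>m. \<integral>\<^sup>+ s\<in>{0..t}. ennreal ((h s - step_function (n m) (u m) (a m) s)\<^sup>2) \<partial>lborel) \<longlonglongrightarrow> 0" (is "?d \<longlonglongrightarrow> 0")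
    and e: "(\<lambda>m. \<integral>\<^sup>+ \<omega>. ennreal ((X \<omega> - step_integral B (n m) (u m) (a m) \<omega>)\<^sup>2) \<partial>M) \<longlonglongrightarrow> 0" (is "?e \<longlonglongrightarrow> 0")
    using X unfolding is_wiener_integral_def by blast
  obtain n' u' a' where p': "\<And>m. is_partition t (n' m) (u' m)"
    and d': "(\<lambda>m. \<integral>\<^sup>+ s\<in>{0..t}. ennreal ((h s - step_function (n' m) (u' m) (a' m) s)\<^sup>2) \<partial>lborel) \<longlonglongrightarrow> 0" (is "?d' \<longlonglongrightarrow> 0")
    and e': "(\<lambda>m. \<integral>\<^sup>+ \<omega>. ennreal ((Y \<omega> - step_integral B (n' m) (u' m) (a' m) \<omega>)\<^sup>2) \<partial>M) \<longlonglongrightarrow> 0" (is "?e' \<longlonglongrightarrow> 0")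
    using Y unfolding is_wiener_integral_def by blast
  have [measurable]: "step_integral B (n m) (u m) (a m) \<in> borel_measurable M"
    "step_integral B (n' m) (u' m) (a' m) \<in> borel_measurable M" for m
    using step_integral_measurable[OF B] p p' by auto
  have bound: "(\<integral>\<^sup>+ \<omega>. ennreal ((X \<omega> - Y \<omega>)\<^sup>2) \<partial>M) \<le> 3 * (?e m + (2 * ?d m + 2 * ?d' m) + ?e' m)" for m
  proof -
    let ?S = "step_integral B (n m) (u m) (a m)" and ?T = "step_integral B (n' m) (u' m) (a' m)"
    have "(\<integral>\<^sup>+ \<omega>. ennreal ((X \<omega> - Y \<omega>)\<^sup>2) \<partial>M)
      \<le> (\<integral>\<^sup>+ \<omega>. 3 * (ennreal ((X \<omega> - ?S \<omega>)\<^sup>2) + ennreal ((?S \<omega> - ?T \<omega>)\<^sup>2) + ennreal ((Y \<omega> - ?T \<omega>)\<^sup>2)) \<partial>M)"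
    proof (intro nn_integral_mono)
      fix \<omega>
      have "(x - y)\<^sup>2 \<le> 3 * ((x - s)\<^sup>2 + (s - t)\<^sup>2 + (y - t)\<^sup>2)" for x y s t :: real
        using zero_le_power2[of "(x - s) - (s - t)"] zero_le_power2[of "(s - t) - (t - y)"]
          zero_le_power2[of "(x - s) - (t - y)"]
        by (simp add: power2_eq_square algebra_simps)
      then show "ennreal ((X \<omega> - Y \<omega>)\<^sup>2)
        \<le> 3 * (ennreal ((X \<omega> - ?S \<omega>)\<^sup>2) + ennreal ((?S \<omega> - ?T \<omega>)\<^sup>2) + ennreal ((Y \<omega> - ?T \<omega>)\<^sup>2))"
        by (simp add: ennreal_leI flip: ennreal_plus ennreal_numeral ennreal_mult)
    qed
    also have "\<dots> = 3 * (?e m + (\<integral>\<^sup>+ \<omega>. ennreal ((?S \<omega> - ?T \<omega>)\<^sup>2) \<partial>M) + ?e' m)"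
      by (simp add: nn_integral_cmult nn_integral_add)
    also have "\<dots> \<le> 3 * (?e m + (2 * ?d m + 2 * ?d' m) + ?e' m)"
      by (intro mult_left_mono add_mono order_refl step_distance_le[OF M B h p p']) auto
    finally show ?thesis .
  qed
  have "(\<lambda>m. 3 * (?e m + (2 * ?d m + 2 * ?d' m) + ?e' m)) \<longlonglongrightarrow> 3 * (0 + (2 * 0 + 2 * 0) + 0)"
    by (intro tendsto_add ennreal_tendsto_cmult d d' e e') auto
  then have "(\<integral>\<^sup>+ \<omega>. ennreal ((X \<omega> - Y \<omega>)\<^sup>2) \<partial>M) \<le> 0"
    using bound by (intro LIMSEQ_le_const) auto
  then have "AE \<omega> in M. ennreal ((X \<omega> - Y \<omega>)\<^sup>2) = 0"
    by (subst nn_integral_0_iff_AE[symmetric]) auto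
  then show ?thesis by (auto simp: ennreal_eq_0_iff)
qed

text \<open>Step integrals whose integrands converge in mean square form a Cauchy sequence in mean square
  by the isometry; Fatou's lemma upgrades almost sure convergence to convergence in mean square.\<close>

lemma wiener_integral_by_AE_limit:
  assumes M: "prob_space M" and B: "standard_brownian_motion M B"
    and h: "set_borel_measurable lborel {0..t} h" and X[measurable]: "X \<in> borel_measurable M"
    and p: "\<And>m. is_partition t (n m) (u m)"
    and d: "(\<lambda>m. \<integral>\<^sup>+ s\<in>{0..t}. ennreal ((h s - step_function (n m) (u m) (a m) s)\<^sup>2) \<partial>lborel) \<longlonglongrightarrow> 0"
    and lim: "AE \<omega> in M. (\<lambda>m. step_integral B (n m) (u m) (a m) \<omega>) \<longlonglongrightarrow> X \<omega>"
  shows "is_wiener_integral M B t h X"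
proof -
  let ?d = "\<lambda>m. \<integral>\<^sup>+ s\<in>{0..t}. ennreal ((h s - step_function (n m) (u m) (a m) s)\<^sup>2) \<partial>lborel"
  let ?S = "\<lambda>m. step_integral B (n m) (u m) (a m)"
  have [measurable]: "?S m \<in> borel_measurable M" for m
    using step_integral_measurable[OF B p] .
  \<comment> \<open>\<open>m\<close> stays fixed while the second index \<open>k\<close> tends to
    infinity, where \<open>?d k\<close> drops out.\<close>
  have bound: "(\<integral>\<^sup>+ \<omega>. ennreal ((X \<omega> - ?S m \<omega>)\<^sup>2) \<partial>M) \<le> 2 * ?d m" for m
  proof -
    have "AE \<omega> in M. ennreal ((X \<omega> - ?S m \<omega>)\<^sup>2) = liminf (\<lambda>k. ennreal ((?S k \<omega> - ?S m \<omega>)\<^sup>2))"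
      using lim
    proof eventually_elim
      case (elim \<omega>)
      then have "(\<lambda>k. ennreal ((?S k \<omega> - ?S m \<omega>)\<^sup>2)) \<longlonglongrightarrow> ennreal ((X \<omega> - ?S m \<omega>)\<^sup>2)"
        by (intro tendsto_ennrealI tendsto_intros)
      then show ?case by (intro lim_imp_Liminf[symmetric]) simp_all
    qed
    then have "(\<integral>\<^sup>+ \<omega>. ennreal ((X \<omega> - ?S m \<omega>)\<^sup>2) \<partial>M)
        = (\<integral>\<^sup>+ \<omega>. liminf (\<lambda>k. ennreal ((?S k \<omega> - ?S m \<omega>)\<^sup>2)) \<partial>M)"
      by (rule nn_integral_cong_AE)
    also have "\<dots> \<le> liminf (\<lambda>k. \<integral>\<^sup>+ \<omega>. ennreal ((?S k \<omega> - ?S m \<omega>)\<^sup>2) \<partial>M)"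
      by (rule nn_integral_liminf) measurable
    also have "\<dots> \<le> liminf (\<lambda>k. 2 * ?d k + 2 * ?d m)"
      by (intro Liminf_mono always_eventually allI step_distance_le[OF M B h p p])
    also have "\<dots> = 2 * 0 + 2 * ?d m"
      by (intro lim_imp_Liminf tendsto_add ennreal_tendsto_cmult d tendsto_const) auto
    finally show ?thesis by simp
  qed
  have "(\<lambda>m. 2 * ?d m) \<longlonglongrightarrow> 2 * 0"
    by (intro ennreal_tendsto_cmult d) auto
  then have "(\<lambda>m. \<integral>\<^sup>+ \<omega>. ennreal ((X \<omega> - ?S m \<omega>)\<^sup>2) \<partial>M) \<longlonglongrightarrow> 0"
    by (intro tendsto_sandwich[OF always_eventually[OF allI] always_eventually[OF allI[OF bound]] tendsto_const])
      simp_all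
  then show ?thesis
    unfolding is_wiener_integral_def
    by (intro conjI exI[of _ n] exI[of _ u] exI[of _ a] allI h X p d)
qed

subsection \<open>Step functions on a partition\<close>

lemma is_partition_sum_indicator:
  assumes "is_partition t n u"
  shows "(\<Sum>i<n. indicator {u i<..u (Suc i)} x) = (indicator {0<..t} x :: real)"
proof -
  have "indicator {u i<..u (Suc i)} x = indicator {0<..u (Suc i)} x - (indicator {0<..u i} x :: real)" if "i < n" for i
    using is_partition_bounds(1)[OF assms, of i] is_partition_mono[OF assms, of i "Suc i"] that
    by (auto simp: indicator_def)
  then have "(\<Sum>i<n. indicator {u i<..u (Suc i)} x) = (\<Sum>i<n. indicator {0<..u (Suc i)} x - (indicator {0<..u i} x :: real))"
    by (intro sum.cong) auto
  also have "\<dots> = indicator {0<..u n} x - indicator {0<..u 0} x"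
    by (rule sum_lessThan_telescope)
  finally show ?thesis using assms by (simp add: is_partition_def)
qed

text \<open>The cell indicators form a partition of unity on \<open>(0, t]\<close>, so the error is
  a weighted mean of errors in the cells and the cell of \<open>x\<close> is never singled
  out.\<close>

lemma step_function_close:
  assumes p: "is_partition t n u" and x: "x \<in> {0<..t}"
    and close: "\<And>i. i < n \<Longrightarrow> x \<in> {u i<..u (Suc i)} \<Longrightarrow> \<bar>y - a i\<bar> \<le> \<delta>"
  shows "\<bar>y - step_function n u a x\<bar> \<le> \<delta>"
proof -
  let ?I = "\<lambda>i. indicator {u i<..u (Suc i)} x :: real"
  have one: "(\<Sum>i<n. ?I i) = 1"
    using x by (simp only: is_partition_sum_indicator[OF p] indicator_simps)
  have "y - step_function n u a x = y * (\<Sum>i<n. ?I i) - (\<Sum>i<n. a i * ?I i)"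
    unfolding one step_function_def by simp
  also have "\<dots> = (\<Sum>i<n. (y - a i) * ?I i)"
    unfolding sum_distrib_left left_diff_distrib sum_subtractf ..
  finally have "\<bar>y - step_function n u a x\<bar> \<le> (\<Sum>i<n. \<bar>(y - a i) * ?I i\<bar>)"
    using sum_abs[of "\<lambda>i. (y - a i) * ?I i" "{..<n}"] by simp
  also have "\<dots> \<le> (\<Sum>i<n. \<delta> * ?I i)"
    using close by (intro sum_mono) (auto simp: indicator_def)
  also have "\<dots> = \<delta>" unfolding sum_distrib_left[symmetric] one by simp
  finally show ?thesis .
qed

text \<open>There are \<open>Suc m\<close> cells, so the mesh never divides by 0.\<close>

definition uniform_grid :: "real \<Rightarrow> nat \<Rightarrow> nat \<Rightarrow> real" where
  "uniform_grid t m i = t * real i / real (Suc m)"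

lemma uniform_grid_bounds:
  assumes "t \<ge> 0" "i \<le> Suc m"
  shows "0 \<le> uniform_grid t m i" "uniform_grid t m i \<le> t"
proof -
  show "0 \<le> uniform_grid t m i" using assms by (simp add: uniform_grid_def)
  have "t * real i \<le> t * real (Suc m)" using assms by (intro mult_left_mono) auto
  then show "uniform_grid t m i \<le> t" by (simp add: uniform_grid_def field_simps)
qed

lemma uniform_grid_step: "uniform_grid t m (Suc i) - uniform_grid t m i = t / real (Suc m)"
  unfolding uniform_grid_def diff_divide_distrib[symmetric] by (simp add: distrib_left)

lemma uniform_grid_ends [simp]: "uniform_grid t m 0 = 0" "uniform_grid t m (Suc m) = t"
  by (simp_all add: uniform_grid_def del: of_nat_Suc)

lemma uniform_grid_partition:
  assumes "t \<ge> 0"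
  shows "is_partition t (Suc m) (uniform_grid t m)"
proof -
  have "uniform_grid t m i \<le> uniform_grid t m (Suc i)" for i
    using uniform_grid_step[of t m i] assms by (smt (verit) divide_nonneg_nonneg of_nat_0_le_iff)
  then show ?thesis by (simp add: is_partition_def)
qed

lemma mesh_tendsto_zero: "(\<lambda>m. C * (t / real (Suc m))) \<longlonglongrightarrow> 0"
  using tendsto_mult_left[OF LIMSEQ_inverse_real_of_nat, of "C * t"] by (simp add: field_simps)

text \<open>Right end points are sampled because the telescoped equation multiplies the increment
  from \<open>u i\<close> to \<open>u (Suc i)\<close> by \<open>P_(t - u (Suc i)) f c\<close>. The
  integrand is deterministic, so this leads to the same integral as left end points.\<close>

lemma step_functions_uniform_grid_L2:
  assumes t: "t \<ge> 0" and L: "L \<ge> 0"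
    and lip: "\<And>r s. r \<in> {0..t} \<Longrightarrow> s \<in> {0..t} \<Longrightarrow> \<bar>h r - h s\<bar> \<le> L * \<bar>r - s\<bar>"
  shows "(\<lambda>m. \<integral>\<^sup>+ s\<in>{0..t}. ennreal ((h s
      - step_function (Suc m) (uniform_grid t m) (\<lambda>i. h (uniform_grid t m (Suc i))) s)\<^sup>2) \<partial>lborel) \<longlonglongrightarrow> 0"
proof -
  let ?\<delta> = "\<lambda>m. L * (t / real (Suc m))"
  let ?s = "\<lambda>m. step_function (Suc m) (uniform_grid t m) (\<lambda>i. h (uniform_grid t m (Suc i)))"
  have close: "\<bar>h x - ?s m x\<bar> \<le> ?\<delta> m" if x: "x \<in> {0<..t}" for x m
  proof (rule step_function_close[OF uniform_grid_partition[OF t] x])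
    fix i assume i: "i < Suc m" "x \<in> {uniform_grid t m i<..uniform_grid t m (Suc i)}"
    have "\<bar>h x - h (uniform_grid t m (Suc i))\<bar> \<le> L * \<bar>x - uniform_grid t m (Suc i)\<bar>"
      using uniform_grid_bounds[OF t, of "Suc i" m] i x by (intro lip) auto
    also have "\<dots> \<le> ?\<delta> m"
      using i(2) L uniform_grid_step[of t m i] by (intro mult_left_mono) (auto simp del: of_nat_Suc)
    finally show "\<bar>h x - h (uniform_grid t m (Suc i))\<bar> \<le> ?\<delta> m" .
  qed
  have bound: "(\<integral>\<^sup>+ s\<in>{0..t}. ennreal ((h s - ?s m s)\<^sup>2) \<partial>lborel) \<le> ennreal ((?\<delta> m)\<^sup>2 * t)" for m
  proof -
    \<comment> \<open>The half-open cells miss the point 0, which is a null set.\<close>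
    have "AE x in lborel. ennreal ((h x - ?s m x)\<^sup>2) * indicator {0..t} x \<le> ennreal ((?\<delta> m)\<^sup>2) * indicator {0..t} x"
      using AE_lborel_singleton[of 0]
    proof eventually_elim
      case (elim x)
      show ?case
      proof (cases "x \<in> {0..t}")
        case True
        then have "\<bar>h x - ?s m x\<bar> \<le> ?\<delta> m" using elim by (intro close) auto
        also note abs_ge_self
        finally have "(h x - ?s m x)\<^sup>2 \<le> (?\<delta> m)\<^sup>2" by (simp only: abs_le_square_iff)
        then show ?thesis by (intro mult_right_mono ennreal_leI) auto
      qed auto
    qed
    then have "(\<integral>\<^sup>+ s\<in>{0..t}. ennreal ((h s - ?s m s)\<^sup>2) \<partial>lborel)
        \<le> (\<integral>\<^sup>+ s. ennreal ((?\<delta> m)\<^sup>2) * indicator {0..t} s \<partial>lborel)"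
      by (rule nn_integral_mono_AE)
    also have "\<dots> = ennreal ((?\<delta> m)\<^sup>2 * t)"
      using t by (subst nn_integral_cmult_indicator) (auto simp: ennreal_mult)
    finally show ?thesis .
  qed
  have "(\<lambda>m. ennreal ((?\<delta> m)\<^sup>2 * t)) \<longlonglongrightarrow> ennreal (0\<^sup>2 * t)"
    by (intro tendsto_ennrealI tendsto_mult tendsto_power tendsto_const mesh_tendsto_zero)
  then have "(\<lambda>m. ennreal ((?\<delta> m)\<^sup>2 * t)) \<longlonglongrightarrow> 0" by simp
  from tendsto_sandwich[OF always_eventually[OF allI] always_eventually[OF allI[OF bound]] tendsto_const this]
  show ?thesis by simp
qed

subsection \<open>The mild formula along a path\<close>

text \<open>This compares the drift of one grid cell with a frozen value. Continuity makes the
  integrals genuine instead of the default 0 and lets them be split at \<open>p\<close>.\<close>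

lemma integral_increment_close:
  fixes k :: "real \<Rightarrow> real"
  assumes k: "continuous_on {0..} k" and pq: "0 \<le> p" "p \<le> q"
    and close: "\<And>r. r \<in> {p..q} \<Longrightarrow> \<bar>k r - v\<bar> \<le> \<epsilon>"
  shows "\<bar>(LINT r:{0..q}|lborel. k r) - (LINT r:{0..p}|lborel. k r) - (q - p) * v\<bar> \<le> (q - p) * \<epsilon>"
proof -
  have c: "continuous_on {a..b} k" if "a \<ge> 0" for a b
    using k by (rule continuous_on_subset) (use that in auto)
  have eq: "(LINT r:{0..b}|lborel. k r) = integral {0..b} k" for b
    by (intro set_borel_integral_eq_integral borel_integrable_atLeastAtMost' c) simp
  have "integral {0..p} k + integral {p..q} k = integral {0..q} k"
    using pq by (intro Henstock_Kurzweil_Integration.integral_combine integrable_continuous_interval c) auto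
  moreover have "integral {p..q} (\<lambda>r. k r - v) = integral {p..q} k - (q - p) * v"
    using pq by (subst integral_diff) (auto intro!: integrable_continuous_interval c)
  moreover have "norm (integral {p..q} (\<lambda>r. k r - v)) \<le> \<epsilon> * (q - p)"
    using pq close by (intro integral_bound continuous_intros c) auto
  ultimately show ?thesis unfolding eq by (simp add: mult.commute)
qed

lemma brownian_semigroup_zero [simp]: "brownian_semigroup 0 f = f"
  by (rule ext) (simp add: brownian_semigroup_def)

text \<open>Writing \<open>\<langle>F t, f\<rangle> - \<langle>F 0, P\<^sub>t f\<rangle>\<close> as a telescoping sum of \<open>\<langle>F s, P\<^bsub>t-s\<^esub> f\<rangle>\<close> over the grid, the equation
  turns each increment into a noise term plus a drift that cancels up to the modulus of continuity of
  \<open>(r, q) \<mapsto> \<langle>F r, P\<^sub>q A f\<rangle>\<close> times the mesh.\<close>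

lemma mild_formula_path_limit:
  fixes F :: "real \<Rightarrow> (real \<Rightarrow> real) \<Rightarrow> real" and b :: "real \<Rightarrow> real"
  assumes F: "continuous_map (top_of_set {0..}) strong_dual_topology F" and f: "f \<in> schwartz" and t: "t \<ge> 0"
    and b0: "b 0 = 0"
    and eq: "\<And>m i j. i \<le> Suc m \<Longrightarrow> j \<le> Suc m \<Longrightarrow>
      F (uniform_grid t m i) (brownian_semigroup (t - uniform_grid t m j) f)
      = \<mu> (brownian_semigroup (t - uniform_grid t m j) f)
        + \<sigma> * b (uniform_grid t m i) * brownian_semigroup (t - uniform_grid t m j) f c
        + (LINT r:{0..uniform_grid t m i}|lborel. F r (half_laplacian (brownian_semigroup (t - uniform_grid t m j) f)))"
  shows "(\<lambda>m. \<Sum>i<Suc m. \<sigma> * (b (uniform_grid t m (Suc i)) - b (uniform_grid t m i))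
      * brownian_semigroup (t - uniform_grid t m (Suc i)) f c) \<longlonglongrightarrow> F t f - \<mu> (brownian_semigroup t f)"
proof (rule LIMSEQ_I)
  fix e :: real assume e: "e > 0"
  let ?Af = "half_laplacian f"
  have Af: "?Af \<in> schwartz" by (rule schwartz_half_laplacian[OF f])
  define \<epsilon> where "\<epsilon> = e / (t + 1)"
  have \<epsilon>: "\<epsilon> > 0" using e t by (simp add: \<epsilon>_def)
  have "uniformly_continuous_on ({0..t} \<times> {0..t}) (\<lambda>(s, r). F s (brownian_semigroup r ?Af))"
    by (intro compact_uniformly_continuous strongly_continuous_semigroup_jointly[OF F Af] compact_Times compact_Icc)
  then obtain d where d: "d > 0" "\<And>x x'. x \<in> {0..t} \<times> {0..t} \<Longrightarrow> x' \<in> {0..t} \<times> {0..t} \<Longrightarrow> dist x' x < d \<Longrightarrow>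
      dist ((\<lambda>(s, r). F s (brownian_semigroup r ?Af)) x') ((\<lambda>(s, r). F s (brownian_semigroup r ?Af)) x) < \<epsilon>"
    unfolding uniformly_continuous_on_def using \<epsilon> by blast
  \<comment> \<open>In the product metric, shifts below \<open>d / 2\<close> in both coordinates
    make a shift below \<open>d\<close>.\<close>
  have mod: "\<bar>F s' (brownian_semigroup r' ?Af) - F s (brownian_semigroup r ?Af)\<bar> \<le> \<epsilon>"
    if "s \<in> {0..t}" "r \<in> {0..t}" "s' \<in> {0..t}" "r' \<in> {0..t}" "\<bar>s' - s\<bar> < d / 2" "\<bar>r' - r\<bar> < d / 2" for s r s' r'
  proof -
    have "dist (s', r') (s, r) \<le> \<bar>s' - s\<bar> + \<bar>r' - r\<bar>"
      unfolding dist_prod_def dist_real_def fst_conv snd_conv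
      by (rule order_trans[OF sqrt_sum_squares_le_sum_abs]) simp
    then show ?thesis using d(2)[of "(s, r)" "(s', r')"] that by (simp add: dist_real_def)
  qed
  obtain m0 where m0: "\<And>m. m \<ge> m0 \<Longrightarrow> norm (1 * (t / real (Suc m)) - 0) < d / 2"
    using LIMSEQ_D[OF mesh_tendsto_zero[of 1 t], of "d / 2"] d(1) by auto
  have "norm ((\<Sum>i<Suc m. \<sigma> * (b (uniform_grid t m (Suc i)) - b (uniform_grid t m i))
      * brownian_semigroup (t - uniform_grid t m (Suc i)) f c) - (F t f - \<mu> (brownian_semigroup t f))) < e"
    if m: "m \<ge> m0" for m
  proof -
    define u where "u = uniform_grid t m"
    define h where "h = t / real (Suc m)"
    have h: "h \<ge> 0" "h < d / 2" using m0[OF m] t by (auto simp: h_def)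
    have u: "0 \<le> u i" "u i \<le> t" if "i \<le> Suc m" for i
      using uniform_grid_bounds[OF t that] by (auto simp: u_def)
    have step: "u (Suc i) = u i + h" for i
      using uniform_grid_step[of t m i] by (simp add: u_def h_def)
    define g where "g i = brownian_semigroup (t - u i) f" for i
    define D where "D i = F (u i) (g i)" for i
    define n where "n i = \<sigma> * (b (u (Suc i)) - b (u i)) * g (Suc i) c" for i
    \<comment> \<open>The increment is split at \<open>F (u i) (g (Suc i))\<close>. The equation
      describes the change of the functional at the fixed test function \<open>g (Suc i)\<close>;
      the mean value theorem describes the change of the test function at the fixed functional
      \<open>F (u i)\<close>.\<close>
    have "\<bar>D (Suc i) - D i - n i\<bar> \<le> h * \<epsilon>" if i: "i < Suc m" for i
    proof -
      have ui: "0 \<le> u i" "u i \<le> t" "0 \<le> u (Suc i)" "u (Suc i) \<le> t" using u[of i] u[of "Suc i"] i by auto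
      have Ag: "half_laplacian (g (Suc i)) = brownian_semigroup (t - u (Suc i)) ?Af"
        unfolding g_def using ui by (intro half_laplacian_brownian_semigroup f) auto
      let ?k = "\<lambda>r. F r (brownian_semigroup (t - u (Suc i)) ?Af)"
      let ?I = "\<lambda>q. LINT r:{0..q}|lborel. ?k r"
      have e1: "F (u j) (g (Suc i)) = \<mu> (g (Suc i)) + \<sigma> * b (u j) * g (Suc i) c + ?I (u j)"
        if "j \<le> Suc m" for j
        using eq[OF that, of "Suc i"] i unfolding u_def[symmetric] g_def[symmetric] Ag by simp
      obtain \<xi> where \<xi>: "t - u (Suc i) \<le> \<xi>" "\<xi> \<le> t - u i"
        "F (u i) (g i) - F (u i) (g (Suc i)) = ((t - u i) - (t - u (Suc i))) * F (u i) (brownian_semigroup \<xi> ?Af)"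
        unfolding g_def using ui h step[of i]
        by (rule_tac tempered_semigroup_mvt[OF strongly_continuous_imp_tempered[OF F ui(1)] f,
              of "t - u (Suc i)" "t - u i"]) auto
      have kc: "continuous_on {0..} ?k"
        using ui by (intro strongly_continuous_imp_continuous_on[OF F] schwartz_brownian_semigroup Af) auto
      have "\<bar>?I (u (Suc i)) - ?I (u i) - (u (Suc i) - u i) * F (u i) (brownian_semigroup \<xi> ?Af)\<bar>
          \<le> (u (Suc i) - u i) * \<epsilon>"
      proof (rule integral_increment_close[OF kc ui(1)])
        show "u i \<le> u (Suc i)" using step h by simp
        \<comment> \<open>Both \<open>r - u i\<close> and the gap between \<open>\<xi>\<close> and
          \<open>t - u (Suc i)\<close> are at most one mesh step, which is below
          \<open>d / 2\<close>.\<close>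
        fix r assume "r \<in> {u i..u (Suc i)}"
        then show "\<bar>?k r - F (u i) (brownian_semigroup \<xi> ?Af)\<bar> \<le> \<epsilon>"
          using ui \<xi> h step[of i] by (intro mod) auto
      qed
      moreover have "D (Suc i) - D i - n i
          = ?I (u (Suc i)) - ?I (u i) - (u (Suc i) - u i) * F (u i) (brownian_semigroup \<xi> ?Af)"
        using e1[of i] e1[of "Suc i"] i \<xi>(3) unfolding D_def n_def by (simp add: algebra_simps)
      ultimately show ?thesis using step[of i] by simp
    qed
    then have "(\<Sum>i<Suc m. \<bar>D (Suc i) - D i - n i\<bar>) \<le> (\<Sum>i<Suc m. h * \<epsilon>)"
      by (intro sum_mono) auto
    \<comment> \<open>The cell errors add up to \<open>t * \<epsilon>\<close> however fine the grid;
      \<open>t + 1\<close> in the choice of \<open>\<epsilon>\<close> covers \<open>t = 0\<close>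
      and makes the bound strict.\<close>
    also have "\<dots> = t * \<epsilon>" by (simp add: h_def)
    also have "\<dots> < (t + 1) * \<epsilon>" using \<epsilon> by simp
    also have "\<dots> = e" using t by (simp add: \<epsilon>_def)
    finally have "\<bar>\<Sum>i<Suc m. D (Suc i) - D i - n i\<bar> < e"
      using sum_abs[of "\<lambda>i. D (Suc i) - D i - n i" "{..<Suc m}"] by linarith
    moreover have "(\<Sum>i<Suc m. D (Suc i) - D i - n i) = D (Suc m) - D 0 - (\<Sum>i<Suc m. n i)"
      unfolding sum_subtractf[of "\<lambda>i. D (Suc i) - D i"] sum_lessThan_telescope ..
    moreover have "D (Suc m) = F t f" by (simp add: D_def g_def u_def)
    \<comment> \<open>At time 0 the drift integral runs over one point, so the equation there
      reduces to the initial value \<open>\<mu>\<close>.\<close>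
    moreover have "(LINT r:{0..0}|lborel. k r) = 0" for k :: "real \<Rightarrow> real"
      unfolding set_lebesgue_integral_def
      by (rule integral_eq_zero_AE) (use AE_lborel_singleton[of 0] in eventually_elim, auto)
    then have "D 0 = \<mu> (brownian_semigroup t f)"
      using eq[of 0 m 0] b0 by (simp add: D_def g_def u_def)
    ultimately show ?thesis unfolding real_norm_def n_def g_def u_def by (simp add: abs_minus_commute)
  qed
  then show "\<exists>no. \<forall>m\<ge>no. norm ((\<Sum>i<Suc m. \<sigma> * (b (uniform_grid t m (Suc i)) - b (uniform_grid t m i))
      * brownian_semigroup (t - uniform_grid t m (Suc i)) f c) - (F t f - \<mu> (brownian_semigroup t f))) < e"
    by (intro exI allI impI)
qed

text \<open>Evaluation at \<open>c\<close> makes the results on \<open>\<phi> (P_r f)\<close>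
  available for \<open>P_r f c\<close>; they give the continuity and the Lipschitz bound of the
  integrand.\<close>

lemma evaluation_tempered: "(\<lambda>f\<in>schwartz. f c) \<in> tempered"
proof (rule temperedI[where C = 1 and N = 0])
  fix f g a b assume "f \<in> schwartz" "g \<in> schwartz"
  then show "(\<lambda>f\<in>schwartz. f c) (\<lambda>x. a * f x + b * g x) = a * (\<lambda>f\<in>schwartz. f c) f + b * (\<lambda>f\<in>schwartz. f c) g"
    by (simp add: schwartz_lincomb)
next
  fix f assume f: "f \<in> schwartz"
  then show "\<bar>(\<lambda>f\<in>schwartz. f c) f\<bar> \<le> 1 * schwartz_norm 0 f"
    using schwartz_deriv_bounded[OF f, of 0 c] schwartz_seminorm_le_norm[OF f, of 0 0 0] by simp
qed simp

lemma continuous_on_eq_zero_rats: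
  fixes k :: "real \<Rightarrow> real"
  assumes k: "continuous_on {0..} k" and zero: "\<And>q. q \<in> \<rat> \<Longrightarrow> q \<ge> 0 \<Longrightarrow> k q = 0" and t: "t \<ge> 0"
  shows "k t = 0"
proof (rule ccontr)
  assume "k t \<noteq> 0"
  then obtain d where d: "d > 0" "\<And>s. s \<in> {0..} \<Longrightarrow> dist s t < d \<Longrightarrow> dist (k s) (k t) < \<bar>k t\<bar>"
    using k t unfolding continuous_on_iff by (metis atLeast_iff zero_less_abs_iff)
  \<comment> \<open>Approaching \<open>t\<close> from the right keeps \<open>q\<close> nonnegative
    even for \<open>t = 0\<close>.\<close>
  obtain q where q: "q \<in> \<rat>" "t < q" "q < t + d"
    using Rats_dense_in_real[of t "t + d"] d(1) by auto
  then show False using d(2)[of q] zero[of q] t by (simp add: dist_real_def)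
qed

subsection \<open>The stochastic equation\<close>

text \<open>The candidate is the asserted formula solved for the stochastic integral. It inherits
  measurability from \<open>Z\<close>, since \<open>\<mu> (P_t f)\<close> is a constant.\<close>

lemma mild_solution_wiener_integral:
  fixes M :: "'a measure"
    and B :: "real \<Rightarrow> 'a \<Rightarrow> real"
    and Z :: "real \<Rightarrow> 'a \<Rightarrow> (real \<Rightarrow> real) \<Rightarrow> real"
    and \<mu> :: "(real \<Rightarrow> real) \<Rightarrow> real"
    and \<sigma> c :: real
  assumes M: "prob_space M" and \<sigma>: "\<sigma> > 0" and B: "standard_brownian_motion M B"
    and Zm: "\<And>t f. t \<ge> 0 \<Longrightarrow> f \<in> schwartz \<Longrightarrow> (\<lambda>\<omega>. Z t \<omega> f) \<in> borel_measurable M"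
    and Zc: "\<And>\<omega>. \<omega> \<in> space M \<Longrightarrow>
           continuous_map (top_of_set {0..}) strong_dual_topology (\<lambda>t. Z t \<omega>)"
    and Z: "\<And>t f. t \<ge> 0 \<Longrightarrow> f \<in> schwartz \<Longrightarrow>
           AE \<omega> in M. Z t \<omega> f = \<mu> f + \<sigma> * B t \<omega> * f c
             + (LINT s:{0..t}|lborel. Z s \<omega> (half_laplacian f))"
    and t: "t \<ge> 0" and f: "f \<in> schwartz"
  shows "is_wiener_integral M B t (\<lambda>s. brownian_semigroup (t - s) f c)
    (\<lambda>\<omega>. (Z t \<omega> f - \<mu> (brownian_semigroup t f)) / \<sigma>)"
proof -
  let ?h = "\<lambda>s. brownian_semigroup (t - s) f c"
  obtain C N where C: "C \<ge> 0" "\<And>g a b. g \<in> schwartz \<Longrightarrow> a \<in> {0..t} \<Longrightarrow> b \<in> {0..t} \<Longrightarrow>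
      \<bar>(\<lambda>f\<in>schwartz. f c) (brownian_semigroup b g) - (\<lambda>f\<in>schwartz. f c) (brownian_semigroup a g)\<bar>
        \<le> C * \<bar>b - a\<bar> * schwartz_norm N g"
    by (rule tempered_semigroup_lipschitz[OF evaluation_tempered, of t c]) (rule that)
  have P: "brownian_semigroup (t - s) f \<in> schwartz" if "s \<in> {0..t}" for s
    using that by (intro schwartz_brownian_semigroup f) auto
  have lip: "\<bar>?h r - ?h s\<bar> \<le> C * schwartz_norm N f * \<bar>r - s\<bar>" if "r \<in> {0..t}" "s \<in> {0..t}" for r s
    using C(2)[OF f, of "t - s" "t - r"] that P by (simp add: abs_minus_commute mult_ac)
  have L: "C * schwartz_norm N f \<ge> 0" using C schwartz_norm_nonneg[OF f] by simp
  have "continuous_on {0..t} ?h"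
  proof -
    have "continuous_on {0..t} (\<lambda>s. (\<lambda>f\<in>schwartz. f c) (brownian_semigroup (t - s) f))"
      by (rule continuous_on_compose2[OF tempered_semigroup_continuous_on[OF evaluation_tempered f]])
        (auto intro!: continuous_intros)
    then show ?thesis
      by (rule continuous_on_eq) (simp add: P)
  qed
  then have h: "set_borel_measurable lborel {0..t} ?h"
    using borel_integrable_atLeastAtMost'[of 0 t ?h] borel_measurable_integrable
    unfolding set_integrable_def set_borel_measurable_def by blast
  \<comment> \<open>The triples \<open>(m, i, j)\<close> are countably many, so one null set serves
    all grids together.\<close>
  have "AE \<omega> in M. \<forall>m i j. i \<le> Suc m \<longrightarrow> j \<le> Suc m \<longrightarrow>
      Z (uniform_grid t m i) \<omega> (brownian_semigroup (t - uniform_grid t m j) f)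
      = \<mu> (brownian_semigroup (t - uniform_grid t m j) f)
        + \<sigma> * B (uniform_grid t m i) \<omega> * brownian_semigroup (t - uniform_grid t m j) f c
        + (LINT r:{0..uniform_grid t m i}|lborel. Z r \<omega> (half_laplacian (brownian_semigroup (t - uniform_grid t m j) f)))"
    unfolding AE_all_countable
  proof (intro allI)
    fix m i j
    show "AE \<omega> in M. i \<le> Suc m \<longrightarrow> j \<le> Suc m \<longrightarrow>
      Z (uniform_grid t m i) \<omega> (brownian_semigroup (t - uniform_grid t m j) f)
      = \<mu> (brownian_semigroup (t - uniform_grid t m j) f)
        + \<sigma> * B (uniform_grid t m i) \<omega> * brownian_semigroup (t - uniform_grid t m j) f c
        + (LINT r:{0..uniform_grid t m i}|lborel. Z r \<omega> (half_laplacian (brownian_semigroup (t - uniform_grid t m j) f)))"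
    proof (cases "i \<le> Suc m \<and> j \<le> Suc m")
      case True
      then show ?thesis
        using Z[OF uniform_grid_bounds(1)[OF t, of i m] P[of "uniform_grid t m j"]]
          uniform_grid_bounds[OF t, of j m] by simp
    qed auto
  qed
  moreover have "AE \<omega> in M. B 0 \<omega> = 0"
    using B by (simp add: standard_brownian_motion_def)
  ultimately have lim: "AE \<omega> in M. (\<lambda>m. step_integral B (Suc m) (uniform_grid t m) (\<lambda>i. ?h (uniform_grid t m (Suc i))) \<omega>)
      \<longlonglongrightarrow> (Z t \<omega> f - \<mu> (brownian_semigroup t f)) / \<sigma>"
    using AE_space
  proof eventually_elim
    case (elim \<omega>)
    have "(\<lambda>m. \<Sum>i<Suc m. \<sigma> * (B (uniform_grid t m (Suc i)) \<omega> - B (uniform_grid t m i) \<omega>)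
      * ?h (uniform_grid t m (Suc i))) \<longlonglongrightarrow> Z t \<omega> f - \<mu> (brownian_semigroup t f)"
      using elim(1) by (intro mild_formula_path_limit[where b = "\<lambda>s. B s \<omega>", OF Zc[OF elim(3)] f t elim(2)]) blast
    then have "(\<lambda>m. (\<Sum>i<Suc m. \<sigma> * (B (uniform_grid t m (Suc i)) \<omega> - B (uniform_grid t m i) \<omega>)
      * ?h (uniform_grid t m (Suc i))) / \<sigma>) \<longlonglongrightarrow> (Z t \<omega> f - \<mu> (brownian_semigroup t f)) / \<sigma>"
      using \<sigma> by (intro tendsto_divide tendsto_const) auto
    moreover have "(\<Sum>i<Suc m. \<sigma> * (B (uniform_grid t m (Suc i)) \<omega> - B (uniform_grid t m i) \<omega>)
      * ?h (uniform_grid t m (Suc i))) / \<sigma>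
      = step_integral B (Suc m) (uniform_grid t m) (\<lambda>i. ?h (uniform_grid t m (Suc i))) \<omega>" for m
      unfolding step_integral_def sum_divide_distrib
      using \<sigma> by (intro sum.cong refl) (simp add: mult.commute)
    ultimately show ?case by (simp only:)
  qed
  show ?thesis
    by (rule wiener_integral_by_AE_limit[OF M B h _ uniform_grid_partition[OF t]
          step_functions_uniform_grid_L2[OF t L lip] lim])
      (use Zm[OF t f] in measurable)
qed

text \<open>The second half rests on the first: every \<open>J\<close> is compared with the version
  \<open>J0\<close> built from \<open>Z\<close>, for which the formula holds by
  construction.\<close>

theorem proposition4p10:
  fixes M :: "'a measure"
    and B :: "real \<Rightarrow> 'a \<Rightarrow> real"
    and Z :: "real \<Rightarrow> 'a \<Rightarrow> (real \<Rightarrow> real) \<Rightarrow> real"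
    and \<mu> :: "(real \<Rightarrow> real) \<Rightarrow> real"
    and \<sigma> c :: real
  assumes "prob_space M"
    and "\<sigma> > 0"
    and "\<mu> \<in> tempered"
    and "standard_brownian_motion M B"
    and "\<And>t f. t \<ge> 0 \<Longrightarrow> f \<in> schwartz \<Longrightarrow> (\<lambda>\<omega>. Z t \<omega> f) \<in> borel_measurable M"
    and "\<And>\<omega>. \<omega> \<in> space M \<Longrightarrow>
           continuous_map (top_of_set {0..}) strong_dual_topology (\<lambda>t. Z t \<omega>)"
    and "\<And>t f. t \<ge> 0 \<Longrightarrow> f \<in> schwartz \<Longrightarrow>
           AE \<omega> in M. Z t \<omega> f = \<mu> f + \<sigma> * B t \<omega> * f c
             + (LINT s:{0..t}|lborel. Z s \<omega> (half_laplacian f))"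
  shows "(\<exists>J. is_stochastic_convolution M B c J) \<and>
         (\<forall>J. is_stochastic_convolution M B c J \<longrightarrow>
            (AE \<omega> in M. \<forall>t\<ge>0. \<forall>f\<in>schwartz.
               Z t \<omega> f = \<mu> (brownian_semigroup t f) + \<sigma> * J t \<omega> f))"
proof -
  have wiener: "is_wiener_integral M B t (\<lambda>s. brownian_semigroup (t - s) f c)
      (\<lambda>\<omega>. (Z t \<omega> f - \<mu> (brownian_semigroup t f)) / \<sigma>)" if "t \<ge> 0" "f \<in> schwartz" for t f
    by (rule mild_solution_wiener_integral[where Z = Z and \<mu> = \<mu> and \<sigma> = \<sigma>]) (rule assms that | assumption)+
  define G where "G t = (\<lambda>f\<in>schwartz. \<mu> (brownian_semigroup t f))" for t
  \<comment> \<open>The restriction makes \<open>J0 t \<omega>\<close> extensional, and the linear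
    combination fits \<open>strongly_continuous_lincomb\<close>; \<open>G\<close> is the path
    \<open>t \<mapsto> \<mu> \<circ> P_t\<close>.\<close>
  define J0 where "J0 t \<omega> = (\<lambda>f\<in>schwartz. (1 / \<sigma>) * Z t \<omega> f + (- 1 / \<sigma>) * G t f)" for t \<omega>
  have J0_eq: "J0 t \<omega> f = (Z t \<omega> f - \<mu> (brownian_semigroup t f)) / \<sigma>" if "f \<in> schwartz" for t \<omega> f
    using that by (simp add: J0_def G_def diff_divide_distrib)
  have J0_cont: "continuous_map (top_of_set {0..}) strong_dual_topology (\<lambda>t. J0 t \<omega>)" if "\<omega> \<in> space M" for \<omega>
    unfolding J0_def G_def
    by (intro strongly_continuous_lincomb assms(6) that strongly_continuous_semigroup assms(3))
  have J0: "is_stochastic_convolution M B c J0"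
    unfolding is_stochastic_convolution_def
  proof (intro conjI allI ballI impI)
    show "is_wiener_integral M B t (\<lambda>s. brownian_semigroup (t - s) f c) (\<lambda>\<omega>. J0 t \<omega> f)"
      if "t \<ge> 0" "f \<in> schwartz" for t f
      unfolding J0_eq[OF that(2)] by (rule wiener[OF that])
  qed (rule J0_cont)
  have "AE \<omega> in M. \<forall>t\<ge>0. \<forall>f\<in>schwartz. Z t \<omega> f = \<mu> (brownian_semigroup t f) + \<sigma> * J t \<omega> f"
    if J: "is_stochastic_convolution M B c J" for J
  proof -
    obtain D where D: "countable D" "D \<subseteq> schwartz"
      and dense: "\<And>f N e. f \<in> schwartz \<Longrightarrow> e > 0 \<Longrightarrow> \<exists>g\<in>D. schwartz_norm N (\<lambda>x. f x - g x) < e"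
      by (rule schwartz_separable) (rule that)
    have J_cont: "continuous_map (top_of_set {0..}) strong_dual_topology (\<lambda>t. J t \<omega>)" if "\<omega> \<in> space M" for \<omega>
      using J that by (simp add: is_stochastic_convolution_def)
    have Q: "countable {q \<in> \<rat>. q \<ge> (0::real)}"
      by (rule countable_subset[OF _ countable_rat]) auto
    have "AE \<omega> in M. \<forall>q\<in>{q \<in> \<rat>. q \<ge> 0}. \<forall>g\<in>D. J q \<omega> g = J0 q \<omega> g"
      unfolding AE_ball_countable[OF Q] AE_ball_countable[OF D(1)]
    proof (intro ballI)
      fix q g assume "q \<in> {q \<in> \<rat>. q \<ge> (0::real)}" "g \<in> D"
      then show "AE \<omega> in M. J q \<omega> g = J0 q \<omega> g"
        using J J0 D(2) unfolding is_stochastic_convolution_def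
        by (intro wiener_integral_unique[OF assms(1,4), of q "\<lambda>s. brownian_semigroup (q - s) g c"]) auto
    qed
    then show ?thesis
      using AE_space
    proof eventually_elim
      case (elim \<omega>)
      \<comment> \<open>Time is extended first, for fixed \<open>g \<in> D\<close>; the test
        function follows, at each fixed time, through the density of \<open>D\<close>.\<close>
      have eq: "J t \<omega> g = J0 t \<omega> g" if t: "t \<ge> 0" and g: "g \<in> D" for t g
      proof -
        have gs: "g \<in> schwartz" using g D(2) by auto
        have "J t \<omega> g - J0 t \<omega> g = 0"
        proof (rule continuous_on_eq_zero_rats[OF continuous_on_diff[OF
                strongly_continuous_imp_continuous_on[OF J_cont[OF elim(2)] gs]
                strongly_continuous_imp_continuous_on[OF J0_cont[OF elim(2)] gs]] _ t])
          show "J q \<omega> g - J0 q \<omega> g = 0" if "q \<in> \<rat>" "q \<ge> 0" for q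
            using elim(1) g that by simp
        qed
        then show ?thesis by simp
      qed
      show ?case
      proof (intro allI impI ballI)
        fix t :: real and f assume t: "t \<ge> 0" and f: "f \<in> schwartz"
        have "J t \<omega> f = J0 t \<omega> f"
          by (rule tempered_eq_on_dense[OF strongly_continuous_imp_tempered[OF J_cont[OF elim(2)] t]
                strongly_continuous_imp_tempered[OF J0_cont[OF elim(2)] t] D(2) dense eq[OF t] f])
        then show "Z t \<omega> f = \<mu> (brownian_semigroup t f) + \<sigma> * J t \<omega> f"
          using assms(2) by (simp add: J0_eq[OF f])
      qed
    qed
  qed
  with J0 show ?thesis by blast
qed

end
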